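(* Let $\mathcal{O}$ be a cyclic multiplicative operad of graded modules. Then $(HH(\mathcal{O}),\bullet,[\cdot,\cdot],B)$ is a BV-algebra with respect to the grading $|\cdot|$.
   Context: BV-algebras. A $k$-Poisson algebra is a graded commutative algebra $A$ with a graded Lie bracket $[-,-]:A\times A\to A$ of degree $k$ (i.e. antisymmetry and the Jacobi identity hold with the usual signs for degrees shifted by $k$) satisfying $[x,yz]=[x,y]z+(-1)^{(\deg x+k)\deg y}y[x,z]$. A BV-algebra is a $1$-Poisson algebra $A$ with a degree one operation $\Delta:A\to A$ such that $\Delta\circ\Delta=0$ and $\Delta(xy)=\Delta(x)y+(-1)^{\deg x}x\Delta(y)+(-1)^{\deg x}[x,y]$. Operads. Operads are in the category of graded modules over a commutative ground ring (with the Koszul sign rule). For $x\in\mathcal{O}(l)$, write $\tilde x$ for its grading in the graded module $\mathcal{O}(l)$, i.e. $x\in\mathcal{O}(l)_{\tilde x}$. For $x\in\mathcal{O}(l)$, $y\in\mathcal{O}(m)$, $x\circ_iy=x(\mathrm{id},\dots,\mathrm{id},y,\mathrm{id},\dots,\mathrm{id})\in\mathcal{O}(l+m-1)$ with $y$ in the $i$-th place, $\mathrm{id}\in\mathcal{O}(1)$ the identity element. A multiplicative operad is a non-symmetric operad $\mathcal{O}=\{\mathcal{O}(k)\}_{k\ge0}$ of graded modules with a morphism from the associative (non-symmetric, unital) operad, one generator of degree $0$ in each arity $k\ge 0$; equivalently there are degree-$0$ elements $\mu\in\mathcal{O}(2)$ (the multiplication) and $e\in\mathcal{O}(0)$ (the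 unit) with $\mu\circ_1\mu=\mu\circ_2\mu$ and $\mu\circ_1e=\mathrm{id}=\mu\circ_2e$. It is a cosimplicial graded module with $d^i:\mathcal{O}(k-1)\to\mathcal{O}(k)$, $d^0x=\mu(\mathrm{id},x)$, $d^ix=x\circ_i\mu$ for $0<i<k$, $d^kx=\mu(x,\mathrm{id})$, and $s^i:\mathcal{O}(k+1)\to\mathcal{O}(k)$, $s^ix=x\circ_{i+1}e$, $0\le i\le k$. A cyclic multiplicative operad is a multiplicative operad with grading-preserving linear maps $\tau_k:\mathcal{O}(k)\to\mathcal{O}(k)$ ($k\ge0$) such that $\tau_k^{k+1}=\mathrm{id}$, $\tau_0(e)=e$, $\tau_2(\mu)=\mu$ and, for $x\in\mathcal{O}(l)$, $y\in\mathcal{O}(m)$: $\tau_{l+m-1}(x\circ_iy)=\tau_l(x)\circ_{i-1}y$ if $i\ge2$, and $\tau_{l+m-1}(x\circ_1y)=(-1)^{\tilde x\tilde y}\tau_m(y)\circ_m\tau_l(x)$ (for $m\ge1$). Hochschild homology. Put $\partial_k=d^0-d^1+\dots+(-1)^{k+1}d^{k+1}:\mathcal{O}(k)\to\mathcal{O}(k+1)$; then $(\mathcal{O},\partial)$ is a complex, with total degree $|x|=\tilde x-l$ for $x\in\mathcal{O}(l)$, and $HH(\mathcal{O})=H_*(\mathcal{O},\partial)$. The normalized subcomplex $\tilde{\mathcal{O}}(k)=\bigcap_{0\le i\le k-1}\ker(s^i:\mathcal{O}(k)\to\mathcal{O}(k-1))$ is quasi-isomorphic to $\mathcal{O}$ via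 inclusion. Operations on $HH(\mathcal{O})$ are induced by the following, for $x\in\mathcal{O}(l)$, $y\in\mathcal{O}(m)$: $x\bullet y=(-1)^{l\tilde y}\mu(x,y)\in\mathcal{O}(l+m)_{\tilde x+\tilde y}$; $[x,y]=x\bar\circ y-(-1)^{(|x|+1)(|y|+1)}y\bar\circ x\in\mathcal{O}(l+m-1)_{\tilde x+\tilde y}$, where $x\bar\circ y=\sum_{1\le i\le l}(-1)^{(m-1)(l-i)+(l-1)\tilde y}x\circ_iy$. (It is known, by work of Tourtchine, that these make $HH(\mathcal{O})$ a $1$-Poisson algebra with respect to $|\cdot|$.) Connes' boundary operation $B$ on $HH(\mathcal{O})$ is induced by the maps on the normalized complex $B_k:\tilde{\mathcal{O}}(k)\to\tilde{\mathcal{O}}(k-1)$, $B_k(x)=(-1)^{\tilde x}\sum_{1\le i\le k}(-1)^{i(k-1)}\tau_{k-1}^{-i}s^{k-1}\tau_k(x)$ for $k\ge1$ and $B_0=0$, which satisfy $B_kB_{k+1}=0$ and $B_{k+1}\partial_k=-\partial_{k-1}B_k$. *)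

theory Defs
  imports
    "HOL-Library.Poly_Mapping"
    "HOL-Algebra.Algebraic_Closure_Type"
begin

section \<open>Graded algebras, Poisson algebras and BV-algebras\<close>

text \<open>
  A graded module over \<open>R\<close> is a family \<open>A :: int \<Rightarrow> _\<close> of modules in the sense of HOL-Algebra.
  Operations take the degrees of their arguments as additional parameters: \<open>mul p q x y\<close> is the
  product of \<open>x\<close> in \<open>A p\<close> and \<open>y\<close> in \<open>A q\<close>.
\<close>

definition msign :: "('r, 'h, 'n) module_scheme \<Rightarrow> int \<Rightarrow> 'h \<Rightarrow> 'h" where
  "msign M n x = (if even n then x else \<ominus>\<^bsub>M\<^esub> x)"

definition graded_linear ::
  "('r, 'm) ring_scheme \<Rightarrow> (int \<Rightarrow> ('r, 'h, 'n) module_scheme) \<Rightarrow> int \<Rightarrow> (int \<Rightarrow> 'h \<Rightarrow> 'h) \<Rightarrow> bool" where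
  "graded_linear R A k f \<longleftrightarrow>
    (\<forall>p. \<forall>x \<in> carrier (A p).
       f p x \<in> carrier (A (p + k)) \<and>
       (\<forall>x' \<in> carrier (A p). f p (x \<oplus>\<^bsub>A p\<^esub> x') = f p x \<oplus>\<^bsub>A (p + k)\<^esub> f p x') \<and>
       (\<forall>a \<in> carrier R. f p (a \<odot>\<^bsub>A p\<^esub> x) = a \<odot>\<^bsub>A (p + k)\<^esub> f p x))"

definition graded_bilinear ::
  "('r, 'm) ring_scheme \<Rightarrow> (int \<Rightarrow> ('r, 'h, 'n) module_scheme) \<Rightarrow> int \<Rightarrow>
   (int \<Rightarrow> int \<Rightarrow> 'h \<Rightarrow> 'h \<Rightarrow> 'h) \<Rightarrow> bool" where
  "graded_bilinear R A k f \<longleftrightarrow>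
    (\<forall>p q. \<forall>x \<in> carrier (A p). \<forall>y \<in> carrier (A q).
       f p q x y \<in> carrier (A (p + q + k)) \<and>
       (\<forall>x' \<in> carrier (A p).
          f p q (x \<oplus>\<^bsub>A p\<^esub> x') y = f p q x y \<oplus>\<^bsub>A (p + q + k)\<^esub> f p q x' y) \<and>
       (\<forall>y' \<in> carrier (A q).
          f p q x (y \<oplus>\<^bsub>A q\<^esub> y') = f p q x y \<oplus>\<^bsub>A (p + q + k)\<^esub> f p q x y') \<and>
       (\<forall>a \<in> carrier R.
          f p q (a \<odot>\<^bsub>A p\<^esub> x) y = a \<odot>\<^bsub>A (p + q + k)\<^esub> f p q x y \<and>
          f p q x (a \<odot>\<^bsub>A q\<^esub> y) = a \<odot>\<^bsub>A (p + q + k)\<^esub> f p q x y))"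

locale graded_comm_algebra =
  fixes R :: "('r, 'm) ring_scheme"
    and A :: "int \<Rightarrow> ('r, 'h, 'n) module_scheme"
    and mul :: "int \<Rightarrow> int \<Rightarrow> 'h \<Rightarrow> 'h \<Rightarrow> 'h"
  assumes graded_module: "\<And>p. Module.module R (A p)"
    and mul_bilinear: "graded_bilinear R A 0 mul"
    and mul_assoc: "\<And>p q r x y z. \<lbrakk>x \<in> carrier (A p); y \<in> carrier (A q); z \<in> carrier (A r)\<rbrakk> \<Longrightarrow>
      mul (p + q) r (mul p q x y) z = mul p (q + r) x (mul q r y z)"
    and mul_comm: "\<And>p q x y. \<lbrakk>x \<in> carrier (A p); y \<in> carrier (A q)\<rbrakk> \<Longrightarrow>
      mul p q x y = msign (A (p + q)) (p * q) (mul q p y x)"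
    and mul_unit: "\<exists>u \<in> carrier (A 0). \<forall>p. \<forall>x \<in> carrier (A p). mul 0 p u x = x \<and> mul p 0 x u = x"

locale poisson_algebra = graded_comm_algebra R A mul
  for k :: int
    and R :: "('r, 'm) ring_scheme"
    and A :: "int \<Rightarrow> ('r, 'h, 'n) module_scheme"
    and mul :: "int \<Rightarrow> int \<Rightarrow> 'h \<Rightarrow> 'h \<Rightarrow> 'h" +
  fixes br :: "int \<Rightarrow> int \<Rightarrow> 'h \<Rightarrow> 'h \<Rightarrow> 'h"
  assumes br_bilinear: "graded_bilinear R A k br"
    and br_antisym: "\<And>p q x y. \<lbrakk>x \<in> carrier (A p); y \<in> carrier (A q)\<rbrakk> \<Longrightarrow>
      br p q x y = \<ominus>\<^bsub>A (p + q + k)\<^esub> msign (A (p + q + k)) ((p + k) * (q + k)) (br q p y x)"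
    and br_jacobi: "\<And>p q r x y z. \<lbrakk>x \<in> carrier (A p); y \<in> carrier (A q); z \<in> carrier (A r)\<rbrakk> \<Longrightarrow>
      br p (q + r + k) x (br q r y z) =
        br (p + q + k) r (br p q x y) z \<oplus>\<^bsub>A (p + q + r + 2 * k)\<^esub>
        msign (A (p + q + r + 2 * k)) ((p + k) * (q + k)) (br q (p + r + k) y (br p r x z))"
    and br_derivation:
      "\<And>p q r x y z. \<lbrakk>x \<in> carrier (A p); y \<in> carrier (A q); z \<in> carrier (A r)\<rbrakk> \<Longrightarrow>
      br p (q + r) x (mul q r y z) =
        mul (p + q + k) r (br p q x y) z \<oplus>\<^bsub>A (p + q + r + k)\<^esub>
        msign (A (p + q + r + k)) ((p + k) * q) (mul q (p + r + k) y (br p r x z))"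

locale BV_algebra = poisson_algebra 1 R A mul br
  for R :: "('r, 'm) ring_scheme"
    and A :: "int \<Rightarrow> ('r, 'h, 'n) module_scheme"
    and mul br :: "int \<Rightarrow> int \<Rightarrow> 'h \<Rightarrow> 'h \<Rightarrow> 'h" +
  fixes \<Delta> :: "int \<Rightarrow> 'h \<Rightarrow> 'h"
  assumes Delta_linear: "graded_linear R A 1 \<Delta>"
    and Delta_square: "\<And>p x. x \<in> carrier (A p) \<Longrightarrow> \<Delta> (p + 1) (\<Delta> p x) = \<zero>\<^bsub>A (p + 2)\<^esub>"
    and Delta_mul: "\<And>p q x y. \<lbrakk>x \<in> carrier (A p); y \<in> carrier (A q)\<rbrakk> \<Longrightarrow>
      \<Delta> (p + q) (mul p q x y) =
        mul (p + 1) q (\<Delta> p x) y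
        \<oplus>\<^bsub>A (p + q + 1)\<^esub> msign (A (p + q + 1)) p (mul p (q + 1) x (\<Delta> q y))
        \<oplus>\<^bsub>A (p + q + 1)\<^esub> msign (A (p + q + 1)) p (br p q x y)"


section \<open>Cyclic multiplicative operads\<close>

text \<open>
  All the modules \<open>\<O>(l)\<^sub>d\<close> (arity \<open>l\<close>, degree \<open>d\<close>) are submodules of one ambient module, which is
  no restriction because an arbitrary family of modules embeds into its direct sum. They are not
  required to be independent: arity and degree are always carried along. The operations are total
  on the ambient module, but are only constrained, and only used, on the submodules.

  \<open>pcomp \<O> l m i x y\<close> is the partial composition \<open>x \<circ>\<^sub>i y\<close> for \<open>x\<close> in \<open>\<O>(l)\<close>, \<open>y\<close> in \<open>\<O>(m)\<close> and
  \<open>1 \<le> i \<le> l\<close>; an operad is given by its partial compositions.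
\<close>

definition ksign :: "int \<Rightarrow> 'a::ab_group_add \<Rightarrow> 'a" where
  "ksign n x = (if even n then x else - x)"

record ('r, 'a) ns_operad =
  scl :: "'r \<Rightarrow> 'a \<Rightarrow> 'a"
  comps :: "nat \<Rightarrow> int \<Rightarrow> 'a set"
  pcomp :: "nat \<Rightarrow> nat \<Rightarrow> nat \<Rightarrow> 'a \<Rightarrow> 'a \<Rightarrow> 'a"
  ident :: 'a

record ('r, 'a) mult_operad = "('r, 'a) ns_operad" +
  mu :: 'a
  unt :: 'a

record ('r, 'a) cyclic_operad = "('r, 'a) mult_operad" +
  tau :: "nat \<Rightarrow> 'a \<Rightarrow> 'a"

locale nonsymmetric_operad = Modules.module "scl \<O>"
  for \<O> :: "('r::comm_ring_1, 'a::ab_group_add, 'z) ns_operad_scheme" +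
  assumes subspace_comps: "\<And>l d. Modules.module.subspace (scl \<O>) (comps \<O> l d)"
    and pcomp_closed: "\<And>l m p q i x y.
      \<lbrakk>1 \<le> i; i \<le> l; x \<in> comps \<O> l p; y \<in> comps \<O> m q\<rbrakk> \<Longrightarrow>
      pcomp \<O> l m i x y \<in> comps \<O> (l + m - 1) (p + q)"
    and pcomp_add_left: "\<And>l m p q i x x' y.
      \<lbrakk>1 \<le> i; i \<le> l; x \<in> comps \<O> l p; x' \<in> comps \<O> l p; y \<in> comps \<O> m q\<rbrakk> \<Longrightarrow>
      pcomp \<O> l m i (x + x') y = pcomp \<O> l m i x y + pcomp \<O> l m i x' y"
    and pcomp_add_right: "\<And>l m p q i x y y'.
      \<lbrakk>1 \<le> i; i \<le> l; x \<in> comps \<O> l p; y \<in> comps \<O> m q; y' \<in> comps \<O> m q\<rbrakk> \<Longrightarrow>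
      pcomp \<O> l m i x (y + y') = pcomp \<O> l m i x y + pcomp \<O> l m i x y'"
    and pcomp_scl_left: "\<And>l m p q i x y a.
      \<lbrakk>1 \<le> i; i \<le> l; x \<in> comps \<O> l p; y \<in> comps \<O> m q\<rbrakk> \<Longrightarrow>
      pcomp \<O> l m i (scl \<O> a x) y = scl \<O> a (pcomp \<O> l m i x y)"
    and pcomp_scl_right: "\<And>l m p q i x y a.
      \<lbrakk>1 \<le> i; i \<le> l; x \<in> comps \<O> l p; y \<in> comps \<O> m q\<rbrakk> \<Longrightarrow>
      pcomp \<O> l m i x (scl \<O> a y) = scl \<O> a (pcomp \<O> l m i x y)"
    and ident_closed: "ident \<O> \<in> comps \<O> 1 0"
    and ident_left: "\<And>m q y. y \<in> comps \<O> m q \<Longrightarrow> pcomp \<O> 1 m 1 (ident \<O>) y = y"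
    and ident_right: "\<And>l p i x. \<lbrakk>1 \<le> i; i \<le> l; x \<in> comps \<O> l p\<rbrakk> \<Longrightarrow>
      pcomp \<O> l 1 i x (ident \<O>) = x"
    and pcomp_sequential: "\<And>l m n p q r i j x y z.
      \<lbrakk>1 \<le> i; i \<le> l; 1 \<le> j; j \<le> m;
       x \<in> comps \<O> l p; y \<in> comps \<O> m q; z \<in> comps \<O> n r\<rbrakk> \<Longrightarrow>
      pcomp \<O> (l + m - 1) n (i + j - 1) (pcomp \<O> l m i x y) z =
      pcomp \<O> l (m + n - 1) i x (pcomp \<O> m n j y z)"
    and pcomp_parallel: "\<And>l m n p q r i j x y z.
      \<lbrakk>1 \<le> i; i < j; j \<le> l;
       x \<in> comps \<O> l p; y \<in> comps \<O> m q; z \<in> comps \<O> n r\<rbrakk> \<Longrightarrow>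
      pcomp \<O> (l + m - 1) n (j + m - 1) (pcomp \<O> l m i x y) z =
      ksign (q * r) (pcomp \<O> (l + n - 1) m i (pcomp \<O> l n j x z) y)"

locale multiplicative_operad = nonsymmetric_operad \<O>
  for \<O> :: "('r::comm_ring_1, 'a::ab_group_add, 'z) mult_operad_scheme" +
  assumes mu_closed: "mu \<O> \<in> comps \<O> 2 0"
    and unt_closed: "unt \<O> \<in> comps \<O> 0 0"
    and mu_assoc: "pcomp \<O> 2 2 1 (mu \<O>) (mu \<O>) = pcomp \<O> 2 2 2 (mu \<O>) (mu \<O>)"
    and mu_unt_left: "pcomp \<O> 2 0 1 (mu \<O>) (unt \<O>) = ident \<O>"
    and mu_unt_right: "pcomp \<O> 2 0 2 (mu \<O>) (unt \<O>) = ident \<O>"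

locale cyclic_multiplicative_operad = multiplicative_operad \<O>
  for \<O> :: "('r::comm_ring_1, 'a::ab_group_add, 'z) cyclic_operad_scheme" +
  assumes tau_closed: "\<And>k d x. x \<in> comps \<O> k d \<Longrightarrow> tau \<O> k x \<in> comps \<O> k d"
    and tau_add: "\<And>k d x x'. \<lbrakk>x \<in> comps \<O> k d; x' \<in> comps \<O> k d\<rbrakk> \<Longrightarrow>
      tau \<O> k (x + x') = tau \<O> k x + tau \<O> k x'"
    and tau_scl: "\<And>k d x a. x \<in> comps \<O> k d \<Longrightarrow> tau \<O> k (scl \<O> a x) = scl \<O> a (tau \<O> k x)"
    and tau_cyclic: "\<And>k d x. x \<in> comps \<O> k d \<Longrightarrow> (tau \<O> k ^^ (k + 1)) x = x"
    and tau_unt: "tau \<O> 0 (unt \<O>) = unt \<O>"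
    and tau_mu: "tau \<O> 2 (mu \<O>) = mu \<O>"
    and tau_pcomp: "\<And>l m p q i x y.
      \<lbrakk>2 \<le> i; i \<le> l; x \<in> comps \<O> l p; y \<in> comps \<O> m q\<rbrakk> \<Longrightarrow>
      tau \<O> (l + m - 1) (pcomp \<O> l m i x y) = pcomp \<O> l m (i - 1) (tau \<O> l x) y"
    and tau_pcomp_first: "\<And>l m p q x y.
      \<lbrakk>1 \<le> l; 1 \<le> m; x \<in> comps \<O> l p; y \<in> comps \<O> m q\<rbrakk> \<Longrightarrow>
      tau \<O> (l + m - 1) (pcomp \<O> l m 1 x y) =
      ksign (p * q) (pcomp \<O> m l m (tau \<O> m y) (tau \<O> l x))"


section \<open>The operations on the components of an operad\<close>

text \<open>
  \<open>\<mu>(x, y)\<close> is \<open>(\<mu> \<circ>\<^sub>1 x) \<circ>\<^bsub>l+1\<^esub> y\<close>; inserting \<open>y\<close> first would permute \<open>x\<close> and \<open>y\<close> and introduce a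
  Koszul sign.
\<close>

definition mu2 :: "('r, 'a, 'z) mult_operad_scheme \<Rightarrow> nat \<Rightarrow> nat \<Rightarrow> 'a \<Rightarrow> 'a \<Rightarrow> 'a" where
  "mu2 \<O> l m x y = pcomp \<O> (l + 1) m (l + 1) (pcomp \<O> 2 l 1 (mu \<O>) x) y"

text \<open>The coface \<open>d\<^sup>i\<close> from arity \<open>k\<close> to arity \<open>k + 1\<close>.\<close>

definition coface :: "('r, 'a, 'z) mult_operad_scheme \<Rightarrow> nat \<Rightarrow> nat \<Rightarrow> 'a \<Rightarrow> 'a" where
  "coface \<O> k i x =
    (if i = 0 then mu2 \<O> 1 k (ident \<O>) x
     else if i = k + 1 then mu2 \<O> k 1 x (ident \<O>)
     else pcomp \<O> k 2 i x (mu \<O>))"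

text \<open>The codegeneracy \<open>s\<^sup>i\<close> from arity \<open>k + 1\<close> to arity \<open>k\<close>.\<close>

definition codegeneracy :: "('r, 'a, 'z) mult_operad_scheme \<Rightarrow> nat \<Rightarrow> nat \<Rightarrow> 'a \<Rightarrow> 'a" where
  "codegeneracy \<O> k i x = pcomp \<O> (k + 1) 0 (i + 1) x (unt \<O>)"

definition bdry :: "('r, 'a::ab_group_add, 'z) mult_operad_scheme \<Rightarrow> nat \<Rightarrow> 'a \<Rightarrow> 'a" where
  "bdry \<O> k x = (\<Sum>i\<le>k + 1. ksign (int i) (coface \<O> k i x))"

text \<open>
  In \<open>bullet \<O> l m q x y\<close>, \<open>circ_bar \<O> l m q x y\<close> and \<open>bracket \<O> l m p q x y\<close> the arguments \<open>l\<close>, \<open>m\<close>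
  are the arities and \<open>p\<close>, \<open>q\<close> the degrees \<open>\<tilde>x\<close>, \<open>\<tilde>y\<close> of \<open>x\<close> and \<open>y\<close>.
\<close>

definition bullet ::
  "('r, 'a::ab_group_add, 'z) mult_operad_scheme \<Rightarrow> nat \<Rightarrow> nat \<Rightarrow> int \<Rightarrow> 'a \<Rightarrow> 'a \<Rightarrow> 'a" where
  "bullet \<O> l m q x y = ksign (int l * q) (mu2 \<O> l m x y)"

definition circ_bar ::
  "('r, 'a::ab_group_add, 'z) ns_operad_scheme \<Rightarrow> nat \<Rightarrow> nat \<Rightarrow> int \<Rightarrow> 'a \<Rightarrow> 'a \<Rightarrow> 'a" where
  "circ_bar \<O> l m q x y =
    (\<Sum>i = 1..l. ksign ((int m - 1) * (int l - int i) + (int l - 1) * q) (pcomp \<O> l m i x y))"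

definition bracket ::
  "('r, 'a::ab_group_add, 'z) ns_operad_scheme \<Rightarrow> nat \<Rightarrow> nat \<Rightarrow> int \<Rightarrow> int \<Rightarrow> 'a \<Rightarrow> 'a \<Rightarrow> 'a" where
  "bracket \<O> l m p q x y =
    circ_bar \<O> l m q x y
    - ksign ((p - int l + 1) * (q - int m + 1)) (circ_bar \<O> m l p y x)"

text \<open>
  \<open>connes \<O> k d x\<close> is \<open>B\<^sub>k x\<close> for \<open>x\<close> of degree \<open>d\<close>. The power \<open>k - i\<close> of \<open>\<tau>\<^bsub>k-1\<^esub>\<close> is its power \<open>-i\<close>,
  since \<open>\<tau>\<^bsub>k-1\<^esub>\<close> has order dividing \<open>k\<close>. For \<open>k = 0\<close> the sum is empty.
\<close>

definition connes :: "('r, 'a::ab_group_add, 'z) cyclic_operad_scheme \<Rightarrow> nat \<Rightarrow> int \<Rightarrow> 'a \<Rightarrow> 'a" where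
  "connes \<O> k d x =
    ksign d (\<Sum>i = 1..k. ksign (int i * (int k - 1))
      ((tau \<O> (k - 1) ^^ (k - i)) (codegeneracy \<O> (k - 1) (k - 1) (tau \<O> k x))))"


section \<open>Hochschild homology\<close>

text \<open>
  The total complex is the direct sum over all arities: a chain of total degree \<open>n\<close> is a finitely
  supported family with entry of arity \<open>l\<close> in \<open>\<O>(l)\<^bsub>l+n\<^esub>\<close>. The differential lowers the total
  degree by one.
\<close>

definition chains :: "('r, 'a::zero, 'z) ns_operad_scheme \<Rightarrow> int \<Rightarrow> (nat \<Rightarrow>\<^sub>0 'a) set" where
  "chains \<O> n = {x. \<forall>l. Poly_Mapping.lookup x l \<in> comps \<O> l (int l + n)}"

definition diff ::
  "('r, 'a::ab_group_add, 'z) mult_operad_scheme \<Rightarrow> (nat \<Rightarrow>\<^sub>0 'a) \<Rightarrow> (nat \<Rightarrow>\<^sub>0 'a)" where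
  "diff \<O> x = (\<Sum>k \<in> Poly_Mapping.keys x.
     Poly_Mapping.single (k + 1) (bdry \<O> k (Poly_Mapping.lookup x k)))"

definition cycles :: "('r, 'a::ab_group_add, 'z) mult_operad_scheme \<Rightarrow> int \<Rightarrow> (nat \<Rightarrow>\<^sub>0 'a) set" where
  "cycles \<O> n = {x \<in> chains \<O> n. diff \<O> x = 0}"

definition boundaries :: "('r, 'a::ab_group_add, 'z) mult_operad_scheme \<Rightarrow> int \<Rightarrow> (nat \<Rightarrow>\<^sub>0 'a) set" where
  "boundaries \<O> n = diff \<O> ` chains \<O> (n + 1)"

definition normalized :: "('r, 'a::ab_group_add, 'z) mult_operad_scheme \<Rightarrow> (nat \<Rightarrow>\<^sub>0 'a) set" where
  "normalized \<O> = {x. \<forall>k. \<forall>i<k. codegeneracy \<O> (k - 1) i (Poly_Mapping.lookup x k) = 0}"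

definition tot_bullet ::
  "('r, 'a::ab_group_add, 'z) mult_operad_scheme \<Rightarrow> int \<Rightarrow> int \<Rightarrow>
   (nat \<Rightarrow>\<^sub>0 'a) \<Rightarrow> (nat \<Rightarrow>\<^sub>0 'a) \<Rightarrow> (nat \<Rightarrow>\<^sub>0 'a)" where
  "tot_bullet \<O> p q x y = (\<Sum>l \<in> Poly_Mapping.keys x. \<Sum>m \<in> Poly_Mapping.keys y.
     Poly_Mapping.single (l + m)
       (bullet \<O> l m (int m + q) (Poly_Mapping.lookup x l) (Poly_Mapping.lookup y m)))"

text \<open>For \<open>l = m = 0\<close> the truncated \<open>l + m - 1\<close> below is harmless, as the bracket is then an empty sum.\<close>

definition tot_bracket ::
  "('r, 'a::ab_group_add, 'z) mult_operad_scheme \<Rightarrow> int \<Rightarrow> int \<Rightarrow>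
   (nat \<Rightarrow>\<^sub>0 'a) \<Rightarrow> (nat \<Rightarrow>\<^sub>0 'a) \<Rightarrow> (nat \<Rightarrow>\<^sub>0 'a)" where
  "tot_bracket \<O> p q x y = (\<Sum>l \<in> Poly_Mapping.keys x. \<Sum>m \<in> Poly_Mapping.keys y.
     Poly_Mapping.single (l + m - 1)
       (bracket \<O> l m (int l + p) (int m + q) (Poly_Mapping.lookup x l) (Poly_Mapping.lookup y m)))"

definition tot_connes ::
  "('r, 'a::ab_group_add, 'z) cyclic_operad_scheme \<Rightarrow> int \<Rightarrow> (nat \<Rightarrow>\<^sub>0 'a) \<Rightarrow> (nat \<Rightarrow>\<^sub>0 'a)" where
  "tot_connes \<O> n x = (\<Sum>k \<in> Poly_Mapping.keys x.
     Poly_Mapping.single (k - 1) (connes \<O> k (int k + n) (Poly_Mapping.lookup x k)))"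

text \<open>
  Homology classes are cosets of the boundaries. An operation on classes is the union of the classes
  of the results over all choices of representatives. Such a union is a class only if there is a
  choice and the result does not depend on it, so the closure conditions of a BV-algebra include the
  assertion that the operation is induced on homology. For \<open>B\<close> the representatives range over the
  normalized cycles in the class.
\<close>

definition hclass ::
  "('r, 'a::ab_group_add, 'z) mult_operad_scheme \<Rightarrow> int \<Rightarrow> (nat \<Rightarrow>\<^sub>0 'a) \<Rightarrow> (nat \<Rightarrow>\<^sub>0 'a) set" where
  "hclass \<O> n x = {x + b | b. b \<in> boundaries \<O> n}"

text \<open>The fields \<^const>\<open>monoid.mult\<close> and \<^const>\<open>monoid.one\<close> of a module record are meaningless.\<close>

definition HH ::
  "('r, 'a::ab_group_add, 'z) mult_operad_scheme \<Rightarrow> int \<Rightarrow> ('r, (nat \<Rightarrow>\<^sub>0 'a) set) module" where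
  "HH \<O> n =
    \<lparr>carrier = hclass \<O> n ` cycles \<O> n,
     monoid.mult = (\<lambda>_ _. undefined), one = undefined,
     ring.zero = hclass \<O> n 0,
     add = (\<lambda>U V. \<Union>x\<in>U. \<Union>y\<in>V. hclass \<O> n (x + y)),
     module.smult = (\<lambda>a U. \<Union>x\<in>U. hclass \<O> n (Poly_Mapping.map (scl \<O> a) x))\<rparr>"

definition HH_bullet ::
  "('r, 'a::ab_group_add, 'z) mult_operad_scheme \<Rightarrow> int \<Rightarrow> int \<Rightarrow>
   (nat \<Rightarrow>\<^sub>0 'a) set \<Rightarrow> (nat \<Rightarrow>\<^sub>0 'a) set \<Rightarrow> (nat \<Rightarrow>\<^sub>0 'a) set" where
  "HH_bullet \<O> p q U V = (\<Union>x\<in>U. \<Union>y\<in>V. hclass \<O> (p + q) (tot_bullet \<O> p q x y))"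

definition HH_bracket ::
  "('r, 'a::ab_group_add, 'z) mult_operad_scheme \<Rightarrow> int \<Rightarrow> int \<Rightarrow>
   (nat \<Rightarrow>\<^sub>0 'a) set \<Rightarrow> (nat \<Rightarrow>\<^sub>0 'a) set \<Rightarrow> (nat \<Rightarrow>\<^sub>0 'a) set" where
  "HH_bracket \<O> p q U V = (\<Union>x\<in>U. \<Union>y\<in>V. hclass \<O> (p + q + 1) (tot_bracket \<O> p q x y))"

definition HH_B ::
  "('r, 'a::ab_group_add, 'z) cyclic_operad_scheme \<Rightarrow> int \<Rightarrow>
   (nat \<Rightarrow>\<^sub>0 'a) set \<Rightarrow> (nat \<Rightarrow>\<^sub>0 'a) set" where
  "HH_B \<O> n U = (\<Union>x \<in> U \<inter> normalized \<O>. hclass \<O> (n + 1) (tot_connes \<O> n x))"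

end

theory Submission
  imports Defs
begin

text \<open>
  \<^bold>\<open>Signs.\<close> Give an operation of arity \<open>l\<close> and degree \<open>p\<close> the suspended degree \<open>a = p - l + 1\<close>, which
  is its total degree plus one, and absorb the sign in the definition of \<open>x \<circ>\<^bsub>bar\<^esub> y\<close> into the partial
  compositions. The result is again an operad in which every sign is the Koszul sign of a transposition.
  Multiplication \<open>\<mu>\<close> then has degree \<open>-1\<close> and the unit \<open>e\<close> degree \<open>1\<close>, \<open>x \<circ>\<^bsub>bar\<^esub> y\<close> is the plain sum
  of all insertions of \<open>y\<close> into \<open>x\<close>, its graded commutator is the bracket, and up to a sign that depends
  only on \<open>p\<close> the differential is \<open>d = [\<mu>, -]\<close>. Also \<open>(-1)\<^sup>l \<tau>\<close> is again a cyclic operator \<open>\<sigma>\<close>.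

  \<^bold>\<open>The Poisson algebra.\<close> The product is associative and the bracket satisfies the Jacobi identity on
  chains, the latter because insertion is a pre-Lie product. The other laws hold up to boundaries. The
  faces of \<open>x\<close> come in a linear order: \<open>\<mu> \<circ>\<^sub>2 x\<close>, then \<open>x \<circ>\<^sub>i \<mu>\<close>, then \<open>\<mu> \<circ>\<^sub>1 x\<close>. Cutting this list at input
  \<open>k\<close> gives \<open>d = L k + R k\<close>, and the boundary of \<open>x \<circ>\<^sub>j y\<close> for a cycle \<open>y\<close> is
  \<open>(R j x) \<circ>\<^sub>j y + (L (j + 1) x) \<circ>\<^bsub>j+1\<^esub> y\<close>. When such boundaries are summed over \<open>j\<close> and the equations
  \<open>(d x) \<circ>\<^sub>j y = 0\<close> are subtracted, everything cancels but the terms at the two ends. For the sum of the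
  \<open>x \<circ>\<^sub>j y\<close> the end terms give commutativity of the product (\<open>cup_comm\<close>), for the sum of
  \<open>(x \<circ>\<^sub>j z) \<circ>\<^sub>i y\<close> over \<open>i < j\<close> they give the derivation rule (\<open>prelie_cup_homotopy\<close>).

  \<^bold>\<open>Connes' operator.\<close> Regard \<open>x\<close> as a tree with \<open>l + 1\<close> cyclically ordered legs, one of which is the
  output. Up to sign \<open>B x\<close> is the sum over all ways to make one of the inputs the output and to plug \<open>e\<close>
  into the old output. Applied to a product \<open>x y\<close>, the new output is an input of \<open>x\<close> or of \<open>y\<close>, and
  \<open>B (x y)\<close> is up to signs the sum of a part \<open>Z (x, y)\<close>, where \<open>y\<close> is plugged into the old output of \<open>x\<close>,
  and of \<open>Z (y, x)\<close> (\<open>connes_sum_cup\<close>, with \<open>rot_prelie\<close> for \<open>Z\<close>). The same cancellation, now for the rotations of \<open>x\<close> with \<open>e\<close> plugged into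
  the old output and \<open>y\<close> into an input to the right of it, shows that \<open>Z (x, y)\<close> is homologous to
  \<open>x \<circ>\<^bsub>bar\<^esub> y + (B x) y\<close> up to sign (\<open>rot_prelie_homotopy\<close>): the end terms occur where \<open>e\<close>, \<open>y\<close> and
  the new output meet in pairs. Adding the two halves and using commutativity gives the BV identity.

  \<open>B\<close> commutes with \<open>d\<close> up to sign on all chains, so it preserves cycles and boundaries. On a normalized
  chain \<open>B B\<close> vanishes term by term, because one of the two copies of \<open>e\<close> is plugged into an input
  (\<open>connes_sum_connes_sum\<close>). Every cycle is homologous to a normalized one (\<open>normalize_cycle\<close>), which
  makes \<open>B\<close> total on homology and gives \<open>B B = 0\<close> there.

  \<^bold>\<open>Assembly.\<close> Since the differential raises the arity by one, the components of a cycle of the total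
  complex are cycles, and by additivity every identity reduces to operations of a single arity.
\<close>

declare sum.op_ivl_Suc [simp del] One_nat_def [simp del]

alias single = Poly_Mapping.single
alias lookup = Poly_Mapping.lookup
alias keys = Poly_Mapping.keys

section \<open>Signs and sums\<close>

lemma ksign_add: "ksign n (x + y) = ksign n x + ksign n (y :: 'a::ab_group_add)"
  by (simp add: ksign_def)

lemma ksign_uminus: "ksign n (- x) = - ksign n (x :: 'a::ab_group_add)"
  by (simp add: ksign_def)

lemma ksign_diff: "ksign n (x - y) = ksign n x - ksign n (y :: 'a::ab_group_add)"
  by (simp add: ksign_def)

lemma ksign_zero [simp]: "ksign n 0 = (0 :: 'a::ab_group_add)"
  by (simp add: ksign_def)

lemma ksign_sum: "ksign n (\<Sum>i\<in>A. f i) = (\<Sum>i\<in>A. ksign n (f i :: 'a::ab_group_add))"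
  by (simp add: ksign_def sum_negf)

lemma ksign_ksign: "ksign m (ksign n x) = ksign (m + n) (x :: 'a::ab_group_add)"
  by (auto simp: ksign_def)

lemma ksign_cong: "even (m - n) \<Longrightarrow> ksign m x = ksign n (x :: 'a::ab_group_add)"
  by (auto simp: ksign_def)

lemma ksign_eq_0_iff [simp]: "ksign n x = 0 \<longleftrightarrow> (x :: 'a::ab_group_add) = 0"
  by (simp add: ksign_def)

lemma sum_shift_ivl:
  fixes f :: "nat \<Rightarrow> 'a::comm_monoid_add"
  assumes "k' + p = k + q" "n' + p = n + q"
  shows "(\<Sum>i=k'..<n'. f i) = (\<Sum>i=k..<n. f (i + q - p))"
proof -
  have "(\<Sum>i=k'..<n'. f i) = (\<Sum>i=k'+p..<n'+p. f (i - p))"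
    by (simp only: sum.shift_bounds_nat_ivl add_diff_cancel_right')
  also have "\<dots> = (\<Sum>i=k..<n. f (i + q - p))"
    by (simp only: assms sum.shift_bounds_nat_ivl)
  finally show ?thesis .
qed

lemma sum_triangle_swap:
  fixes f :: "nat \<Rightarrow> nat \<Rightarrow> 'a::comm_monoid_add"
  shows "(\<Sum>i=k..<n. \<Sum>j=Suc i..<n. f i j) = (\<Sum>j=k..<n. \<Sum>i=k..<j. f i j)"
proof -
  have "(\<Sum>i=k..<n. \<Sum>j=Suc i..<n. f i j) = (\<Sum>(i, j)\<in>Sigma {k..<n} (\<lambda>i. {Suc i..<n}). f i j)"
    by (rule sum.Sigma) auto
  also have "\<dots> = (\<Sum>(j, i)\<in>Sigma {k..<n} (\<lambda>j. {k..<j}). f i j)"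
    by (rule sum.reindex_bij_witness[of _ "\<lambda>(i, j). (j, i)" "\<lambda>(i, j). (j, i)"]) auto
  also have "\<dots> = (\<Sum>j=k..<n. \<Sum>i=k..<j. f i j)"
    by (rule sum.Sigma[symmetric]) auto
  finally show ?thesis .
qed

lemma cancel_zero_sum:
  fixes t :: "'a::ab_group_add"
  assumes "t = a + f + c - c'" "a + a' + (f + f') = 0"
  shows "t = - a' + (c - f') - c'"
proof -
  have "t - (- a' + (c - f') - c') = a + a' + (f + f')" by (simp add: assms(1) algebra_simps)
  then show ?thesis by (simp add: assms(2))
qed

lemma cancel_zero_sum2:
  fixes t :: "'a::ab_group_add"
  assumes "t = a + f + m" "a + a' + (m + m') + (f + f') = 0"
  shows "t = - a' - m' - f'"
proof -
  have "t - (- a' - m' - f') = a + a' + (m + m') + (f + f')" by (simp add: assms(1) algebra_simps)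
  then show ?thesis by (simp add: assms(2))
qed

section \<open>Operads with suspended degrees\<close>

text \<open>
  \<open>E l a\<close> holds the operations of arity \<open>l\<close> and suspended degree \<open>a\<close>, and \<open>pc i x y\<close> is \<open>x \<circ>\<^sub>i y\<close>. The arity
  is no parameter of \<open>pc\<close>: in the instance below an element determines its arity and degree. The signs in
  the laws of \<open>\<mu>\<close> and \<open>e\<close> are those of the suspension: associativity becomes \<open>\<mu> \<circ>\<^sub>1 \<mu> + \<mu> \<circ>\<^sub>2 \<mu> = 0\<close>.
\<close>

locale suspended_operad =
  fixes E :: "nat \<Rightarrow> int \<Rightarrow> 'b::ab_group_add set"
    and pc :: "nat \<Rightarrow> 'b \<Rightarrow> 'b \<Rightarrow> 'b"
    and idt \<mu> e :: 'b
  assumes E_zero [simp]: "0 \<in> E l a"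
    and E_add: "\<lbrakk>x \<in> E l a; y \<in> E l a\<rbrakk> \<Longrightarrow> x + y \<in> E l a"
    and E_uminus: "x \<in> E l a \<Longrightarrow> - x \<in> E l a"
    and pc_closed: "\<lbrakk>x \<in> E l a; y \<in> E m b; 1 \<le> i; i \<le> l\<rbrakk> \<Longrightarrow> pc i x y \<in> E (l + m - 1) (a + b)"
    and pc_add_left: "\<lbrakk>x \<in> E l a; x' \<in> E l a; y \<in> E m b; 1 \<le> i; i \<le> l\<rbrakk> \<Longrightarrow>
      pc i (x + x') y = pc i x y + pc i x' y"
    and pc_add_right: "\<lbrakk>x \<in> E l a; y \<in> E m b; y' \<in> E m b; 1 \<le> i; i \<le> l\<rbrakk> \<Longrightarrow>
      pc i x (y + y') = pc i x y + pc i x y'"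
    and pc_sequential: "\<lbrakk>x \<in> E l a; y \<in> E m b; z \<in> E n c; 1 \<le> i; i \<le> l; 1 \<le> j; j \<le> m\<rbrakk> \<Longrightarrow>
      pc (i + j - 1) (pc i x y) z = pc i x (pc j y z)"
    and pc_parallel: "\<lbrakk>x \<in> E l a; y \<in> E m b; z \<in> E n c; 1 \<le> i; i < j; j \<le> l\<rbrakk> \<Longrightarrow>
      pc (j + m - 1) (pc i x y) z = ksign (b * c) (pc i (pc j x z) y)"
    and idt_left: "y \<in> E m b \<Longrightarrow> pc 1 idt y = y"
    and idt_right: "\<lbrakk>x \<in> E l a; 1 \<le> i; i \<le> l\<rbrakk> \<Longrightarrow> pc i x idt = x"
    and mu_E: "\<mu> \<in> E 2 (-1)"
    and e_E: "e \<in> E 0 1"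
    and mu_mu: "pc 1 \<mu> \<mu> = - pc 2 \<mu> \<mu>"
    and mu_e_left: "pc 1 \<mu> e = - idt"
    and mu_e_right: "pc 2 \<mu> e = idt"
begin

lemma idt_E: "idt \<in> E 1 0"
  using pc_closed[OF mu_E e_E, of 2] by (simp add: mu_e_right One_nat_def)

lemma E_diff: "\<lbrakk>x \<in> E l a; y \<in> E l a\<rbrakk> \<Longrightarrow> x - y \<in> E l a"
  using E_add E_uminus by (metis diff_conv_add_uminus)

lemma E_sum: "(\<And>i. i \<in> A \<Longrightarrow> f i \<in> E l a) \<Longrightarrow> (\<Sum>i\<in>A. f i) \<in> E l a"
  by (induction A rule: infinite_finite_induct) (auto intro: E_add)

lemma E_ksign: "x \<in> E l a \<Longrightarrow> ksign n x \<in> E l a"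
  by (simp add: ksign_def E_uminus)

lemma pcI:
  assumes "x \<in> E l a" "y \<in> E m b" "1 \<le> i" "i \<le> l" "n + 1 = l + m" "c = a + b"
  shows "pc i x y \<in> E n c"
proof -
  from \<open>n + 1 = l + m\<close> have "n = l + m - 1" by simp
  then show ?thesis using assms pc_closed by blast
qed

lemma pc_zero_left [simp]: "\<lbrakk>y \<in> E m b; 1 \<le> i\<rbrakk> \<Longrightarrow> pc i 0 y = 0"
  using pc_add_left[of 0 i _ 0 y m b i] by simp

lemma pc_zero_right [simp]: "\<lbrakk>x \<in> E l a; 1 \<le> i; i \<le> l\<rbrakk> \<Longrightarrow> pc i x 0 = 0"
  using pc_add_right[of x l a 0 0 _ 0] by simp

lemma pc_uminus_left: "\<lbrakk>x \<in> E l a; y \<in> E m b; 1 \<le> i; i \<le> l\<rbrakk> \<Longrightarrow> pc i (- x) y = - pc i x y"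
  using pc_add_left[of x l a "- x" y m b i] E_uminus[of x l a] pc_zero_left[of y m b i]
  by (simp add: eq_neg_iff_add_eq_0 add.commute)

lemma pc_uminus_right: "\<lbrakk>x \<in> E l a; y \<in> E m b; 1 \<le> i; i \<le> l\<rbrakk> \<Longrightarrow> pc i x (- y) = - pc i x y"
  using pc_add_right[of x l a y m b "- y" i] E_uminus[of y m b] pc_zero_right[of x l a i]
  by (simp add: eq_neg_iff_add_eq_0 add.commute)

lemma pc_diff_left: "\<lbrakk>x \<in> E l a; x' \<in> E l a; y \<in> E m b; 1 \<le> i; i \<le> l\<rbrakk> \<Longrightarrow>
    pc i (x - x') y = pc i x y - pc i x' y"
  using pc_add_left[of x l a "- x'" y m b i] E_uminus[of x' l a] pc_uminus_left[of x' l a y m b i]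
  by simp

lemma pc_diff_right: "\<lbrakk>x \<in> E l a; y \<in> E m b; y' \<in> E m b; 1 \<le> i; i \<le> l\<rbrakk> \<Longrightarrow>
    pc i x (y - y') = pc i x y - pc i x y'"
  using pc_add_right[of x l a y m b "- y'" i] E_uminus[of y' m b] pc_uminus_right[of x l a y' m b i]
  by simp

lemma pc_ksign_left: "\<lbrakk>x \<in> E l a; y \<in> E m b; 1 \<le> i; i \<le> l\<rbrakk> \<Longrightarrow> pc i (ksign n x) y = ksign n (pc i x y)"
  by (simp add: ksign_def pc_uminus_left)

lemma pc_ksign_right: "\<lbrakk>x \<in> E l a; y \<in> E m b; 1 \<le> i; i \<le> l\<rbrakk> \<Longrightarrow> pc i x (ksign n y) = ksign n (pc i x y)"
  by (simp add: ksign_def pc_uminus_right)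

lemma pc_sum_left: "\<lbrakk>\<And>t. t \<in> A \<Longrightarrow> f t \<in> E l a; y \<in> E m b; 1 \<le> i; i \<le> l\<rbrakk> \<Longrightarrow>
    pc i (\<Sum>t\<in>A. f t) y = (\<Sum>t\<in>A. pc i (f t) y)"
  by (induction A rule: infinite_finite_induct)
    (auto simp: pc_add_left[of _ l a _ y m b] E_sum)

lemma pc_sum_right: "\<lbrakk>\<And>t. t \<in> A \<Longrightarrow> f t \<in> E m b; x \<in> E l a; 1 \<le> i; i \<le> l\<rbrakk> \<Longrightarrow>
    pc i x (\<Sum>t\<in>A. f t) = (\<Sum>t\<in>A. pc i x (f t))"
  by (induction A rule: infinite_finite_induct)
    (auto simp: pc_add_right[of x l a _ m b] E_sum)

text \<open>
  This form and the next leave the index of the outer composition free, so that they apply to any term for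
  it.
\<close>

lemma seq:
  assumes "x \<in> E l a" "y \<in> E m b" "z \<in> E n c" "1 \<le> i" "i \<le> l" "1 \<le> j" "j \<le> m" "k + 1 = i + j"
  shows "pc k (pc i x y) z = pc i x (pc j y z)"
proof -
  from \<open>k + 1 = i + j\<close> have "k = i + j - 1" by simp
  then show ?thesis using assms by (simp only: pc_sequential)
qed

lemma par:
  assumes "x \<in> E l a" "y \<in> E m b" "z \<in> E n c" "1 \<le> i" "i < j" "j \<le> l" "k + 1 = j + m"
  shows "pc k (pc i x y) z = ksign (b * c) (pc i (pc j x z) y)"
proof -
  from \<open>k + 1 = j + m\<close> have "k = j + m - 1" by simp
  then show ?thesis using assms by (simp only: pc_parallel)
qed

section \<open>The differential and its two halves\<close>

text \<open>
  The faces of \<open>x\<close> are ordered like the cofaces \<open>d\<^sup>0, \<dots>, d\<^sup>l\<^sup>+\<^sup>1\<close>; \<open>L a k\<close> is the sum of those before input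
  \<open>k\<close> and \<open>R l a k\<close> the sum of the others.
\<close>

definition L :: "int \<Rightarrow> nat \<Rightarrow> 'b \<Rightarrow> 'b" where
  "L a k x = pc 2 \<mu> x + ksign (a + 1) (\<Sum>i=1..<k. pc i x \<mu>)"

definition R :: "nat \<Rightarrow> int \<Rightarrow> nat \<Rightarrow> 'b \<Rightarrow> 'b" where
  "R l a k x = pc 1 \<mu> x + ksign (a + 1) (\<Sum>i=k..<Suc l. pc i x \<mu>)"

definition d :: "nat \<Rightarrow> int \<Rightarrow> 'b \<Rightarrow> 'b" where
  "d l a x = pc 1 \<mu> x + pc 2 \<mu> x + ksign (a + 1) (\<Sum>i=1..<Suc l. pc i x \<mu>)"

lemma pc_mu_E: "\<lbrakk>x \<in> E l a; i = 1 \<or> i = 2\<rbrakk> \<Longrightarrow> pc i \<mu> x \<in> E (Suc l) (a - 1)"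
  by (rule pcI[OF mu_E]) auto

lemma mu_pc_E: "\<lbrakk>x \<in> E l a; 1 \<le> i; i \<le> l\<rbrakk> \<Longrightarrow> pc i x \<mu> \<in> E (Suc l) (a - 1)"
  by (rule pcI[OF _ mu_E]) auto

lemma L_E: "\<lbrakk>x \<in> E l a; k \<le> Suc l\<rbrakk> \<Longrightarrow> L a k x \<in> E (Suc l) (a - 1)"
  unfolding L_def by (intro E_add E_ksign E_sum pc_mu_E mu_pc_E) auto

lemma R_E: "\<lbrakk>x \<in> E l a; 1 \<le> k\<rbrakk> \<Longrightarrow> R l a k x \<in> E (Suc l) (a - 1)"
  unfolding R_def by (intro E_add E_ksign E_sum pc_mu_E mu_pc_E) auto

lemma d_E: "x \<in> E l a \<Longrightarrow> d l a x \<in> E (Suc l) (a - 1)"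
  unfolding d_def by (intro E_add E_ksign E_sum pc_mu_E mu_pc_E) auto

lemma d_split3:
  assumes "1 \<le> j" "j \<le> k" "k \<le> Suc l"
  shows "d l a x = L a j x + ksign (a + 1) (\<Sum>i=j..<k. pc i x \<mu>) + R l a k x"
proof -
  have "(\<Sum>i=1..<Suc l. pc i x \<mu>) =
      (\<Sum>i=1..<j. pc i x \<mu>) + ((\<Sum>i=j..<k. pc i x \<mu>) + (\<Sum>i=k..<Suc l. pc i x \<mu>))"
    using assms by (subst sum.atLeastLessThan_concat, simp, simp)+ (rule refl)
  then show ?thesis
    unfolding d_def L_def R_def by (simp only: ksign_add ac_simps)
qed

lemma d_split: "\<lbrakk>1 \<le> k; k \<le> Suc l\<rbrakk> \<Longrightarrow> d l a x = L a k x + R l a k x"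
  using d_split3[of k k l a x] by simp

lemma d_add: "\<lbrakk>x \<in> E l a; y \<in> E l a\<rbrakk> \<Longrightarrow> d l a (x + y) = d l a x + d l a y"
proof -
  assume x: "x \<in> E l a" and y: "y \<in> E l a"
  have 1: "pc i \<mu> (x + y) = pc i \<mu> x + pc i \<mu> y" if "i = 1 \<or> i = 2" for i
    using that by (intro pc_add_right[OF mu_E x y]) auto
  have 2: "pc i (x + y) \<mu> = pc i x \<mu> + pc i y \<mu>" if "i \<in> {1..<Suc l}" for i
    using that by (intro pc_add_left[OF x y mu_E]) auto
  have "(\<Sum>i=1..<Suc l. pc i (x + y) \<mu>) = (\<Sum>i=1..<Suc l. pc i x \<mu> + pc i y \<mu>)"
    by (intro sum.cong refl 2)
  then show ?thesis
    by (simp add: d_def 1 sum.distrib ksign_add)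
qed

lemma d_zero [simp]: "d l a 0 = 0"
  using d_add[of 0 l a 0] by simp

lemma d_uminus: "x \<in> E l a \<Longrightarrow> d l a (- x) = - d l a x"
  using d_add[of x l a "- x"] E_uminus[of x l a]
  by (simp add: eq_neg_iff_add_eq_0 add.commute)

lemma d_diff: "\<lbrakk>x \<in> E l a; y \<in> E l a\<rbrakk> \<Longrightarrow> d l a (x - y) = d l a x - d l a y"
  using d_add[of x l a "- y"] d_uminus[of y l a] E_uminus[of y l a] by simp

lemma d_ksign: "x \<in> E l a \<Longrightarrow> d l a (ksign n x) = ksign n (d l a x)"
  by (simp add: ksign_def d_uminus)

lemma d_sum: "(\<And>t. t \<in> A \<Longrightarrow> f t \<in> E l a) \<Longrightarrow> d l a (\<Sum>t\<in>A. f t) = (\<Sum>t\<in>A. d l a (f t))"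
  by (induction A rule: infinite_finite_induct) (auto simp: d_add E_sum)

text \<open>
  Faces to the left of the input that \<open>y\<close> occupies do not see \<open>y\<close>: they only move that input by one. For
  faces to the right of it see the next lemma.
\<close>

lemma L_pc:
  assumes x: "x \<in> E l a" and y: "y \<in> E m b" and k: "1 \<le> k" "k \<le> j" "j \<le> l"
  shows "L (a + b) k (pc j x y) = pc (Suc j) (L a k x) y"
proof -
  have 1: "pc (Suc j) (pc 2 \<mu> x) y = pc 2 \<mu> (pc j x y)"
    using k by (intro seq[OF mu_E x y]) auto
  have 2: "pc (Suc j) (pc i x \<mu>) y = ksign b (pc i (pc j x y) \<mu>)" if "i \<in> {1..<k}" for i
  proof -
    have "pc (Suc j) (pc i x \<mu>) y = ksign (-1 * b) (pc i (pc j x y) \<mu>)"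
      using that k by (intro par[OF x mu_E y]) auto
    also have "\<dots> = ksign b (pc i (pc j x y) \<mu>)" by (simp add: ksign_def)
    finally show ?thesis .
  qed
  have E: "pc i x \<mu> \<in> E (Suc l) (a - 1)" if "i \<in> {1..<k}" for i
    using that k by (intro mu_pc_E[OF x]) auto
  have "pc (Suc j) (\<Sum>i=1..<k. pc i x \<mu>) y = (\<Sum>i=1..<k. pc (Suc j) (pc i x \<mu>) y)"
    using k by (intro pc_sum_left[OF E y]) auto
  also have "\<dots> = ksign b (\<Sum>i=1..<k. pc i (pc j x y) \<mu>)"
    unfolding ksign_sum by (intro sum.cong refl 2)
  finally have 3: "pc (Suc j) (\<Sum>i=1..<k. pc i x \<mu>) y = ksign b (\<Sum>i=1..<k. pc i (pc j x y) \<mu>)" .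
  have S: "(\<Sum>i=1..<k. pc i x \<mu>) \<in> E (Suc l) (a - 1)" by (intro E_sum E)
  have "pc (Suc j) (L a k x) y = pc (Suc j) (pc 2 \<mu> x) y + pc (Suc j) (ksign (a + 1) (\<Sum>i=1..<k. pc i x \<mu>)) y"
    unfolding L_def using k by (intro pc_add_left[OF pc_mu_E[OF x] E_ksign[OF S] y]) auto
  also have "pc (Suc j) (ksign (a + 1) (\<Sum>i=1..<k. pc i x \<mu>)) y
      = ksign (a + 1) (ksign b (\<Sum>i=1..<k. pc i (pc j x y) \<mu>))"
    unfolding 3[symmetric] using k by (intro pc_ksign_left[OF S y]) auto
  finally show ?thesis
    unfolding L_def[of "a + b"] 1 ksign_ksign by (simp only: ac_simps)
qed

lemma R_pc:
  assumes x: "x \<in> E l a" and y: "y \<in> E m b" and k: "1 \<le> j" "j < k" "k \<le> Suc l"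
    and k': "Suc k' = k + m" and n: "Suc n = l + m"
  shows "R n (a + b) k' (pc j x y) = pc j (R l a k x) y"
proof -
  have 1: "pc j (pc 1 \<mu> x) y = pc 1 \<mu> (pc j x y)"
    using k by (intro seq[OF mu_E x y]) auto
  have 2: "pc (i + m - 1) (pc j x y) \<mu> = ksign b (pc j (pc i x \<mu>) y)" if "i \<in> {k..<Suc l}" for i
  proof -
    have "pc (i + m - 1) (pc j x y) \<mu> = ksign (b * -1) (pc j (pc i x \<mu>) y)"
      using that k k' by (intro par[OF x y mu_E]) auto
    also have "\<dots> = ksign b (pc j (pc i x \<mu>) y)" by (simp add: ksign_def)
    finally show ?thesis .
  qed
  have E: "pc i x \<mu> \<in> E (Suc l) (a - 1)" if "i \<in> {k..<Suc l}" for i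
    using that k by (intro mu_pc_E[OF x]) auto
  have "(\<Sum>i=k'..<Suc n. pc i (pc j x y) \<mu>) = (\<Sum>i=k..<Suc l. pc (i + m - 1) (pc j x y) \<mu>)"
    by (rule sum_shift_ivl) (use k' n in simp_all)
  also have "\<dots> = (\<Sum>i=k..<Suc l. ksign b (pc j (pc i x \<mu>) y))"
    by (intro sum.cong refl 2)
  also have "\<dots> = ksign b (pc j (\<Sum>i=k..<Suc l. pc i x \<mu>) y)"
    unfolding ksign_sum[symmetric] using k
    by (intro arg_cong[of _ _ "ksign b"] pc_sum_left[OF E y, symmetric]) auto
  finally have 3: "(\<Sum>i=k'..<Suc n. pc i (pc j x y) \<mu>) = ksign b (pc j (\<Sum>i=k..<Suc l. pc i x \<mu>) y)" .
  have S: "(\<Sum>i=k..<Suc l. pc i x \<mu>) \<in> E (Suc l) (a - 1)" by (intro E_sum E)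
  have "pc j (R l a k x) y = pc j (pc 1 \<mu> x) y + pc j (ksign (a + 1) (\<Sum>i=k..<Suc l. pc i x \<mu>)) y"
    unfolding R_def using k by (intro pc_add_left[OF pc_mu_E[OF x] E_ksign[OF S] y]) auto
  also have "pc j (ksign (a + 1) (\<Sum>i=k..<Suc l. pc i x \<mu>)) y
      = ksign (a + 1) (pc j (\<Sum>i=k..<Suc l. pc i x \<mu>) y)"
    using k by (intro pc_ksign_left[OF S y]) auto
  also have "\<dots> = ksign (a + b + 1) (ksign b (pc j (\<Sum>i=k..<Suc l. pc i x \<mu>) y))"
    by (cases "even a"; cases "even b"; simp add: ksign_def)
  finally show ?thesis
    unfolding R_def[of n] 3 1 by (rule sym)
qed

text \<open>
  The faces of \<open>x \<circ>\<^sub>j y\<close> are those of \<open>x\<close> at other inputs and those of \<open>y\<close> except \<open>\<mu> \<circ>\<^sub>1 y\<close> and \<open>\<mu> \<circ>\<^sub>2 y\<close>.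
  By associativity \<open>x \<circ>\<^sub>j (\<mu> \<circ>\<^sub>1 y)\<close> and \<open>x \<circ>\<^sub>j (\<mu> \<circ>\<^sub>2 y)\<close> are the face \<open>x \<circ>\<^sub>j \<mu>\<close> with \<open>y\<close> in its left or
  right input. So that face occurs both in \<open>R j\<close> and in \<open>L (Suc j)\<close>.
\<close>

lemma d_pc:
  assumes x: "x \<in> E l a" and y: "y \<in> E m b" and j: "1 \<le> j" "j \<le> l" and n: "Suc n = l + m"
  shows "d n (a + b) (pc j x y) =
    pc j (R l a j x) y + pc (Suc j) (L a (Suc j) x) y + ksign a (pc j x (d m b y))"
proof -
  have L: "L (a + b) j (pc j x y) = pc (Suc j) (L a j x) y"
    using j by (intro L_pc[OF x y]) auto
  have R: "R n (a + b) (j + m) (pc j x y) = pc j (R l a (Suc j) x) y"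
    using j n by (intro R_pc[OF x y]) auto
  have M: "(\<Sum>i=j..<j+m. pc i (pc j x y) \<mu>) = pc j x (\<Sum>i=1..<Suc m. pc i y \<mu>)" (is "?M = _")
  proof -
    have "?M = (\<Sum>i=1..<Suc m. pc (i + j - 1) (pc j x y) \<mu>)"
      by (rule sum_shift_ivl) simp_all
    also have "\<dots> = (\<Sum>i=1..<Suc m. pc j x (pc i y \<mu>))"
      using j by (intro sum.cong refl seq[OF x y mu_E]) auto
    also have "\<dots> = pc j x (\<Sum>i=1..<Suc m. pc i y \<mu>)"
      using j by (intro pc_sum_right[OF mu_pc_E[OF y] x, symmetric]) auto
    finally show ?thesis .
  qed
  define Y where "Y = (\<Sum>i=1..<Suc m. pc i y \<mu>)"
  have Y: "Y \<in> E (Suc m) (b - 1)"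
    unfolding Y_def by (intro E_sum mu_pc_E[OF y]) auto
  have dy: "d m b y = pc 1 \<mu> y + pc 2 \<mu> y + ksign (b + 1) Y"
    by (simp add: d_def Y_def)
  have D: "pc j x (d m b y) = pc j x (pc 1 \<mu> y) + pc j x (pc 2 \<mu> y) + ksign (b + 1) (pc j x Y)"
    unfolding dy using j
    by (simp add: pc_add_right[OF x E_add[OF pc_mu_E[OF y] pc_mu_E[OF y]] E_ksign[OF Y]]
        pc_add_right[OF x pc_mu_E[OF y] pc_mu_E[OF y]] pc_ksign_right[OF x Y])
  have m1: "pc j x (pc 1 \<mu> y) = pc j (pc j x \<mu>) y"
    using j by (intro seq[OF x mu_E y, symmetric]) auto
  have m2: "pc j x (pc 2 \<mu> y) = pc (Suc j) (pc j x \<mu>) y"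
    using j by (intro seq[OF x mu_E y, symmetric]) auto
  have xm: "pc j x \<mu> \<in> E (Suc l) (a - 1)" using j by (intro mu_pc_E[OF x]) auto
  have Rj: "R l a j x = R l a (Suc j) x + ksign (a + 1) (pc j x \<mu>)"
    using j by (simp add: R_def sum.atLeast_Suc_lessThan[of j] ksign_add)
  have R': "pc j (R l a j x) y = pc j (R l a (Suc j) x) y + ksign (a + 1) (pc j x (pc 1 \<mu> y))"
    unfolding Rj m1 using j
    by (simp add: pc_add_left[OF R_E[OF x] E_ksign[OF xm] y] pc_ksign_left[OF xm y])
  have Lj: "L a (Suc j) x = L a j x + ksign (a + 1) (pc j x \<mu>)"
    using j by (simp add: L_def ksign_add sum.op_ivl_Suc)
  have L': "pc (Suc j) (L a (Suc j) x) y = pc (Suc j) (L a j x) y + ksign (a + 1) (pc j x (pc 2 \<mu> y))"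
    unfolding Lj m2 using j
    by (simp add: pc_add_left[OF L_E[OF x] E_ksign[OF xm] y] pc_ksign_left[OF xm y])
  have "d n (a + b) (pc j x y) = pc (Suc j) (L a j x) y + ksign (a + b + 1) (pc j x Y) + pc j (R l a (Suc j) x) y"
    using d_split3[of j "j + m" n "a + b" "pc j x y"] j n L R M by (simp add: Y_def)
  then show ?thesis
    unfolding R' L' D by (cases "even a"; cases "even b"; simp add: ksign_def)
qed

section \<open>The pre-Lie product and the bracket\<close>

definition prelie :: "nat \<Rightarrow> 'b \<Rightarrow> 'b \<Rightarrow> 'b" where
  "prelie l x y = (\<Sum>i=1..<Suc l. pc i x y)"

lemma prelie_E: "\<lbrakk>x \<in> E l a; y \<in> E m b; Suc n = l + m; c = a + b\<rbrakk> \<Longrightarrow> prelie l x y \<in> E n c"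
  unfolding prelie_def by (intro E_sum pcI[of x l a y m b]) auto

text \<open>
  The differential of \<open>\<mu> \<circ>\<^sub>1 x\<close>, cut on either side of its last input. The faces of \<open>\<mu>\<close> cancel in pairs, so
  only faces of \<open>x\<close> are left.
\<close>

lemma d_mu_pc: 
  assumes x: "x \<in> E l a"
  shows "R (Suc l) (a - 1) (Suc l) (pc 1 \<mu> x) = 0"
    and "L (a - 1) (Suc (Suc l)) (pc 1 \<mu> x) = - pc 1 \<mu> (d l a x)"
proof -
  have mm: "pc i \<mu> \<mu> \<in> E 3 (-2)" if "i = 1 \<or> i = 2" for i
    using pc_mu_E[OF mu_E that] by (simp add: numeral_3_eq_3)
  have iv: "{1..<3} = {1, 2::nat}" "{2..<3} = {2::nat}" "{1..<2} = {1::nat}" by auto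
  have R2: "R 2 (-1) 2 \<mu> = 0" by (simp add: R_def mu_mu ksign_def iv)
  have R1: "R 2 (-1) 1 \<mu> = pc 1 \<mu> \<mu>" by (simp add: R_def mu_mu ksign_def iv)
  have L2: "L (-1) 2 \<mu> = 0" by (simp add: L_def mu_mu ksign_def iv)
  have "R (Suc l) (-1 + a) (Suc l) (pc 1 \<mu> x) = pc 1 (R 2 (-1) 2 \<mu>) x"
    by (rule R_pc[OF mu_E x]) auto
  then show "R (Suc l) (a - 1) (Suc l) (pc 1 \<mu> x) = 0"
    using R2 x by simp
  have "d (Suc l) (-1 + a) (pc 1 \<mu> x) = pc 1 (R 2 (-1) 1 \<mu>) x + pc (Suc 1) (L (-1) (Suc 1) \<mu>) x
      + ksign (-1) (pc 1 \<mu> (d l a x))"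
    by (rule d_pc[OF mu_E x]) auto
  then have "d (Suc l) (a - 1) (pc 1 \<mu> x) = pc 1 (pc 1 \<mu> \<mu>) x - pc 1 \<mu> (d l a x)"
    using R1 L2 x by (simp add: numeral_2_eq_2[symmetric]) (simp add: ksign_def)
  moreover have "pc 1 (pc 1 \<mu> \<mu>) x = pc 1 \<mu> (pc 1 \<mu> x)"
    by (rule seq[OF mu_E mu_E x]) auto
  moreover have "d (Suc l) (a - 1) (pc 1 \<mu> x) =
      L (a - 1) (Suc (Suc l)) (pc 1 \<mu> x) + R (Suc l) (a - 1) (Suc (Suc l)) (pc 1 \<mu> x)"
    by (rule d_split) auto
  moreover have "R (Suc l) (a - 1) (Suc (Suc l)) (pc 1 \<mu> x) = pc 1 \<mu> (pc 1 \<mu> x)"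
    by (simp add: R_def)
  ultimately show "L (a - 1) (Suc (Suc l)) (pc 1 \<mu> x) = - pc 1 \<mu> (d l a x)"
    by simp
qed

lemma prelie_E': "\<lbrakk>x \<in> E l a; y \<in> E m b\<rbrakk> \<Longrightarrow> prelie l x y \<in> E (l + m - 1) (a + b)"
  by (cases "l = 0") (auto simp: prelie_def intro!: E_sum pcI[of x l a y m b])

lemma prelie_add_left: "\<lbrakk>x \<in> E l a; x' \<in> E l a; y \<in> E m b\<rbrakk> \<Longrightarrow>
    prelie l (x + x') y = prelie l x y + prelie l x' y"
  unfolding prelie_def sum.distrib[symmetric]
  by (intro sum.cong refl pc_add_left[of x l a x' y m b]) auto

lemma prelie_add_right: "\<lbrakk>x \<in> E l a; y \<in> E m b; y' \<in> E m b\<rbrakk> \<Longrightarrow>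
    prelie l x (y + y') = prelie l x y + prelie l x y'"
  unfolding prelie_def sum.distrib[symmetric]
  by (intro sum.cong refl pc_add_right[of x l a y m b y']) auto

lemma prelie_ksign_left: "\<lbrakk>x \<in> E l a; y \<in> E m b\<rbrakk> \<Longrightarrow> prelie l (ksign n x) y = ksign n (prelie l x y)"
  unfolding prelie_def ksign_sum
  by (intro sum.cong refl pc_ksign_left[of x l a y m b]) auto

lemma prelie_ksign_right: "\<lbrakk>x \<in> E l a; y \<in> E m b\<rbrakk> \<Longrightarrow> prelie l x (ksign n y) = ksign n (prelie l x y)"
  unfolding prelie_def ksign_sum
  by (intro sum.cong refl pc_ksign_right[of x l a y m b]) auto

lemma prelie_diff_left: "\<lbrakk>x \<in> E l a; x' \<in> E l a; y \<in> E m b\<rbrakk> \<Longrightarrow>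
    prelie l (x - x') y = prelie l x y - prelie l x' y"
  unfolding prelie_def sum_subtractf[symmetric]
  by (intro sum.cong refl pc_diff_left[of x l a x' y m b]) auto

lemma prelie_diff_right: "\<lbrakk>x \<in> E l a; y \<in> E m b; y' \<in> E m b\<rbrakk> \<Longrightarrow>
    prelie l x (y - y') = prelie l x y - prelie l x y'"
  unfolding prelie_def sum_subtractf[symmetric]
  by (intro sum.cong refl pc_diff_right[of x l a y m b y']) auto

lemma prelie_zero_left [simp]: "y \<in> E m b \<Longrightarrow> prelie l 0 y = 0"
  by (auto simp: prelie_def intro!: sum.neutral pc_zero_left)

lemma prelie_zero_right [simp]: "x \<in> E l a \<Longrightarrow> prelie l x 0 = 0"
  by (auto simp: prelie_def intro!: sum.neutral pc_zero_right)

lemma prelie_0 [simp]: "prelie 0 x y = 0"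
  by (simp add: prelie_def One_nat_def)

definition brace :: "nat \<Rightarrow> 'b \<Rightarrow> 'b \<Rightarrow> 'b \<Rightarrow> 'b" where
  "brace l x y z = (\<Sum>j=1..<Suc l. \<Sum>i=1..<j. pc i (pc j x z) y)"

text \<open>
  In \<open>(x \<circ>\<^sub>i y) \<circ>\<^sub>k z\<close> either \<open>z\<close> goes into an input of \<open>y\<close>, which gives \<open>x \<circ> (y \<circ> z)\<close>, or into an input of \<open>x\<close> to
  the left or to the right of \<open>y\<close>. The two braces are exchanged by interchanging \<open>y\<close> and \<open>z\<close>, so the
  associator is graded symmetric in them.
\<close>

lemma prelie_assoc:
  assumes x: "x \<in> E l a" and y: "y \<in> E m b" and z: "z \<in> E n c"
  shows "prelie (l + m - 1) (prelie l x y) z =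
    prelie l x (prelie m y z) + ksign (b * c) (brace l x y z) + brace l x z y"
proof (cases "l = 0")
  case True
  then show ?thesis using z by (simp add: brace_def One_nat_def)
next
  case False
  define N where "N = l + m - 1"
  have N: "Suc N = l + m" using False by (simp add: N_def)
  have xy: "pc i x y \<in> E N (a + b)" if "i \<in> {1..<Suc l}" for i
    using that N by (intro pcI[OF x y]) auto
  have term_split: "(\<Sum>k=1..<Suc N. pc k (pc i x y) z) =
      (\<Sum>k=1..<i. pc k (pc i x y) z) + (pc i x (prelie m y z) +
       ksign (b * c) (\<Sum>j=Suc i..<Suc l. pc i (pc j x z) y))" if i: "i \<in> {1..<Suc l}" for i
  proof -
    have "(\<Sum>k=1..<Suc N. pc k (pc i x y) z) =
      (\<Sum>k=1..<i. pc k (pc i x y) z) + ((\<Sum>k=i..<i+m. pc k (pc i x y) z) +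
       (\<Sum>k=i+m..<Suc N. pc k (pc i x y) z))"
      using i N by (subst sum.atLeastLessThan_concat, simp, simp)+ (rule refl)
    moreover have "(\<Sum>k=i..<i+m. pc k (pc i x y) z) = pc i x (prelie m y z)"
    proof -
      have "(\<Sum>k=i..<i+m. pc k (pc i x y) z) = (\<Sum>k=1..<Suc m. pc (k + i - 1) (pc i x y) z)"
        by (rule sum_shift_ivl) simp_all
      also have "\<dots> = (\<Sum>k=1..<Suc m. pc i x (pc k y z))"
        using i by (intro sum.cong refl seq[OF x y z]) auto
      also have "\<dots> = pc i x (prelie m y z)"
        unfolding prelie_def using i
        by (intro pc_sum_right[OF pcI[OF y z] x, of _ _ "m + n - 1" "b + c", symmetric]) auto
      finally show ?thesis .
    qed
    moreover have "(\<Sum>k=i+m..<Suc N. pc k (pc i x y) z) =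
        ksign (b * c) (\<Sum>j=Suc i..<Suc l. pc i (pc j x z) y)"
    proof -
      have "(\<Sum>k=i+m..<Suc N. pc k (pc i x y) z) = (\<Sum>j=Suc i..<Suc l. pc (j + m - 1) (pc i x y) z)"
        by (rule sum_shift_ivl) (use N in simp_all)
      also have "\<dots> = (\<Sum>j=Suc i..<Suc l. ksign (b * c) (pc i (pc j x z) y))"
        using i by (intro sum.cong refl par[OF x y z]) auto
      finally show ?thesis by (simp only: ksign_sum)
    qed
    ultimately show ?thesis by (simp only:)
  qed
  have "prelie N (prelie l x y) z = (\<Sum>k=1..<Suc N. \<Sum>i=1..<Suc l. pc k (pc i x y) z)"
    unfolding prelie_def by (intro sum.cong refl pc_sum_left[OF xy z]) auto
  also have "\<dots> = (\<Sum>i=1..<Suc l. \<Sum>k=1..<Suc N. pc k (pc i x y) z)"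
    by (rule sum.swap)
  also have "\<dots> = (\<Sum>i=1..<Suc l. (\<Sum>k=1..<i. pc k (pc i x y) z) + (pc i x (prelie m y z) +
       ksign (b * c) (\<Sum>j=Suc i..<Suc l. pc i (pc j x z) y)))"
    by (intro sum.cong refl term_split)
  also have "\<dots> = brace l x z y + (prelie l x (prelie m y z) + ksign (b * c) (brace l x y z))"
    unfolding sum.distrib brace_def prelie_def[of l x "prelie m y z"]
    by (simp only: sum_triangle_swap[symmetric] ksign_sum)
  finally show ?thesis by (simp add: N_def add_ac)
qed

text \<open>
  \<open>\<mu>(x, y)\<close> without the sign that turns it into the product of the total complex.
\<close>

definition cup :: "nat \<Rightarrow> 'b \<Rightarrow> 'b \<Rightarrow> 'b" where
  "cup l x y = pc (Suc l) (pc 1 \<mu> x) y"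

lemma cup_E: "\<lbrakk>x \<in> E l a; y \<in> E m b\<rbrakk> \<Longrightarrow> cup l x y \<in> E (l + m) (a + b - 1)"
  unfolding cup_def by (rule pcI[OF pc_mu_E[of x l a]]) auto

lemma cup_add_left: "\<lbrakk>x \<in> E l a; x' \<in> E l a; y \<in> E m b\<rbrakk> \<Longrightarrow> cup l (x + x') y = cup l x y + cup l x' y"
  by (simp add: cup_def pc_add_right[OF mu_E, of x l a x'] pc_add_left[OF pc_mu_E pc_mu_E, of x l a 1 x' 1 y m b])

lemma cup_add_right: "\<lbrakk>x \<in> E l a; y \<in> E m b; y' \<in> E m b\<rbrakk> \<Longrightarrow> cup l x (y + y') = cup l x y + cup l x y'"
  unfolding cup_def by (rule pc_add_right[OF pc_mu_E]) auto

lemma cup_diff_left: "\<lbrakk>x \<in> E l a; x' \<in> E l a; y \<in> E m b\<rbrakk> \<Longrightarrow> cup l (x - x') y = cup l x y - cup l x' y"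
  by (simp add: cup_def pc_diff_right[OF mu_E, of x l a x'] pc_diff_left[OF pc_mu_E pc_mu_E, of x l a 1 x' 1 y m b])

lemma cup_diff_right: "\<lbrakk>x \<in> E l a; y \<in> E m b; y' \<in> E m b\<rbrakk> \<Longrightarrow> cup l x (y - y') = cup l x y - cup l x y'"
  unfolding cup_def by (rule pc_diff_right[OF pc_mu_E]) auto

lemma cup_ksign_left: "\<lbrakk>x \<in> E l a; y \<in> E m b\<rbrakk> \<Longrightarrow> cup l (ksign n x) y = ksign n (cup l x y)"
  by (simp add: cup_def pc_ksign_right[OF mu_E, of x l a] pc_ksign_left[OF pc_mu_E, of x l a 1 y m b])

lemma cup_ksign_right: "\<lbrakk>x \<in> E l a; y \<in> E m b\<rbrakk> \<Longrightarrow> cup l x (ksign n y) = ksign n (cup l x y)"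
  unfolding cup_def by (rule pc_ksign_right[OF pc_mu_E]) auto

lemma cup_zero_left [simp]: "y \<in> E m b \<Longrightarrow> cup l 0 y = 0"
  by (simp add: cup_def pc_zero_right[OF mu_E])

lemma cup_zero_right [simp]: "x \<in> E l a \<Longrightarrow> cup l x 0 = 0"
  unfolding cup_def by (rule pc_zero_right[OF pc_mu_E]) auto

lemma cup_sum_left: "\<lbrakk>\<And>t. t \<in> A \<Longrightarrow> f t \<in> E l a; y \<in> E m b\<rbrakk> \<Longrightarrow>
    cup l (\<Sum>t\<in>A. f t) y = (\<Sum>t\<in>A. cup l (f t) y)"
  by (induction A rule: infinite_finite_induct) (auto simp: cup_add_left[of _ l a _ y m b] E_sum)

lemma cup_sum_right: "\<lbrakk>\<And>t. t \<in> A \<Longrightarrow> f t \<in> E m b; x \<in> E l a\<rbrakk> \<Longrightarrow>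
    cup l x (\<Sum>t\<in>A. f t) = (\<Sum>t\<in>A. cup l x (f t))"
  by (induction A rule: infinite_finite_induct) (auto simp: cup_add_right[of x l a _ m b] E_sum)

text \<open>
  Filling the second input of \<open>\<mu>\<close> first costs a Koszul sign.
\<close>

lemma cup_swap:
  assumes x: "x \<in> E l a" and y: "y \<in> E m b"
  shows "pc 1 (pc 2 \<mu> x) y = ksign (a * b) (cup m y x)"
proof -
  have "cup m y x = ksign (b * a) (pc 1 (pc 2 \<mu> x) y)"
    unfolding cup_def by (rule par[OF mu_E y x]) auto
  then show ?thesis by (simp add: ksign_ksign mult.commute) (simp add: ksign_def)
qed

lemma cup_assoc:
  assumes x: "x \<in> E l a" and y: "y \<in> E m b" and z: "z \<in> E n c"
  shows "cup l x (cup m y z) = ksign (a + 1) (cup (l + m) (cup l x y) z)"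
proof -
  have mx: "pc 1 \<mu> x \<in> E (Suc l) (a - 1)" and my: "pc 1 \<mu> y \<in> E (Suc m) (b - 1)"
    by (rule pc_mu_E[OF x], simp, rule pc_mu_E[OF y], simp)
  have m2m: "pc 2 \<mu> \<mu> \<in> E 3 (-2)" and m1m: "pc 1 \<mu> \<mu> \<in> E 3 (-2)"
    using pc_mu_E[OF mu_E, of 2] pc_mu_E[OF mu_E, of 1] by (simp_all add: numeral_3_eq_3)
  have mxm: "pc (Suc l) (pc 1 \<mu> x) \<mu> \<in> E (Suc (Suc l)) (a - 2)"
    by (rule pcI[OF mx mu_E]) auto
  have "cup l x (cup m y z) = pc (Suc (l + m)) (pc (Suc l) (pc 1 \<mu> x) (pc 1 \<mu> y)) z"
    unfolding cup_def by (rule seq[OF mx my z, symmetric]) auto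
  also have "pc (Suc l) (pc 1 \<mu> x) (pc 1 \<mu> y) = pc (Suc l) (pc (Suc l) (pc 1 \<mu> x) \<mu>) y"
    by (rule seq[OF mx mu_E y, symmetric]) auto
  also have "pc (Suc l) (pc 1 \<mu> x) \<mu> = ksign (a * -1) (pc 1 (pc 2 \<mu> \<mu>) x)"
    by (rule par[OF mu_E x mu_E]) auto
  also have "pc 1 (pc 2 \<mu> \<mu>) x = - pc 1 (pc 1 \<mu> \<mu>) x"
    using pc_uminus_left[OF m2m x, of 1] by (simp add: mu_mu)
  also have "pc 1 (pc 1 \<mu> \<mu>) x = pc 1 \<mu> (pc 1 \<mu> x)"
    by (rule seq[OF mu_E mu_E x]) auto
  also have "ksign (a * -1) (- pc 1 \<mu> (pc 1 \<mu> x)) = ksign (a + 1) (pc 1 \<mu> (pc 1 \<mu> x))"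
    by (simp add: ksign_def)
  also have "pc (Suc l) (ksign (a + 1) (pc 1 \<mu> (pc 1 \<mu> x))) y
      = ksign (a + 1) (pc (Suc l) (pc 1 \<mu> (pc 1 \<mu> x)) y)"
    by (rule pc_ksign_left[OF pc_mu_E[OF mx] y]) auto
  also have "pc (Suc l) (pc 1 \<mu> (pc 1 \<mu> x)) y = pc 1 \<mu> (cup l x y)"
    unfolding cup_def by (rule seq[OF mu_E mx y]) auto
  also have "pc (Suc (l + m)) (ksign (a + 1) (pc 1 \<mu> (cup l x y))) z
      = ksign (a + 1) (pc (Suc (l + m)) (pc 1 \<mu> (cup l x y)) z)"
    by (rule pc_ksign_left[OF pc_mu_E[OF cup_E[OF x y]] z]) auto
  finally show ?thesis by (simp add: cup_def)
qed

lemma cup_e_left: "y \<in> E m b \<Longrightarrow> cup 0 e y = - y"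
proof -
  assume y: "y \<in> E m b"
  show ?thesis
    using pc_uminus_left[OF idt_E y, of 1] idt_left[OF y] by (simp add: cup_def mu_e_left flip: One_nat_def)
qed

lemma cup_e_right: "x \<in> E l a \<Longrightarrow> cup l x e = ksign a x"
proof -
  assume x: "x \<in> E l a"
  have "cup l x e = ksign (a * 1) (pc 1 (pc 2 \<mu> e) x)"
    unfolding cup_def by (rule par[OF mu_E x e_E]) auto
  then show ?thesis by (simp add: mu_e_right idt_left[OF x])
qed

lemma d_cup:
  assumes x: "x \<in> E l a" and y: "y \<in> E m b"
  shows "d (l + m) (a + b - 1) (cup l x y) =
    - cup (Suc l) (d l a x) y + ksign (a + 1) (cup l x (d m b y))"
proof -
  have mx: "pc 1 \<mu> x \<in> E (Suc l) (a - 1)" by (rule pc_mu_E[OF x]) simp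
  have "d (l + m) (a - 1 + b) (cup l x y) = pc (Suc l) (R (Suc l) (a - 1) (Suc l) (pc 1 \<mu> x)) y
      + pc (Suc (Suc l)) (L (a - 1) (Suc (Suc l)) (pc 1 \<mu> x)) y + ksign (a - 1) (cup l x (d m b y))"
    unfolding cup_def by (rule d_pc[OF mx y]) auto
  moreover have "pc (Suc (Suc l)) (- pc 1 \<mu> (d l a x)) y = - cup (Suc l) (d l a x) y"
    unfolding cup_def by (rule pc_uminus_left[OF pc_mu_E[OF d_E[OF x]] y]) auto
  moreover have "a - 1 + b = a + b - 1" by simp
  ultimately show ?thesis
    using y by (simp add: d_mu_pc[OF x]) (simp add: ksign_def)
qed

text \<open>
  Insertion is a homotopy for the commutativity of the product. By \<open>d_pc\<close> the boundaries of the \<open>x \<circ>\<^sub>i y\<close>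
  contribute \<open>R i\<close> at input \<open>i\<close> for \<open>i \<le> l\<close> and \<open>L i\<close> at input \<open>i\<close> for \<open>2 \<le> i \<le> l + 1\<close>. What is missing
  from \<open>(d x) \<circ> y\<close> is \<open>R (l + 1)\<close> and \<open>L 1\<close>, which consist of \<open>\<mu> \<circ>\<^sub>1 x\<close> and \<open>\<mu> \<circ>\<^sub>2 x\<close> only.
\<close>

lemma d_prelie:
  assumes x: "x \<in> E l a" and y: "y \<in> E m b" and n: "Suc n = l + m"
  shows "d n (a + b) (prelie l x y) = prelie (Suc l) (d l a x) y + ksign a (prelie l x (d m b y))
    - cup l x y - ksign (a * b) (cup m y x)"
proof -
  define A where "A i = pc i (R l a i x) y" for i
  define C where "C i = pc i (L a i x) y" for i
  have xy: "pc i x y \<in> E n (a + b)" if "i \<in> {1..<Suc l}" for i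
    using that n by (intro pcI[OF x y]) auto
  have "d n (a + b) (prelie l x y) = (\<Sum>i=1..<Suc l. d n (a + b) (pc i x y))"
    unfolding prelie_def by (rule d_sum[OF xy])
  also have "\<dots> = (\<Sum>i=1..<Suc l. A i + C (Suc i) + ksign a (pc i x (d m b y)))"
    unfolding A_def C_def by (intro sum.cong refl d_pc[OF x y _ _ n]) auto
  also have "\<dots> = (\<Sum>i=1..<Suc l. A i) + (\<Sum>i=1..<Suc l. C (Suc i)) + ksign a (prelie l x (d m b y))"
    by (simp only: sum.distrib prelie_def ksign_sum)
  also have "(\<Sum>i=1..<Suc l. C (Suc i)) = (\<Sum>i=1..<Suc (Suc l). C i) - C 1"
    using sum.atLeast_Suc_lessThan[of 1 "Suc (Suc l)" C]
    by (simp add: sum.shift_bounds_Suc_ivl[of C 1 "Suc l", symmetric] del: Suc_1)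
  also have "(\<Sum>i=1..<Suc l. A i) = (\<Sum>i=1..<Suc (Suc l). A i) - A (Suc l)"
    by (simp add: sum.op_ivl_Suc)
  finally have 1: "d n (a + b) (prelie l x y) = ((\<Sum>i=1..<Suc (Suc l). A i) + (\<Sum>i=1..<Suc (Suc l). C i))
      - A (Suc l) - C 1 + ksign a (prelie l x (d m b y))" by simp
  have "prelie (Suc l) (d l a x) y = (\<Sum>i=1..<Suc (Suc l). C i + A i)"
    unfolding prelie_def
  proof (intro sum.cong refl)
    fix i assume i: "i \<in> {1..<Suc (Suc l)}"
    then have "d l a x = L a i x + R l a i x" by (intro d_split) auto
    then show "pc i (d l a x) y = C i + A i"
      unfolding A_def C_def using i by (simp add: pc_add_left[OF L_E[OF x] R_E[OF x] y])
  qed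
  moreover have "A (Suc l) = cup l x y" by (simp add: A_def R_def cup_def)
  moreover have "C 1 = ksign (a * b) (cup m y x)"
    using cup_swap[OF x y] by (simp add: C_def L_def)
  ultimately show ?thesis using 1 by (simp add: sum.distrib)
qed

definition br :: "nat \<Rightarrow> int \<Rightarrow> nat \<Rightarrow> int \<Rightarrow> 'b \<Rightarrow> 'b \<Rightarrow> 'b" where
  "br l a m b x y = prelie l x y - ksign (a * b) (prelie m y x)"

lemma br_E: "\<lbrakk>x \<in> E l a; y \<in> E m b\<rbrakk> \<Longrightarrow> br l a m b x y \<in> E (l + m - 1) (a + b)"
  unfolding br_def using prelie_E'[of x l a y m b] prelie_E'[of y m b x l a]
  by (intro E_diff E_ksign) (auto simp: add.commute)

text \<open>
  The commutator of a pre-Lie product is a Lie bracket: after expanding with \<open>prelie_assoc\<close> all braces cancel.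
\<close>

lemma br_jacobi:
  assumes x: "x \<in> E l a" and y: "y \<in> E m b" and z: "z \<in> E n c"
  shows "br l a (m + n - 1) (b + c) x (br m b n c y z) =
    br (l + m - 1) (a + b) n c (br l a m b x y) z +
    ksign (a * b) (br m b (l + n - 1) (a + c) y (br l a n c x z))"
proof -
  note E = prelie_E'[OF x y] prelie_E'[OF y x] prelie_E'[OF x z] prelie_E'[OF z x]
    prelie_E'[OF y z] prelie_E'[OF z y]
  note E' = E[THEN E_ksign, of "a * b"] E[THEN E_ksign, of "a * c"] E[THEN E_ksign, of "b * c"]
  have c: "m + l - 1 = l + m - 1" "n + m - 1 = m + n - 1" "n + l - 1 = l + n - 1"
    "b + a = a + b" "c + b = b + c" "c + a = a + c" by simp_all
  note E = E[unfolded c] and E' = E'[unfolded c]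
  note assoc = prelie_assoc[OF x y z] prelie_assoc[OF y x z, unfolded c] prelie_assoc[OF x z y]
    prelie_assoc[OF z x y, unfolded c] prelie_assoc[OF y z x] prelie_assoc[OF z y x, unfolded c]
  have 1: "br l a (m + n - 1) (b + c) x (br m b n c y z) =
    prelie l x (prelie m y z) - ksign (b * c) (prelie l x (prelie n z y))
    - ksign (a * (b + c)) (prelie (m + n - 1) (prelie m y z) x - ksign (b * c) (prelie (m + n - 1) (prelie n z y) x))"
    unfolding br_def
    using E E' by (simp add: prelie_diff_right[OF x E(5) E'(18)] prelie_diff_left[OF E(5) E'(18) x]
        prelie_ksign_right[OF x E(6)] prelie_ksign_left[OF E(6) x])
  have 2: "br (l + m - 1) (a + b) n c (br l a m b x y) z =
    prelie (l + m - 1) (prelie l x y) z - ksign (a * b) (prelie (l + m - 1) (prelie m y x) z)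
    - ksign ((a + b) * c) (prelie n z (prelie l x y) - ksign (a * b) (prelie n z (prelie m y x)))"
    unfolding br_def
    using E E' by (simp add: prelie_diff_right[OF z E(1) E'(2)] prelie_diff_left[OF E(1) E'(2) z]
        prelie_ksign_right[OF z E(2)] prelie_ksign_left[OF E(2) z])
  have 3: "br m b (l + n - 1) (a + c) y (br l a n c x z) =
    prelie m y (prelie l x z) - ksign (a * c) (prelie m y (prelie n z x))
    - ksign (b * (a + c)) (prelie (l + n - 1) (prelie l x z) y - ksign (a * c) (prelie (l + n - 1) (prelie n z x) y))"
    unfolding br_def
    using E E' by (simp add: prelie_diff_right[OF y E(3) E'(10)] prelie_diff_left[OF E(3) E'(10) y]
        prelie_ksign_right[OF y E(4)] prelie_ksign_left[OF E(4) y])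
  show ?thesis
    unfolding 1 2 3 assoc
    by (cases "even a"; cases "even b"; cases "even c"; simp add: ksign_def)
qed

text \<open>
  The products in \<open>d_prelie\<close> are symmetric in \<open>x\<close> and \<open>y\<close> and cancel in the commutator.
\<close>

lemma d_br:
  assumes x: "x \<in> E l a" and y: "y \<in> E m b" and n: "Suc n = l + m"
  shows "d n (a + b) (br l a m b x y) =
    br (Suc l) (a - 1) m b (d l a x) y + ksign a (br l a (Suc m) (b - 1) x (d m b y))"
proof -
  have n': "Suc n = m + l" using n by simp
  have E: "prelie l x y \<in> E n (a + b)" "prelie m y x \<in> E n (a + b)"
    using n by (auto intro: prelie_E[OF x y] prelie_E[OF y x])
  have "d n (a + b) (br l a m b x y) = d n (a + b) (prelie l x y) - ksign (a * b) (d n (a + b) (prelie m y x))"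
    unfolding br_def by (simp add: d_diff[OF E(1) E_ksign[OF E(2)]] d_ksign[OF E(2)])
  then show ?thesis
    unfolding d_prelie[OF x y n] d_prelie[OF y x n', unfolded add.commute[of b a]] br_def
    by (cases "even a"; cases "even b"; simp add: ksign_def)
qed

lemma d_conv_prelie: "d l a x = prelie 2 \<mu> x + ksign (a + 1) (prelie l x \<mu>)"
proof -
  have "{1..<Suc 2} = {1, 2::nat}" by auto
  then show ?thesis by (simp add: d_def prelie_def)
qed

text \<open>
  The graded Jacobi identity only gives \<open>2 d d = 0\<close>. Expanding with the pre-Lie identity instead avoids
  the division by \<open>2\<close>: it uses \<open>\<mu> \<circ> \<mu> = 0\<close>, and \<open>(x \<circ> \<mu>) \<circ> \<mu> = 0\<close> because \<open>\<mu>\<close> is odd.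
\<close>

lemma d_d:
  assumes x: "x \<in> E l a"
  shows "d (Suc l) (a - 1) (d l a x) = 0"
proof -
  have iv: "{1..<3} = {1, 2::nat}" by auto
  have mm: "prelie 2 \<mu> \<mu> = 0" by (simp add: prelie_def iv mu_mu)
  have E: "prelie 2 \<mu> x \<in> E (Suc l) (a - 1)" "prelie l x \<mu> \<in> E (Suc l) (a - 1)"
    by (auto intro: prelie_E[OF mu_E x] prelie_E[OF x mu_E])
  note E' = E(2)[THEN E_ksign]
  note assoc = prelie_assoc[OF mu_E mu_E x] prelie_assoc[OF mu_E x mu_E] prelie_assoc[OF x mu_E mu_E]
  have s: "2 + l - 1 = Suc l" "2 + 2 - 1 = (3::nat)" "l + 2 - 1 = Suc l" by simp_all
  note assoc' = assoc[unfolded mm s prelie_zero_left[OF x] prelie_zero_right[OF x]]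
  have "d (Suc l) (a - 1) (d l a x) =
      prelie 2 \<mu> (prelie 2 \<mu> x) + ksign (a + 1) (prelie 2 \<mu> (prelie l x \<mu>))
      + ksign a (prelie (Suc l) (prelie 2 \<mu> x) \<mu>
        + ksign (a + 1) (prelie (Suc l) (prelie l x \<mu>) \<mu>))"
    unfolding d_conv_prelie
    by (simp add: prelie_add_right[OF mu_E E(1) E'] prelie_add_left[OF E(1) E' mu_E]
        prelie_ksign_right[OF mu_E E(2)] prelie_ksign_left[OF E(2) mu_E])
  moreover have "prelie 2 \<mu> (prelie 2 \<mu> x) = - ksign (- a) (brace 2 \<mu> \<mu> x) - brace 2 \<mu> x \<mu>"
    using assoc'(1) by (simp add: eq_neg_iff_add_eq_0 algebra_simps)
  ultimately show ?thesis
    unfolding assoc'(2,3)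
    by (cases "even a"; simp add: ksign_def)
qed

text \<open>
  Zero is listed separately because nothing has a boundary in arity \<open>0\<close>.
\<close>

definition bnd :: "nat \<Rightarrow> int \<Rightarrow> 'b set" where
  "bnd k a = {z. z = 0 \<or> (\<exists>j w. k = Suc j \<and> w \<in> E j (a + 1) \<and> z = d j (a + 1) w)}"

lemma bnd_zero [simp]: "0 \<in> bnd k a"
  by (simp add: bnd_def)

lemma bnd_d: "\<lbrakk>w \<in> E j b; b = a + 1; k = Suc j\<rbrakk> \<Longrightarrow> d j b w \<in> bnd k a"
  by (auto simp: bnd_def)

lemma bnd_add: "\<lbrakk>x \<in> bnd k a; y \<in> bnd k a\<rbrakk> \<Longrightarrow> x + y \<in> bnd k a"
  by (auto simp: bnd_def) (metis E_add d_add)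

lemma bnd_uminus: "x \<in> bnd k a \<Longrightarrow> - x \<in> bnd k a"
  by (auto simp: bnd_def) (metis E_uminus d_uminus)

lemma bnd_ksign: "x \<in> bnd k a \<Longrightarrow> ksign n x \<in> bnd k a"
  by (simp add: ksign_def bnd_uminus)

lemma bnd_sum: "(\<And>i. i \<in> A \<Longrightarrow> f i \<in> bnd k a) \<Longrightarrow> (\<Sum>i\<in>A. f i) \<in> bnd k a"
  by (induction A rule: infinite_finite_induct) (auto intro: bnd_add)

text \<open>
  In arity \<open>0\<close> there is no insertion \<open>x \<circ>\<^sub>i y\<close>, and the homotopy of \<open>d_prelie\<close> degenerates to this equation.
\<close>

lemma prelie_d_arity_0:
  assumes x: "x \<in> E 0 a" and y: "y \<in> E 0 b"
  shows "prelie 1 (d 0 a x) y = cup 0 x y + ksign (a * b) (cup 0 y x)"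
proof -
  have "d 0 a x = pc 1 \<mu> x + pc 2 \<mu> x" by (simp add: d_def One_nat_def)
  then show ?thesis
    using pc_add_left[OF pc_mu_E[OF x, of 1] pc_mu_E[OF x, of 2] y, of 1] cup_swap[OF x y]
    by (simp add: prelie_def cup_def One_nat_def)
qed

lemma cup_comm:
  assumes x: "x \<in> E l a" and y: "y \<in> E m b" and dx: "d l a x = 0" and dy: "d m b y = 0"
  shows "cup l x y + ksign (a * b) (cup m y x) \<in> bnd (l + m) (a + b - 1)"
proof (cases "l + m")
  case 0
  then show ?thesis using prelie_d_arity_0[of x a y b] x y dx by simp
next
  case (Suc n)
  have "d n (a + b) (prelie l x y) = - (cup l x y + ksign (a * b) (cup m y x))"
    using d_prelie[OF x y Suc[symmetric]] x y by (simp add: dx dy)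
  moreover have "d n (a + b) (prelie l x y) \<in> bnd (l + m) (a + b - 1)"
    using Suc by (intro bnd_d prelie_E[OF x y]) auto
  ultimately show ?thesis by (metis bnd_uminus minus_minus)
qed

section \<open>The derivation rule\<close>

text \<open>
  Insertion into a product is a derivation without any homotopy: an input of \<open>\<mu>(y, z)\<close> is an input of \<open>y\<close> or
  of \<open>z\<close>.
\<close>

lemma prelie_cup:
  assumes x: "x \<in> E l a" and y: "y \<in> E m b" and z: "z \<in> E n c"
  shows "prelie (m + n) (cup m y z) x =
    cup m y (prelie n z x) + ksign (a * c) (cup (m + l - 1) (prelie m y x) z)"
proof -
  have my: "pc 1 \<mu> y \<in> E (Suc m) (b - 1)" by (rule pc_mu_E[OF y]) simp
  have 1: "(\<Sum>i=1..<Suc m. pc i (cup m y z) x) = ksign (a * c) (cup (m + l - 1) (prelie m y x) z)"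
  proof -
    have "(\<Sum>i=1..<Suc m. pc i (cup m y z) x) = (\<Sum>i=1..<Suc m. ksign (a * c) (cup (m + l - 1) (pc i y x) z))"
    proof (intro sum.cong refl)
      fix i assume i: "i \<in> {1..<Suc m}"
      have "pc (m + l) (pc i (pc 1 \<mu> y) x) z = ksign (a * c) (pc i (cup m y z) x)"
        unfolding cup_def using i by (intro par[OF my x z]) auto
      moreover have "pc i (pc 1 \<mu> y) x = pc 1 \<mu> (pc i y x)"
        using i by (intro seq[OF mu_E y x]) auto
      moreover have "Suc (m + l - 1) = m + l" using i by simp
      ultimately show "pc i (cup m y z) x = ksign (a * c) (cup (m + l - 1) (pc i y x) z)"
        by (simp add: cup_def ksign_ksign) (simp add: ksign_def)
    qed
    also have "\<dots> = ksign (a * c) (cup (m + l - 1) (prelie m y x) z)"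
      unfolding prelie_def ksign_sum[symmetric]
      by (intro arg_cong[of _ _ "ksign (a * c)"] cup_sum_left[OF _ z, of _ _ "m + l - 1" "b + a", symmetric]
          pcI[OF y x]) auto
    finally show ?thesis .
  qed
  have 2: "(\<Sum>i=Suc m..<Suc (m + n). pc i (cup m y z) x) = cup m y (prelie n z x)"
  proof -
    have "(\<Sum>i=Suc m..<Suc (m + n). pc i (cup m y z) x) = (\<Sum>i=1..<Suc n. pc (i + m - 0) (cup m y z) x)"
      by (rule sum_shift_ivl) simp_all
    also have "\<dots> = (\<Sum>i=1..<Suc n. cup m y (pc i z x))"
      unfolding cup_def by (intro sum.cong refl seq[OF my z x]) auto
    also have "\<dots> = cup m y (prelie n z x)"
      unfolding prelie_def
      by (intro cup_sum_right[OF _ y, of _ _ "n + l - 1" "c + a", symmetric] pcI[OF z x]) auto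
    finally show ?thesis .
  qed
  have "prelie (m + n) (cup m y z) x = (\<Sum>i=1..<Suc m. pc i (cup m y z) x)
      + (\<Sum>i=Suc m..<Suc (m + n). pc i (cup m y z) x)"
    unfolding prelie_def by (rule sum.atLeastLessThan_concat[symmetric]) auto
  then show ?thesis by (simp add: 1 2)
qed

lemma d_pc_cycle:
  assumes x: "x \<in> E l a" and y: "y \<in> E m b" and j: "1 \<le> j" "j \<le> l" and n: "Suc n = l + m"
    and dy: "d m b y = 0"
  shows "d n (a + b) (pc j x y) = pc j (R l a j x) y + pc (Suc j) (L a (Suc j) x) y"
  using d_pc[OF x y j n] x j by (simp add: dy)

text \<open>
  The homotopy is the sum of \<open>(x \<circ>\<^sub>j z) \<circ>\<^sub>i y\<close> over \<open>i < j\<close>. Its boundary is compared with the sum of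
  \<open>((d x) \<circ>\<^sub>j z) \<circ>\<^sub>i y = 0\<close>. Three families of end terms remain: \<open>z\<close> at the last face gives \<open>(x \<circ> y) z\<close>, \<open>y\<close> at
  the first face gives \<open>y (x \<circ> z)\<close>, and the places where \<open>y\<close> and \<open>z\<close> meet at one face give \<open>x \<circ> (y z)\<close>.
\<close>

lemma prelie_cup_homotopy:
  assumes x: "x \<in> E l a" and y: "y \<in> E m b" and z: "z \<in> E n c"
    and dx: "d l a x = 0" and dy: "d m b y = 0" and dz: "d n c z = 0"
  shows "prelie l x (cup m y z) - ksign a (cup (l + m - 1) (prelie l x y) z)
      - ksign (a + a * b) (cup m y (prelie l x z)) \<in> bnd (l + m + n - 1) (a + b + c - 1)"
proof -
  define A where "A j i = pc i (pc j (R l a j x) z) y" for j i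
  define F where "F j i = pc i (pc (Suc j) (L a (Suc j) x) z) y" for j i
  define C where "C j i = pc i (pc (Suc j) (L a i x) z) y" for j i
  define N where "N = l + m + n - 2"
  define T where "T j i = d N (a + b + c) (pc i (pc j x z) y)" for j i
  have Rx: "R l a k x \<in> E (Suc l) (a - 1)" if "1 \<le> k" for k using R_E[OF x that] .
  have Lx: "L a k x \<in> E (Suc l) (a - 1)" if "k \<le> Suc l" for k using L_E[OF x that] .
  have T: "T j i = A j i + F j i - C j i + C j (Suc i)" if "i \<in> {1..<j}" "j \<in> {1..<Suc l}" for i j
  proof -
    have ij: "1 \<le> i" "i < j" "j \<le> l" using that by auto
    define v where "v = pc j x z"
    define M where "M = l + n - 1"
    have M: "Suc M = l + n" and iM: "i \<le> M" and jM: "j < Suc (Suc M)" using ij by (auto simp: M_def)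
    have v: "v \<in> E M (a + c)" unfolding v_def using ij M by (intro pcI[OF x z]) auto
    have "d N (a + c + b) (pc i v y) = pc i (R M (a + c) i v) y + pc (Suc i) (L (a + c) (Suc i) v) y"
      using ij iM by (intro d_pc_cycle[OF v y _ _ _ dy]) (auto simp: N_def M_def)
    also have "L (a + c) (Suc i) v = pc (Suc j) (L a (Suc i) x) z"
      unfolding v_def using ij by (intro L_pc[OF x z]) auto
    also have "R M (a + c) i v = d M (a + c) v - L (a + c) i v"
      using d_split[of i M "a + c" v] ij iM by simp
    also have "L (a + c) i v = pc (Suc j) (L a i x) z"
      unfolding v_def using ij by (intro L_pc[OF x z]) auto
    also have "d M (a + c) v = pc j (R l a j x) z + pc (Suc j) (L a (Suc j) x) z"
      unfolding v_def using ij M by (intro d_pc_cycle[OF x z _ _ _ dz]) auto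
    also have "pc i (pc j (R l a j x) z + pc (Suc j) (L a (Suc j) x) z - pc (Suc j) (L a i x) z) y
        = A j i + F j i - C j i"
    proof -
      have E: "pc j (R l a j x) z \<in> E (Suc M) (a - 1 + c)"
        "pc (Suc j) (L a (Suc j) x) z \<in> E (Suc M) (a - 1 + c)"
        "pc (Suc j) (L a i x) z \<in> E (Suc M) (a - 1 + c)"
        using ij M by (auto intro!: pcI[OF Rx z] pcI[OF Lx z])
      have "pc i (pc j (R l a j x) z + pc (Suc j) (L a (Suc j) x) z - pc (Suc j) (L a i x) z) y
        = pc i (pc j (R l a j x) z) y + pc i (pc (Suc j) (L a (Suc j) x) z) y - pc i (pc (Suc j) (L a i x) z) y"
        using ij iM by (simp add: pc_diff_left[OF E_add[OF E(1,2)] E(3) y] pc_add_left[OF E(1,2) y])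
      then show ?thesis by (simp add: A_def F_def C_def)
    qed
    finally show ?thesis by (simp add: T_def v_def C_def add_ac)
  qed
  \<comment> \<open>the terms of \<open>((d x) \<circ>\<^sub>j z) \<circ>\<^sub>i y\<close>, with \<open>d x\<close> cut at the input of \<open>z\<close>\<close>
  have zero: "(\<Sum>j=1..<Suc (Suc l). \<Sum>i=1..<j. A j i + F (j - 1) i) = 0"
  proof (intro sum.neutral ballI)
    fix j i assume ij: "j \<in> {1..<Suc (Suc l)}" "i \<in> {1..<j}"
    have "pc i (pc j (d l a x) z) y = A j i + F (j - 1) i"
    proof -
      have E: "pc j (R l a j x) z \<in> E (l + n) (a - 1 + c)" "pc j (L a j x) z \<in> E (l + n) (a - 1 + c)"
        using ij by (auto intro!: pcI[OF Rx z] pcI[OF Lx z])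
      have "pc j (d l a x) z = pc j (R l a j x) z + pc j (L a j x) z"
        using ij by (simp add: d_split[of j l a x] pc_add_left[OF Lx Rx z] add.commute)
      then show ?thesis using ij by (simp add: pc_add_left[OF E y] A_def F_def)
    qed
    then show "A j i + F (j - 1) i = 0"
      using ij y by (simp add: dx pc_zero_left[OF z])
  qed
  \<comment> \<open>the terms \<open>C\<close> telescope in \<open>i\<close>, the others cancel against \<open>zero\<close>\<close>
  have "(\<Sum>j=1..<Suc l. \<Sum>i=1..<j. T j i) =
      (\<Sum>j=1..<Suc l. \<Sum>i=1..<j. A j i + F j i - C j i + C j (Suc i))"
    by (intro sum.cong refl T)
  also have "\<dots> = (\<Sum>j=1..<Suc l. \<Sum>i=1..<j. A j i) + (\<Sum>j=1..<Suc l. \<Sum>i=1..<j. F j i)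
      + (\<Sum>j=1..<Suc l. \<Sum>i=1..<j. C j (Suc i) - C j i)"
    by (simp add: sum.distrib sum_subtractf algebra_simps)
  also have "(\<Sum>j=1..<Suc l. \<Sum>i=1..<j. C j (Suc i) - C j i) = (\<Sum>j=1..<Suc l. C j j - C j 1)"
    by (intro sum.cong refl sum_Suc_diff') auto
  finally have 1: "(\<Sum>j=1..<Suc l. \<Sum>i=1..<j. T j i) =
      (\<Sum>j=1..<Suc l. \<Sum>i=1..<j. A j i) + (\<Sum>j=1..<Suc l. \<Sum>i=1..<j. F j i)
      + (\<Sum>j=1..<Suc l. C j j) - (\<Sum>j=1..<Suc l. C j 1)" by (simp add: sum_subtractf)
  have 2: "(\<Sum>j=1..<Suc l. \<Sum>i=1..<j. A j i) + (\<Sum>i=1..<Suc l. A (Suc l) i)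
     + ((\<Sum>j=1..<Suc l. \<Sum>i=1..<j. F j i) + (\<Sum>j=1..<Suc l. F j j)) = 0"
  proof -
    have "(\<Sum>j=1..<Suc (Suc l). \<Sum>i=1..<j. F (j - 1) i) = (\<Sum>j=0..<Suc l. \<Sum>i=1..<Suc j. F j i)"
      using sum.shift_bounds_Suc_ivl[of "\<lambda>j. \<Sum>i=1..<j. F (j - 1) i" 0 "Suc l"] by (simp add: One_nat_def)
    also have "\<dots> = (\<Sum>j=1..<Suc l. \<Sum>i=1..<Suc j. F j i)"
      by (simp add: sum.atLeast_Suc_lessThan[of 0] One_nat_def)
    also have "\<dots> = (\<Sum>j=1..<Suc l. (\<Sum>i=1..<j. F j i) + F j j)"
      by (intro sum.cong refl) (simp add: sum.op_ivl_Suc)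
    finally show ?thesis
      using zero by (simp add: sum.distrib sum.op_ivl_Suc[of _ 1 "Suc l"])
  qed
  \<comment> \<open>\<open>z\<close> at the last face\<close>
  have A: "(\<Sum>i=1..<Suc l. A (Suc l) i) = ksign (b * c) (cup (l + m - 1) (prelie l x y) z)"
  proof -
    have "A (Suc l) i = ksign (b * c) (cup (l + m - 1) (pc i x y) z)" if i: "i \<in> {1..<Suc l}" for i
    proof -
      have "pc (l + m) (pc i (pc 1 \<mu> x) y) z = ksign (b * c) (pc i (pc (Suc l) (pc 1 \<mu> x) z) y)"
        using i by (intro par[OF pc_mu_E[OF x] y z]) auto
      moreover have "pc i (pc 1 \<mu> x) y = pc 1 \<mu> (pc i x y)"
        using i by (intro seq[OF mu_E x y]) auto
      moreover have "Suc (l + m - 1) = l + m" using i by simp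
      ultimately show ?thesis by (simp add: cup_def A_def R_def ksign_ksign) (simp add: ksign_def)
    qed
    then have "(\<Sum>i=1..<Suc l. A (Suc l) i) = ksign (b * c) (\<Sum>i=1..<Suc l. cup (l + m - 1) (pc i x y) z)"
      by (simp add: ksign_sum)
    also have "(\<Sum>i=1..<Suc l. cup (l + m - 1) (pc i x y) z) = cup (l + m - 1) (prelie l x y) z"
      unfolding prelie_def
      by (intro cup_sum_left[OF _ z, of _ _ "l + m - 1" "a + b", symmetric] pcI[OF x y]) auto
    finally show ?thesis .
  qed
  \<comment> \<open>\<open>y\<close> and \<open>z\<close> at the same face \<open>x \<circ>\<^sub>j \<mu>\<close>\<close>
  have CF: "C j j - F j j = ksign (a + b * c) (pc j x (cup m y z))" if j: "j \<in> {1..<Suc l}" for j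
  proof -
    have xm: "pc j x \<mu> \<in> E (Suc l) (a - 1)" using j by (intro mu_pc_E[OF x]) auto
    have "L a j x - L a (Suc j) x = - ksign (a + 1) (pc j x \<mu>)"
      using j by (simp add: L_def ksign_add sum.op_ivl_Suc)
    then have "L a j x - L a (Suc j) x = ksign a (pc j x \<mu>)"
      by (simp add: ksign_def split: if_splits)
    moreover have "C j j - F j j = pc j (pc (Suc j) (L a j x - L a (Suc j) x) z) y"
    proof -
      have E: "pc (Suc j) (L a j x) z \<in> E (l + n) (a - 1 + c)"
        "pc (Suc j) (L a (Suc j) x) z \<in> E (l + n) (a - 1 + c)"
        using j by (auto intro!: pcI[OF Lx z])
      show ?thesis
        using j by (simp add: C_def F_def pc_diff_left[OF Lx Lx z] pc_diff_left[OF E y])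
    qed
    moreover have "pc j (pc (Suc j) (ksign a (pc j x \<mu>)) z) y = ksign a (pc j (pc (Suc j) (pc j x \<mu>) z) y)"
    proof -
      have "pc (Suc j) (pc j x \<mu>) z \<in> E (l + n) (a - 1 + c)"
        using j by (intro pcI[OF xm z]) auto
      then show ?thesis
        using j by (simp add: pc_ksign_left[OF xm z] pc_ksign_left[OF _ y, of _ "l + n" "a - 1 + c"])
    qed
    moreover have "pc (Suc j) (pc j x \<mu>) z = pc j x (pc 2 \<mu> z)"
      using j by (intro seq[OF x mu_E z]) auto
    moreover have "pc j (pc j x (pc 2 \<mu> z)) y = pc j x (pc 1 (pc 2 \<mu> z) y)"
      using j by (intro seq[OF x pc_mu_E[OF z] y]) auto
    moreover have "pc 1 (pc 2 \<mu> z) y = ksign (c * b) (cup m y z)"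
      by (rule cup_swap[OF z y])
    moreover have "pc j x (ksign (c * b) (cup m y z)) = ksign (c * b) (pc j x (cup m y z))"
      using j by (intro pc_ksign_right[OF x cup_E[OF y z]]) auto
    ultimately show ?thesis by (simp add: ksign_ksign mult.commute)
  qed
  \<comment> \<open>\<open>y\<close> at the first face\<close>
  have C1: "C j 1 = ksign ((a + c) * b) (cup m y (pc j x z))" if j: "j \<in> {1..<Suc l}" for j
  proof -
    have xz: "pc j x z \<in> E (l + n - 1) (a + c)" using j by (intro pcI[OF x z]) auto
    have "pc (Suc j) (pc 2 \<mu> x) z = pc 2 \<mu> (pc j x z)"
      using j by (intro seq[OF mu_E x z]) auto
    then show ?thesis by (simp add: C_def L_def cup_swap[OF xz y])
  qed
  have CFs: "(\<Sum>j=1..<Suc l. C j j) - (\<Sum>j=1..<Suc l. F j j) = ksign (a + b * c) (prelie l x (cup m y z))"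
    unfolding sum_subtractf[symmetric] prelie_def ksign_sum by (intro sum.cong refl CF)
  have C1s: "(\<Sum>j=1..<Suc l. C j 1) = ksign ((a + c) * b) (cup m y (prelie l x z))"
  proof -
    have "(\<Sum>j=1..<Suc l. C j 1) = ksign ((a + c) * b) (\<Sum>j=1..<Suc l. cup m y (pc j x z))"
      unfolding ksign_sum by (intro sum.cong refl C1)
    also have "(\<Sum>j=1..<Suc l. cup m y (pc j x z)) = cup m y (prelie l x z)"
      unfolding prelie_def
      by (intro cup_sum_right[OF _ y, of _ _ "l + n - 1" "a + c", symmetric] pcI[OF x z]) auto
    finally show ?thesis .
  qed
  have "(\<Sum>j=1..<Suc l. \<Sum>i=1..<j. T j i) = - (\<Sum>i=1..<Suc l. A (Suc l) i)
      + ((\<Sum>j=1..<Suc l. C j j) - (\<Sum>j=1..<Suc l. F j j)) - (\<Sum>j=1..<Suc l. C j 1)"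
    using 1 2 by (rule cancel_zero_sum)
  also have "\<dots> = ksign (a + b * c) (prelie l x (cup m y z))
      - ksign (b * c) (cup (l + m - 1) (prelie l x y) z) - ksign ((a + c) * b) (cup m y (prelie l x z))"
    unfolding A CFs C1s by simp
  also have "\<dots> = ksign (a + b * c) (prelie l x (cup m y z) - ksign a (cup (l + m - 1) (prelie l x y) z)
      - ksign (a + a * b) (cup m y (prelie l x z)))"
    by (cases "even a"; cases "even b"; cases "even c"; simp add: ksign_def)
  finally have 3: "ksign (a + b * c) (\<Sum>j=1..<Suc l. \<Sum>i=1..<j. T j i) =
      prelie l x (cup m y z) - ksign a (cup (l + m - 1) (prelie l x y) z)
      - ksign (a + a * b) (cup m y (prelie l x z))"
    by (simp only: ksign_ksign) (simp add: ksign_def)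
  have "T j i \<in> bnd (l + m + n - 1) (a + b + c - 1)" if "j \<in> {1..<Suc l}" "i \<in> {1..<j}" for j i
    unfolding T_def
  proof (rule bnd_d)
    have xz: "pc j x z \<in> E (l + n - 1) (a + c)" using that by (intro pcI[OF x z]) auto
    show "pc i (pc j x z) y \<in> E N (a + b + c)"
      using that by (intro pcI[OF xz y]) (auto simp: N_def)
  qed (use that in \<open>auto simp: N_def\<close>)
  then show ?thesis unfolding 3[symmetric] by (intro bnd_ksign bnd_sum)
qed

section \<open>Normalization of cycles\<close>

lemma mu2_e: "x \<in> E l a \<Longrightarrow> pc 1 (pc 2 \<mu> x) e = ksign (a + 1) x"
  using cup_swap[of x l a e 0 1] e_E cup_e_left[of x l a] by (auto simp: ksign_def)

lemma pc_mu_e_right: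
  assumes x: "x \<in> E l a" and t: "1 \<le> t" "t \<le> l"
  shows "pc (Suc t) (pc t x \<mu>) e = x"
proof -
  have "pc (Suc t) (pc t x \<mu>) e = pc t x (pc 2 \<mu> e)"
    using t by (intro seq[OF x mu_E e_E]) auto
  then show ?thesis using idt_right[OF x t] by (simp add: mu_e_right)
qed

lemma pc_mu_e_left:
  assumes x: "x \<in> E l a" and t: "1 \<le> t" "t \<le> l"
  shows "pc t (pc t x \<mu>) e = - x"
proof -
  have "pc t (pc t x \<mu>) e = pc t x (pc 1 \<mu> e)"
    using t by (intro seq[OF x mu_E e_E]) auto
  then show ?thesis using idt_right[OF x t] pc_uminus_right[OF x idt_E t] by (simp add: mu_e_left)
qed

text \<open>
  Plugging \<open>e\<close> next to a \<open>\<mu>\<close> removes both; the faces on either side of \<open>e\<close> cancel, and all others contain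
  \<open>x \<circ>\<^sub>i e\<close> for some \<open>i < k\<close>. In the first equation \<open>e\<close> is at the cut, where only the left one of these two
  faces is present.
\<close>

lemma L_e_vanish:
  assumes x: "x \<in> E l a" and k: "1 \<le> k" "k \<le> l" and nrm: "\<And>i. 1 \<le> i \<Longrightarrow> i < k \<Longrightarrow> pc i x e = 0"
  shows "pc k (L a k x) e = ksign (a + 1) x"
    and "1 \<le> i \<Longrightarrow> i \<le> k \<Longrightarrow> pc i (L a (Suc k) x) e = 0"
proof -
  have xm: "pc t x \<mu> \<in> E (Suc l) (a - 1)" if "1 \<le> t" "t \<le> l" for t using mu_pc_E[OF x that] .
  have mx: "pc 2 \<mu> x \<in> E (Suc l) (a - 1)" by (rule pc_mu_E[OF x]) simp
  have D: "pc i (L a j x) e = pc i (pc 2 \<mu> x) e + ksign (a + 1) (\<Sum>t=1..<j. pc i (pc t x \<mu>) e)"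
    if "1 \<le> i" "i \<le> Suc l" "j \<le> Suc l" for i j
  proof -
    have S: "(\<Sum>t=1..<j. pc t x \<mu>) \<in> E (Suc l) (a - 1)" using that by (intro E_sum xm) auto
    have "pc i (\<Sum>t=1..<j. pc t x \<mu>) e = (\<Sum>t=1..<j. pc i (pc t x \<mu>) e)"
      using that by (intro pc_sum_left[OF xm e_E]) auto
    then show ?thesis
      unfolding L_def using that
      by (simp add: pc_add_left[OF mx E_ksign[OF S] e_E] pc_ksign_left[OF S e_E])
  qed
  have m2: "pc i (pc 2 \<mu> x) e = 0" if "2 \<le> i" "i \<le> k" for i
  proof -
    have "pc i (pc 2 \<mu> x) e = pc 2 \<mu> (pc (i - 1) x e)"
      using that k by (intro seq[OF mu_E x e_E]) auto
    then show ?thesis using that nrm by (simp add: pc_zero_right[OF mu_E])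
  qed
  have below: "pc i (pc t x \<mu>) e = 0" if "1 \<le> t" "Suc t < i" "i \<le> k" for t i
  proof -
    have "pc i (pc t x \<mu>) e = ksign (-1 * 1) (pc t (pc (i - 1) x e) \<mu>)"
      using that k by (intro par[OF x mu_E e_E]) auto
    then show ?thesis using that nrm mu_E by simp
  qed
  have above: "pc i (pc t x \<mu>) e = 0" if "1 \<le> i" "i < t" "t \<le> k" for t i
  proof -
    have "pc (t - 1) (pc i x e) \<mu> = ksign (1 * -1) (pc i (pc t x \<mu>) e)"
      using that k by (intro par[OF x e_E mu_E]) auto
    then show ?thesis using that nrm mu_E by (simp add: pc_zero_left[OF mu_E])
  qed
  show "pc k (L a k x) e = ksign (a + 1) x"
  proof (cases "k = 1")
    case True
    then show ?thesis using D[of 1 1] mu2_e[OF x] by simp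
  next
    case False
    then have k': "2 \<le> k" "Suc (k - 1) = k" using k by auto
    have "(\<Sum>t=1..<k. pc k (pc t x \<mu>) e) = (\<Sum>t=1..<k-1. pc k (pc t x \<mu>) e) + pc k (pc (k - 1) x \<mu>) e"
      using sum.op_ivl_Suc[of "\<lambda>t. pc k (pc t x \<mu>) e" 1 "k - 1"] k' by simp
    also have "(\<Sum>t=1..<k-1. pc k (pc t x \<mu>) e) = 0"
      using below by (intro sum.neutral) auto
    also have "pc k (pc (k - 1) x \<mu>) e = x"
      using pc_mu_e_right[OF x, of "k - 1"] k' k by simp
    finally show ?thesis using D[of k k] m2[of k] k k' by simp
  qed
  assume i: "1 \<le> i" "i \<le> k"
  have split: "(\<Sum>t=1..<Suc k. pc i (pc t x \<mu>) e) =
      (\<Sum>t=1..<i. pc i (pc t x \<mu>) e) + pc i (pc i x \<mu>) e + (\<Sum>t=Suc i..<Suc k. pc i (pc t x \<mu>) e)"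
    using i sum.atLeastLessThan_concat[of 1 i "Suc k" "\<lambda>t. pc i (pc t x \<mu>) e", symmetric]
      sum.atLeast_Suc_lessThan[of i "Suc k" "\<lambda>t. pc i (pc t x \<mu>) e"] by (simp add: add.assoc)
  have s3: "(\<Sum>t=Suc i..<Suc k. pc i (pc t x \<mu>) e) = 0"
    using above i by (intro sum.neutral) auto
  have s2: "pc i (pc i x \<mu>) e = - x" using pc_mu_e_left[OF x] i k by auto
  show "pc i (L a (Suc k) x) e = 0"
  proof (cases "i = 1")
    case True
    then show ?thesis using D[of 1 "Suc k"] k split s2 s3 mu2_e[OF x] by (simp add: ksign_uminus)
  next
    case False
    then have i': "2 \<le> i" "Suc (i - 1) = i" using i by auto
    have "(\<Sum>t=1..<i. pc i (pc t x \<mu>) e) = (\<Sum>t=1..<i-1. pc i (pc t x \<mu>) e) + pc i (pc (i - 1) x \<mu>) e"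
      using sum.op_ivl_Suc[of "\<lambda>t. pc i (pc t x \<mu>) e" 1 "i - 1"] i' by simp
    also have "(\<Sum>t=1..<i-1. pc i (pc t x \<mu>) e) = 0"
      using below i by (intro sum.neutral) auto
    also have "pc i (pc (i - 1) x \<mu>) e = x"
      using pc_mu_e_right[OF x, of "i - 1"] i' i k by simp
    finally show ?thesis using D[of i "Suc k"] m2[of i] k i i' split s2 s3 by simp
  qed
qed

lemma d_e: "d 0 1 e = 0"
  by (simp add: d_def One_nat_def[symmetric] mu_e_left mu_e_right)

text \<open>
  The boundary of \<open>x \<circ>\<^sub>k e\<close> is \<open>(R k x) \<circ>\<^sub>k e + (L (k + 1) x) \<circ>\<^bsub>k+1\<^esub> e\<close>, and for a cycle \<open>R k x = - L k x\<close>. By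
  \<open>L_e_vanish\<close> the first summand is \<open>\<plusminus> x\<close>, so the second one is, up to sign, homologous to \<open>x\<close>, and it is killed
  by \<open>e\<close> at the first \<open>k\<close> inputs.
\<close>

lemma normalize_step:
  assumes x: "x \<in> E l a" and dx: "d l a x = 0" and k: "1 \<le> k" "k \<le> l"
    and nrm: "\<And>i. 1 \<le> i \<Longrightarrow> i < k \<Longrightarrow> pc i x e = 0"
  obtains x' where "x' \<in> E l a" "d l a x' = 0" "x' - x \<in> bnd l a" "\<And>i. 1 \<le> i \<Longrightarrow> i \<le> k \<Longrightarrow> pc i x' e = 0"
proof -
  have Lx: "L a (Suc k) x \<in> E (Suc l) (a - 1)" using k by (intro L_E[OF x]) auto
  define w where "w = pc (Suc k) (L a (Suc k) x) e"
  have w: "w \<in> E l a" unfolding w_def using k by (intro pcI[OF Lx e_E]) auto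
  have xe: "pc k x e \<in> E (l - 1) (a + 1)" using k by (intro pcI[OF x e_E]) auto
  have "d (l - 1) (a + 1) (pc k x e) = pc k (R l a k x) e + w"
    unfolding w_def using k by (intro d_pc_cycle[OF x e_E _ _ _ d_e]) auto
  moreover have "R l a k x = - L a k x"
    using d_split[of k l a x] k dx by (simp add: eq_neg_iff_add_eq_0 add.commute)
  moreover have "pc k (- L a k x) e = - ksign (a + 1) x"
    using k L_e_vanish(1)[OF x k nrm] pc_uminus_left[OF L_E[OF x] e_E, of k k] by simp
  ultimately have dw: "d (l - 1) (a + 1) (pc k x e) = w - ksign (a + 1) x" by simp
  have B: "ksign (a + 1) (d (l - 1) (a + 1) (pc k x e)) \<in> bnd l a"
    using k by (intro bnd_ksign bnd_d[OF xe]) auto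
  define x' where "x' = ksign (a + 1) w"
  have e: "x' - x = ksign (a + 1) (d (l - 1) (a + 1) (pc k x e))"
    unfolding dw x'_def ksign_diff ksign_ksign by (simp add: ksign_def)
  show ?thesis
  proof
    show x': "x' \<in> E l a" unfolding x'_def by (rule E_ksign[OF w])
    show "x' - x \<in> bnd l a" unfolding e by (rule B)
    have "d l a (d (l - 1) (a + 1) (pc k x e)) = 0"
      using d_d[OF xe] k by simp
    moreover have "d (l - 1) (a + 1) (pc k x e) \<in> E l a" using d_E[OF xe] k by simp
    ultimately have "d l a (x' - x) = 0" unfolding e by (simp add: d_ksign)
    then show "d l a x' = 0" using d_diff[OF x' x] dx by simp
    fix i assume i: "1 \<le> i" "i \<le> k"
    have "pc k (pc i (L a (Suc k) x) e) e = ksign (1 * 1) (pc i (pc (Suc k) (L a (Suc k) x) e) e)"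
      using i k by (intro par[OF Lx e_E e_E]) auto
    then have "pc i w e = 0"
      using L_e_vanish(2)[OF x k nrm i] k e_E by (simp add: w_def)
    then show "pc i x' e = 0"
      unfolding x'_def using i k by (simp add: pc_ksign_left[OF w e_E])
  qed
qed

lemma normalize_cycle:
  assumes x: "x \<in> E l a" and dx: "d l a x = 0"
  obtains x' where "x' \<in> E l a" "d l a x' = 0" "x' - x \<in> bnd l a" "\<And>i. 1 \<le> i \<Longrightarrow> i \<le> l \<Longrightarrow> pc i x' e = 0"
proof -
  have "\<exists>x'. x' \<in> E l a \<and> d l a x' = 0 \<and> x' - x \<in> bnd l a \<and> (\<forall>i. 1 \<le> i \<longrightarrow> i \<le> k \<longrightarrow> pc i x' e = 0)"
    if "k \<le> l" for k
    using that
  proof (induction k)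
    case 0
    then show ?case using x dx by (intro exI[of _ x]) simp
  next
    case (Suc k)
    then obtain u where u: "u \<in> E l a" "d l a u = 0" "u - x \<in> bnd l a" "\<And>i. 1 \<le> i \<Longrightarrow> i < Suc k \<Longrightarrow> pc i u e = 0"
      by auto
    obtain x' where x': "x' \<in> E l a" "d l a x' = 0" "x' - u \<in> bnd l a" "\<And>i. 1 \<le> i \<Longrightarrow> i \<le> Suc k \<Longrightarrow> pc i x' e = 0"
      using normalize_step[OF u(1,2) _ Suc.prems u(4)] by auto
    have "x' - x \<in> bnd l a" using bnd_add[OF x'(3) u(3)] by simp
    then show ?case using x' by blast
  qed
  from this[of l] show ?thesis using that by auto
qed

section \<open>Operations on cycles\<close>

definition cyc :: "nat \<Rightarrow> int \<Rightarrow> 'b set" where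
  "cyc l a = {x \<in> E l a. d l a x = 0}"

lemma cycI: "\<lbrakk>x \<in> E l a; d l a x = 0\<rbrakk> \<Longrightarrow> x \<in> cyc l a"
  by (simp add: cyc_def)

lemma cyc_E: "x \<in> cyc l a \<Longrightarrow> x \<in> E l a" and cyc_d: "x \<in> cyc l a \<Longrightarrow> d l a x = 0"
  by (simp_all add: cyc_def)

lemma bnd_cases:
  assumes "z \<in> bnd k a"
  obtains "z = 0" | j w where "k = Suc j" "w \<in> E j (a + 1)" "z = d j (a + 1) w"
  using assms by (auto simp: bnd_def)

definition prod :: "nat \<Rightarrow> int \<Rightarrow> 'b \<Rightarrow> 'b \<Rightarrow> 'b" where
  "prod l a x y = ksign a (cup l x y)"

lemma prod_cyc: "\<lbrakk>x \<in> cyc l a; y \<in> cyc m b\<rbrakk> \<Longrightarrow> prod l a x y \<in> cyc (l + m) (a + b - 1)"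
proof (rule cycI)
  assume x: "x \<in> cyc l a" and y: "y \<in> cyc m b"
  note xE = cyc_E[OF x] and yE = cyc_E[OF y]
  show "prod l a x y \<in> E (l + m) (a + b - 1)"
    unfolding prod_def by (intro E_ksign cup_E xE yE)
  show "d (l + m) (a + b - 1) (prod l a x y) = 0"
    using xE yE by (simp add: prod_def d_ksign[OF cup_E[OF xE yE]] d_cup[OF xE yE] cyc_d[OF x] cyc_d[OF y])
qed

lemma prod_bnd_right:
  assumes x: "x \<in> cyc l a" and y: "y \<in> bnd m b"
  shows "prod l a x y \<in> bnd (l + m) (a + b - 1)"
  using y
proof (cases rule: bnd_cases)
  case 1
  then show ?thesis using cyc_E[OF x] by (simp add: prod_def)
next
  case (2 j w)
  have "d (l + j) (a + (b + 1) - 1) (cup l x w) \<in> bnd (l + m) (a + b - 1)"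
    by (intro bnd_d cup_E[OF cyc_E[OF x] 2(2)]) (auto simp: 2)
  then have "ksign (a + 1) (cup l x y) \<in> bnd (l + m) (a + b - 1)"
    using d_cup[OF cyc_E[OF x] 2(2)] by (simp add: cyc_d[OF x] 2 cup_zero_left[OF 2(2)])
  then have "ksign 1 (ksign (a + 1) (cup l x y)) \<in> bnd (l + m) (a + b - 1)"
    by (rule bnd_ksign)
  then show ?thesis by (simp add: prod_def ksign_ksign) (simp add: ksign_def)
qed

lemma prod_bnd_left:
  assumes x: "x \<in> bnd l a" and y: "y \<in> cyc m b"
  shows "prod l a x y \<in> bnd (l + m) (a + b - 1)"
  using x
proof (cases rule: bnd_cases)
  case 1
  then show ?thesis using cyc_E[OF y] by (simp add: prod_def)
next
  case (2 j w)
  have "d (j + m) (a + 1 + b - 1) (cup j w y) \<in> bnd (l + m) (a + b - 1)"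
    by (intro bnd_d cup_E[OF 2(2) cyc_E[OF y]]) (auto simp: 2)
  then have "- cup l x y \<in> bnd (l + m) (a + b - 1)"
    using d_cup[OF 2(2) cyc_E[OF y]] by (simp add: cyc_d[OF y] 2 cup_zero_right[OF 2(2)])
  then have "cup l x y \<in> bnd (l + m) (a + b - 1)"
    using bnd_uminus by fastforce
  then show ?thesis unfolding prod_def by (rule bnd_ksign)
qed

lemma prod_assoc:
  assumes x: "x \<in> E l a" and y: "y \<in> E m b" and z: "z \<in> E n c"
  shows "prod (l + m) (a + b - 1) (prod l a x y) z = prod l a x (prod m b y z)"
  unfolding prod_def
  by (simp add: cup_ksign_left[OF cup_E[OF x y] z] cup_ksign_right[OF x cup_E[OF y z]]
      cup_assoc[OF x y z] ksign_ksign) (simp add: ksign_def)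

lemma prod_comm:
  assumes x: "x \<in> cyc l a" and y: "y \<in> cyc m b"
  shows "prod l a x y - ksign ((a - 1) * (b - 1)) (prod m b y x) \<in> bnd (l + m) (a + b - 1)"
proof -
  have "ksign a (cup l x y + ksign (a * b) (cup m y x)) \<in> bnd (l + m) (a + b - 1)"
    using x y by (intro bnd_ksign cup_comm) (auto simp: cyc_def)
  also have "ksign a (cup l x y + ksign (a * b) (cup m y x)) =
      prod l a x y - ksign ((a - 1) * (b - 1)) (prod m b y x)"
    by (cases "even a"; cases "even b"; simp add: ksign_def prod_def)
  finally show ?thesis .
qed

lemma prod_e_left: "y \<in> E m b \<Longrightarrow> prod 0 1 e y = y"
  by (simp add: prod_def cup_e_left ksign_def)

lemma prod_e_right: "x \<in> E l a \<Longrightarrow> prod l a x e = x"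
  by (simp add: prod_def cup_e_right ksign_def)

lemma br_0_0: "br 0 a 0 b x y = 0"
  by (simp add: br_def)

lemma br_zero_left: "y \<in> E m b \<Longrightarrow> br l a m b 0 y = 0"
  by (simp add: br_def)

lemma br_zero_right: "x \<in> E l a \<Longrightarrow> br l a m b x 0 = 0"
  by (simp add: br_def)

lemma br_cyc:
  assumes x: "x \<in> cyc l a" and y: "y \<in> cyc m b"
  shows "br l a m b x y \<in> cyc (l + m - 1) (a + b)"
proof (rule cycI)
  note xE = cyc_E[OF x] and yE = cyc_E[OF y]
  show "br l a m b x y \<in> E (l + m - 1) (a + b)" by (rule br_E[OF xE yE])
  show "d (l + m - 1) (a + b) (br l a m b x y) = 0"
  proof (cases "l + m = 0")
    case True
    then show ?thesis by (simp add: br_0_0)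
  next
    case False
    then have n: "Suc (l + m - 1) = l + m" by simp
    show ?thesis
      by (simp add: d_br[OF xE yE n] cyc_d[OF x] cyc_d[OF y] br_zero_left[OF yE] br_zero_right[OF xE])
  qed
qed

lemma br_swap: "br l a m b x y = - ksign (a * b) (br m b l a y x)"
  by (simp add: br_def ksign_def mult.commute)

text \<open>
  For \<open>y = d w\<close> the bracket is the boundary of \<open>\<plusminus> [x, w]\<close>, except that \<open>[x, w]\<close> has no arity when both have arity
  \<open>0\<close>; then \<open>[x, d w]\<close> is zero.
\<close>

lemma br_bnd_right:
  assumes x: "x \<in> cyc l a" and y: "y \<in> bnd m b"
  shows "br l a m b x y \<in> bnd (l + m - 1) (a + b)"
  using y
proof (cases rule: bnd_cases)
  case 1
  then show ?thesis using cyc_E[OF x] by (simp add: br_def)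
next
  case (2 j w)
  note xE = cyc_E[OF x]
  show ?thesis
  proof (cases "l + j = 0")
    case True
    then have lj: "l = 0" "j = 0" by auto
    have x0: "x \<in> E 0 a" and w: "w \<in> E 0 (b + 1)" using xE 2 lj by simp_all
    have "prelie 1 (d 0 (b + 1) w) x = ksign (a * (b + 1)) (prelie 1 (d 0 a x) w)"
      unfolding prelie_d_arity_0[OF w x0] prelie_d_arity_0[OF x0 w]
      by (cases "even a"; cases "even b"; simp add: ksign_def)
    then have "prelie 1 (d 0 (b + 1) w) x = 0" using cyc_d[OF x] lj w by simp
    then show ?thesis using 2 lj by (simp add: br_def One_nat_def)
  next
    case False
    then have n: "Suc (l + j - 1) = l + j" by simp
    have "d (l + j - 1) (a + (b + 1)) (br l a j (b + 1) x w) \<in> bnd (l + m - 1) (a + b)"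
      using False by (intro bnd_d br_E[OF xE 2(2)]) (auto simp: 2)
    then have "ksign a (br l a m b x y) \<in> bnd (l + m - 1) (a + b)"
      using d_br[OF xE 2(2) n] prelie_zero_left[OF 2(2)] prelie_zero_right[OF 2(2)]
      by (simp add: cyc_d[OF x] 2 br_def)
    then have "ksign a (ksign a (br l a m b x y)) \<in> bnd (l + m - 1) (a + b)"
      by (rule bnd_ksign)
    then show ?thesis by (simp only: ksign_ksign) (simp add: ksign_def)
  qed
qed

lemma br_bnd_left:
  assumes x: "x \<in> bnd l a" and y: "y \<in> cyc m b"
  shows "br l a m b x y \<in> bnd (l + m - 1) (a + b)"
proof -
  have "br m b l a y x \<in> bnd (l + m - 1) (a + b)"
    using br_bnd_right[OF y x] by (simp add: add.commute)
  then show ?thesis unfolding br_swap[of l a] by (intro bnd_uminus bnd_ksign)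
qed

lemma br_prod:
  assumes x: "x \<in> cyc l a" and y: "y \<in> cyc m b" and z: "z \<in> cyc n c"
  shows "br l a (m + n) (b + c - 1) x (prod m b y z) -
      (prod (l + m - 1) (a + b) (br l a m b x y) z +
       ksign (a * (b - 1)) (prod m b y (br l a n c x z))) \<in> bnd (l + m + n - 1) (a + b + c - 1)"
proof -
  note xE = cyc_E[OF x] and yE = cyc_E[OF y] and zE = cyc_E[OF z]
  have c: "m + l - 1 = l + m - 1" "n + l - 1 = l + n - 1" "b + a = a + b" "c + a = a + c" by simp_all
  note E = prelie_E'[OF xE yE] prelie_E'[OF yE xE, unfolded c] prelie_E'[OF xE zE] prelie_E'[OF zE xE, unfolded c]
  have P1: "prelie l x (prod m b y z) = ksign b (prelie l x (cup m y z))"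
    unfolding prod_def by (rule prelie_ksign_right[OF xE cup_E[OF yE zE]])
  have P2: "prelie (m + n) (prod m b y z) x = ksign b (prelie (m + n) (cup m y z) x)"
    unfolding prod_def by (rule prelie_ksign_left[OF cup_E[OF yE zE] xE])
  have P3: "prod (l + m - 1) (a + b) (br l a m b x y) z = ksign (a + b)
      (cup (l + m - 1) (prelie l x y) z - ksign (a * b) (cup (l + m - 1) (prelie m y x) z))"
    unfolding prod_def br_def
    by (simp add: cup_diff_left[OF E(1) E_ksign[OF E(2)] zE] cup_ksign_left[OF E(2) zE])
  have P4: "prod m b y (br l a n c x z) = ksign b
      (cup m y (prelie l x z) - ksign (a * c) (cup m y (prelie n z x)))"
    unfolding prod_def br_def
    by (simp add: cup_diff_right[OF yE E(3) E_ksign[OF E(4)]] cup_ksign_right[OF yE E(4)])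
  have "ksign b (prelie l x (cup m y z) - ksign a (cup (l + m - 1) (prelie l x y) z)
      - ksign (a + a * b) (cup m y (prelie l x z))) \<in> bnd (l + m + n - 1) (a + b + c - 1)"
    using x y z by (intro bnd_ksign prelie_cup_homotopy) (auto simp: cyc_def)
  also have "ksign b (prelie l x (cup m y z) - ksign a (cup (l + m - 1) (prelie l x y) z)
      - ksign (a + a * b) (cup m y (prelie l x z))) =
      br l a (m + n) (b + c - 1) x (prod m b y z) -
      (prod (l + m - 1) (a + b) (br l a m b x y) z +
       ksign (a * (b - 1)) (prod m b y (br l a n c x z)))"
    unfolding br_def[of l a "m + n"] P1 P2 P3 P4 prelie_cup[OF xE yE zE] c
    by (cases "even a"; cases "even b"; cases "even c"; simp add: ksign_def)
  finally show ?thesis .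
qed

end

section \<open>Cyclic operads and Connes' operator\<close>

text \<open>
  \<open>\<sigma>\<close> stands for \<open>(-1)\<^sup>l \<tau>\<close> in arity \<open>l\<close>. With \<open>\<tau>\<close> itself the law for \<open>i \<ge> 2\<close> would have a sign; for \<open>\<sigma>\<close> the only
  sign beyond Koszul's is the minus in the last law.
\<close>

locale cyclic_suspended_operad = suspended_operad E pc idt \<mu> e
  for E :: "nat \<Rightarrow> int \<Rightarrow> 'b::ab_group_add set"
    and pc :: "nat \<Rightarrow> 'b \<Rightarrow> 'b \<Rightarrow> 'b"
    and idt \<mu> e :: 'b +
  fixes \<sigma> :: "'b \<Rightarrow> 'b"
  assumes \<sigma>_E: "x \<in> E l a \<Longrightarrow> \<sigma> x \<in> E l a"
    and \<sigma>_add: "\<lbrakk>x \<in> E l a; y \<in> E l a\<rbrakk> \<Longrightarrow> \<sigma> (x + y) = \<sigma> x + \<sigma> y"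
    and \<sigma>_cyclic: "x \<in> E l a \<Longrightarrow> (\<sigma> ^^ Suc l) x = x"
    and \<sigma>_mu: "\<sigma> \<mu> = \<mu>"
    and \<sigma>_pc: "\<lbrakk>x \<in> E l a; y \<in> E m b; 2 \<le> i; i \<le> l\<rbrakk> \<Longrightarrow> \<sigma> (pc i x y) = pc (i - 1) (\<sigma> x) y"
    and \<sigma>_pc_first: "\<lbrakk>x \<in> E l a; y \<in> E m b; 1 \<le> l; 1 \<le> m\<rbrakk> \<Longrightarrow>
      \<sigma> (pc 1 x y) = - ksign (a * b) (pc m (\<sigma> y) (\<sigma> x))"
begin

lemma \<sigma>_zero [simp]: "\<sigma> 0 = 0"
  using \<sigma>_add[of 0 0 0 0] by simp

lemma \<sigma>_uminus: "x \<in> E l a \<Longrightarrow> \<sigma> (- x) = - \<sigma> x"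
  using \<sigma>_add[of x l a "- x"] E_uminus[of x l a] by (simp add: eq_neg_iff_add_eq_0 add.commute)

lemma \<sigma>_ksign: "x \<in> E l a \<Longrightarrow> \<sigma> (ksign n x) = ksign n (\<sigma> x)"
  by (simp add: ksign_def \<sigma>_uminus)

lemma \<sigma>_sum: "(\<And>t. t \<in> A \<Longrightarrow> f t \<in> E l a) \<Longrightarrow> \<sigma> (\<Sum>t\<in>A. f t) = (\<Sum>t\<in>A. \<sigma> (f t))"
  by (induction A rule: infinite_finite_induct) (auto simp: \<sigma>_add[of _ l a] E_sum)

lemma \<sigma>_pow_E: "x \<in> E l a \<Longrightarrow> (\<sigma> ^^ k) x \<in> E l a"
  by (induction k) (auto intro: \<sigma>_E)

lemma \<sigma>_pow_ksign: "x \<in> E l a \<Longrightarrow> (\<sigma> ^^ k) (ksign n x) = ksign n ((\<sigma> ^^ k) x)"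
  by (induction k) (auto simp: \<sigma>_ksign[OF \<sigma>_pow_E])

lemma \<sigma>_pow_zero [simp]: "(\<sigma> ^^ k) 0 = 0"
  by (induction k) auto

lemma \<sigma>_pow_add: "\<lbrakk>x \<in> E l a; y \<in> E l a\<rbrakk> \<Longrightarrow> (\<sigma> ^^ k) (x + y) = (\<sigma> ^^ k) x + (\<sigma> ^^ k) y"
  by (induction k) (auto simp: \<sigma>_add[OF \<sigma>_pow_E \<sigma>_pow_E])

lemma \<sigma>_pow_pc: "\<lbrakk>x \<in> E l a; y \<in> E m b; k < i; i \<le> l\<rbrakk> \<Longrightarrow>
    (\<sigma> ^^ k) (pc i x y) = pc (i - k) ((\<sigma> ^^ k) x) y"
proof (induction k)
  case (Suc k)
  then have "(\<sigma> ^^ Suc k) (pc i x y) = \<sigma> (pc (i - k) ((\<sigma> ^^ k) x) y)" by simp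
  also have "\<dots> = pc (i - k - 1) (\<sigma> ((\<sigma> ^^ k) x)) y"
    using Suc.prems by (intro \<sigma>_pc[OF \<sigma>_pow_E[of x l a] Suc.prems(2)]) auto
  finally show ?case by (simp add: One_nat_def)
qed simp

lemma \<sigma>_mu_left: "x \<in> E l a \<Longrightarrow> \<sigma> (pc 2 \<mu> x) = pc 1 \<mu> x"
  using \<sigma>_pc[OF mu_E, of x l a 2] by (simp add: \<sigma>_mu One_nat_def)

lemma \<sigma>_mu_right: "\<lbrakk>x \<in> E l a; 1 \<le> l\<rbrakk> \<Longrightarrow> \<sigma> (pc 1 \<mu> x) = ksign (a + 1) (pc l (\<sigma> x) \<mu>)"
  using \<sigma>_pc_first[OF mu_E, of x l a] by (simp add: \<sigma>_mu) (simp add: ksign_def)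

text \<open>
  Arity \<open>0\<close> is not covered by \<open>\<sigma>_pc_first\<close>, but \<open>\<sigma>\<close> has order two on operations of arity \<open>1\<close>.
\<close>

lemma \<sigma>_mu_right_0: "x \<in> E 0 a \<Longrightarrow> \<sigma> (pc 1 \<mu> x) = pc 2 \<mu> x"
  using \<sigma>_cyclic[OF pc_mu_E[of x 0 a 2]] \<sigma>_mu_left[of x 0 a] by simp

lemma \<sigma>_pc_mu_first:
  assumes x: "x \<in> E l a" and l: "1 \<le> l"
  shows "\<sigma> (pc 1 x \<mu>) = ksign (a + 1) (pc 2 \<mu> (\<sigma> x))"
  using \<sigma>_pc_first[OF x mu_E] l by (simp add: \<sigma>_mu) (simp add: ksign_def)

text \<open>
  Rotation moves a face to the left by one input, the face \<open>x \<circ>\<^sub>1 \<mu>\<close> to \<open>\<mu> \<circ>\<^sub>2 (\<sigma> x)\<close>, and \<open>\<mu> \<circ>\<^sub>2 x\<close> to \<open>\<mu> \<circ>\<^sub>1 x\<close>.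
  In the last case the output of \<open>x\<close> keeps touching \<open>\<mu>\<close>, so \<open>x\<close> itself is not rotated.
\<close>

lemma \<sigma>_L:
  assumes u: "u \<in> E l a" and c: "2 \<le> c" "c \<le> Suc l"
  shows "\<sigma> (L a c u) = pc 1 \<mu> u + L a (c - 1) (\<sigma> u)"
proof -
  have um: "pc i u \<mu> \<in> E (Suc l) (a - 1)" if "1 \<le> i" "i \<le> l" for i using mu_pc_E[OF u that] .
  have S: "(\<Sum>i=1..<c. pc i u \<mu>) \<in> E (Suc l) (a - 1)" using c by (intro E_sum um) auto
  have "\<sigma> (\<Sum>i=1..<c. pc i u \<mu>) = (\<Sum>i=1..<c. \<sigma> (pc i u \<mu>))"
    using c by (intro \<sigma>_sum[OF um]) auto
  also have "\<dots> = \<sigma> (pc 1 u \<mu>) + (\<Sum>i=Suc 1..<Suc (c - 1). \<sigma> (pc i u \<mu>))"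
    using c by (simp add: sum.atLeast_Suc_lessThan)
  also have "\<sigma> (pc 1 u \<mu>) = ksign (a + 1) (pc 2 \<mu> (\<sigma> u))"
    using c by (intro \<sigma>_pc_mu_first[OF u]) auto
  also have "(\<Sum>i=Suc 1..<Suc (c - 1). \<sigma> (pc i u \<mu>)) = (\<Sum>i=1..<c - 1. pc i (\<sigma> u) \<mu>)"
    unfolding sum.shift_bounds_Suc_ivl
  proof (intro sum.cong refl)
    fix i assume "i \<in> {1..<c - 1}"
    then have i: "2 \<le> Suc i" "Suc i \<le> l" using c by auto
    then show "\<sigma> (pc (Suc i) u \<mu>) = pc i (\<sigma> u) \<mu>"
      using \<sigma>_pc[OF u mu_E i] by simp
  qed
  finally have "\<sigma> (ksign (a + 1) (\<Sum>i=1..<c. pc i u \<mu>)) =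
      pc 2 \<mu> (\<sigma> u) + ksign (a + 1) (\<Sum>i=1..<c - 1. pc i (\<sigma> u) \<mu>)"
    by (simp add: \<sigma>_ksign[OF S] ksign_add ksign_ksign) (simp add: ksign_def)
  then show ?thesis
    using \<sigma>_add[OF pc_mu_E[OF u, of 2] E_ksign[OF S]] by (simp add: L_def \<sigma>_mu_left[OF u])
qed

lemma \<sigma>_R:
  assumes u: "u \<in> E l a" and c: "2 \<le> c" "c \<le> Suc l"
  shows "pc 1 \<mu> (\<sigma> u) + \<sigma> (R l a c u) = R l a (c - 1) (\<sigma> u)"
proof -
  have um: "pc i u \<mu> \<in> E (Suc l) (a - 1)" if "1 \<le> i" "i \<le> l" for i using mu_pc_E[OF u that] .
  have S: "(\<Sum>i=c..<Suc l. pc i u \<mu>) \<in> E (Suc l) (a - 1)" using c by (intro E_sum um) auto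
  have "\<sigma> (\<Sum>i=c..<Suc l. pc i u \<mu>) = (\<Sum>i=Suc (c - 1)..<Suc l. \<sigma> (pc i u \<mu>))"
    using c \<sigma>_sum[OF um, of "{c..<Suc l}" "\<lambda>i. i"] by auto
  also have "\<dots> = (\<Sum>i=c - 1..<l. pc i (\<sigma> u) \<mu>)"
    unfolding sum.shift_bounds_Suc_ivl
  proof (intro sum.cong refl)
    fix i assume "i \<in> {c - 1..<l}"
    then have i: "2 \<le> Suc i" "Suc i \<le> l" using c by auto
    then show "\<sigma> (pc (Suc i) u \<mu>) = pc i (\<sigma> u) \<mu>"
      using \<sigma>_pc[OF u mu_E i] by simp
  qed
  finally have "\<sigma> (R l a c u) = ksign (a + 1) (pc l (\<sigma> u) \<mu>) + ksign (a + 1) (\<Sum>i=c - 1..<l. pc i (\<sigma> u) \<mu>)"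
    using \<sigma>_add[OF pc_mu_E[OF u, of 1] E_ksign[OF S]] c
    by (simp add: R_def \<sigma>_mu_right[OF u] \<sigma>_ksign[OF S])
  moreover have "(\<Sum>i=c - 1..<Suc l. pc i (\<sigma> u) \<mu>) = (\<Sum>i=c - 1..<l. pc i (\<sigma> u) \<mu>) + pc l (\<sigma> u) \<mu>"
  proof -
    have "c - 1 \<le> l" using c by simp
    then show ?thesis by (simp add: sum.op_ivl_Suc)
  qed
  ultimately show ?thesis by (simp add: R_def ksign_add add_ac)
qed

text \<open>
  A rotation of \<open>d x\<close> consists of faces of rotations of \<open>x\<close>. The faces behind the old output come from one
  rotation of \<open>x\<close>, those before it from the next, which is why \<open>R\<close> and \<open>L\<close> get different arguments.
\<close>

lemma \<sigma>_d_pow: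
  assumes x: "x \<in> E l a" and k: "k \<le> l"
  shows "(\<sigma> ^^ Suc k) (d l a x) = R l a (Suc l - k) ((\<sigma> ^^ k) x) + L a (Suc l - k) ((\<sigma> ^^ Suc k) x)"
  using k
proof (induction k)
  case 0
  show ?case
  proof (cases "l = 0")
    case True
    have "\<sigma> x = x" using \<sigma>_cyclic[OF x] True by simp
    moreover have "d l a x = pc 1 \<mu> x + pc 2 \<mu> x" "R l a (Suc l) x = pc 1 \<mu> x" "L a (Suc l) x = pc 2 \<mu> x"
      using True by (simp_all add: d_def R_def L_def One_nat_def)
    moreover have "\<sigma> (pc 1 \<mu> x + pc 2 \<mu> x) = pc 2 \<mu> x + pc 1 \<mu> x"
      using \<sigma>_add[OF pc_mu_E[OF x, of 1] pc_mu_E[OF x, of 2]] x True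
      by (simp add: \<sigma>_mu_left[OF x] \<sigma>_mu_right_0)
    ultimately show ?thesis by (simp add: add.commute)
  next
    case False
    have Lx: "L a (Suc l) x \<in> E (Suc l) (a - 1)" and Rx: "R l a (Suc l) x \<in> E (Suc l) (a - 1)"
      by (rule L_E[OF x], simp, rule R_E[OF x], simp)
    have "\<sigma> (d l a x) = \<sigma> (L a (Suc l) x) + \<sigma> (R l a (Suc l) x)"
      by (simp add: d_split[of "Suc l"] \<sigma>_add[OF Lx Rx])
    also have "\<sigma> (L a (Suc l) x) = pc 1 \<mu> x + L a l (\<sigma> x)"
      using False \<sigma>_L[OF x, of "Suc l"] by simp
    also have "\<sigma> (R l a (Suc l) x) = ksign (a + 1) (pc l (\<sigma> x) \<mu>)"
      using False by (simp add: R_def \<sigma>_mu_right[OF x])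
    also have "pc 1 \<mu> x + L a l (\<sigma> x) + ksign (a + 1) (pc l (\<sigma> x) \<mu>) = R l a (Suc l) x + L a (Suc l) (\<sigma> x)"
      using False by (simp add: R_def L_def sum.op_ivl_Suc ksign_add add_ac)
    finally show ?thesis by simp
  qed
next
  case (Suc k)
  define c where "c = Suc l - k"
  have c: "2 \<le> c" "c \<le> Suc l" "Suc l - Suc k = c - 1" using Suc.prems by (auto simp: c_def)
  define u where "u = (\<sigma> ^^ k) x"
  have u: "u \<in> E l a" unfolding u_def by (rule \<sigma>_pow_E[OF x])
  have "(\<sigma> ^^ Suc (Suc k)) (d l a x) = \<sigma> (R l a c u + L a c (\<sigma> u))"
    using Suc by (simp add: u_def c_def)
  also have "\<dots> = \<sigma> (R l a c u) + \<sigma> (L a c (\<sigma> u))"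
    using c by (intro \<sigma>_add[OF R_E[OF u] L_E[OF \<sigma>_E[OF u]]]) auto
  also have "\<sigma> (L a c (\<sigma> u)) = pc 1 \<mu> (\<sigma> u) + L a (c - 1) (\<sigma> (\<sigma> u))"
    by (rule \<sigma>_L[OF \<sigma>_E[OF u] c(1,2)])
  finally show ?case
    unfolding c(3) using \<sigma>_R[OF u c(1,2)] by (simp add: u_def add_ac)
qed

text \<open>
  The rotation of \<open>x\<close> that has the old output as its \<open>c\<close>-th input; \<open>c = 0\<close> and \<open>c = Suc l\<close> both stand for \<open>x\<close>.
\<close>

definition rot :: "nat \<Rightarrow> nat \<Rightarrow> 'b \<Rightarrow> 'b" where
  "rot l c x = (\<sigma> ^^ (Suc l - c)) x"

lemma rot_E: "x \<in> E l a \<Longrightarrow> rot l c x \<in> E l a"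
  unfolding rot_def by (rule \<sigma>_pow_E)

lemma rot_0: "x \<in> E l a \<Longrightarrow> rot l 0 x = x"
  unfolding rot_def using \<sigma>_cyclic by simp

lemma rot_Suc: "rot l (Suc l) x = x"
  by (simp add: rot_def)

lemma rot_d:
  assumes x: "x \<in> E l a" and c: "1 \<le> c" "c \<le> Suc l"
  shows "rot (Suc l) c (d l a x) = R l a c (rot l c x) + L a c (rot l (c - 1) x)"
proof -
  have "Suc l - (Suc l - c) = c" "Suc (Suc l - c) = Suc (Suc l) - c" "Suc (Suc l - c) = Suc l - (c - 1)"
    using c by auto
  then show ?thesis
    using \<sigma>_d_pow[OF x, of "Suc l - c"] c unfolding rot_def by simp
qed

text \<open>
  Connes' operator up to sign. It is \<open>rot_prelie l x e\<close> for the sum \<open>rot_prelie\<close> defined next, in which \<open>y\<close> is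
  plugged into the old output.
\<close>

definition connes_sum :: "nat \<Rightarrow> 'b \<Rightarrow> 'b" where
  "connes_sum l x = (\<Sum>c=1..<Suc l. pc c (rot l c x) e)"

definition rot_prelie :: "nat \<Rightarrow> 'b \<Rightarrow> 'b \<Rightarrow> 'b" where
  "rot_prelie l x y = (\<Sum>c=1..<Suc l. pc c (rot l c x) y)"

lemma connes_sum_E: "x \<in> E l a \<Longrightarrow> connes_sum l x \<in> E (l - 1) (a + 1)"
  unfolding connes_sum_def by (intro E_sum pcI[OF rot_E e_E]) auto

lemma connes_sum_add: "\<lbrakk>x \<in> E l a; y \<in> E l a\<rbrakk> \<Longrightarrow> connes_sum l (x + y) = connes_sum l x + connes_sum l y"
  unfolding connes_sum_def sum.distrib[symmetric]
  by (intro sum.cong refl) (auto simp: rot_def \<sigma>_pow_add pc_add_left[OF \<sigma>_pow_E \<sigma>_pow_E e_E])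

lemma connes_sum_zero [simp]: "connes_sum l 0 = 0"
  using connes_sum_add[of 0 l 0 0] by simp

lemma connes_sum_0 [simp]: "connes_sum 0 x = 0"
  by (simp add: connes_sum_def One_nat_def)

lemma mu1_e: "x \<in> E l a \<Longrightarrow> pc (Suc l) (pc 1 \<mu> x) e = ksign a x"
  using cup_e_right[of x l a] by (simp add: cup_def)

text \<open>
  By \<open>rot_d\<close> and \<open>d_pc\<close> both sides consist of the same terms, except that the sum for \<open>d x\<close> has one more
  term at each end. These two are \<open>\<plusminus> x\<close> with opposite signs.
\<close>

lemma connes_sum_d:
  assumes x: "x \<in> E l a"
  shows "1 \<le> l \<Longrightarrow> connes_sum (Suc l) (d l a x) = d (l - 1) (a + 1) (connes_sum l x)"
    and "l = 0 \<Longrightarrow> connes_sum (Suc l) (d l a x) = 0"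
proof -
  define A where "A c = pc c (R l a c (rot l c x)) e" for c
  define F where "F c = pc (Suc c) (L a (Suc c) (rot l c x)) e" for c
  have xc: "rot l c x \<in> E l a" for c by (rule rot_E[OF x])
  have "connes_sum (Suc l) (d l a x) = (\<Sum>c=1..<Suc (Suc l). A c + F (c - 1))"
    unfolding connes_sum_def
  proof (intro sum.cong refl)
    fix c assume c: "c \<in> {1..<Suc (Suc l)}"
    then have 1: "rot (Suc l) c (d l a x) = R l a c (rot l c x) + L a c (rot l (c - 1) x)"
      by (intro rot_d[OF x]) auto
    have "pc c (rot (Suc l) c (d l a x)) e = pc c (R l a c (rot l c x)) e + pc c (L a c (rot l (c - 1) x)) e"
      unfolding 1 using c by (intro pc_add_left[OF R_E[OF xc] L_E[OF xc] e_E]) auto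
    then show "pc c (rot (Suc l) c (d l a x)) e = A c + F (c - 1)"
      using c by (simp add: A_def F_def)
  qed
  also have "\<dots> = (\<Sum>c=1..<Suc l. A c) + A (Suc l) + (\<Sum>c=0..<Suc l. F c)"
  proof -
    have "(\<Sum>c=1..<Suc (Suc l). F (c - 1)) = (\<Sum>c=0..<Suc l. F c)"
      using sum.shift_bounds_Suc_ivl[of "\<lambda>c. F (c - 1)" 0 "Suc l"] by (simp add: One_nat_def)
    then show ?thesis by (simp add: sum.distrib sum.op_ivl_Suc[of _ 1 "Suc l"])
  qed
  also have "(\<Sum>c=0..<Suc l. F c) = F 0 + (\<Sum>c=1..<Suc l. F c)"
    by (simp add: sum.atLeast_Suc_lessThan One_nat_def)
  also have "A (Suc l) = ksign a x"
    by (simp add: A_def R_def rot_Suc mu1_e[OF x])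
  also have "F 0 = ksign (a + 1) x"
    by (simp add: F_def L_def rot_0[OF x] mu2_e[OF x] flip: One_nat_def)
  finally have 2: "connes_sum (Suc l) (d l a x) = (\<Sum>c=1..<Suc l. A c + F c)"
    by (simp add: sum.distrib ksign_def)
  then show "connes_sum (Suc l) (d l a x) = 0" if "l = 0" using that by (simp add: One_nat_def)
  assume l: "1 \<le> l"
  have "d (l - 1) (a + 1) (connes_sum l x) = (\<Sum>c=1..<Suc l. d (l - 1) (a + 1) (pc c (rot l c x) e))"
    unfolding connes_sum_def by (intro d_sum pcI[OF xc e_E]) auto
  also have "\<dots> = (\<Sum>c=1..<Suc l. A c + F c)"
    unfolding A_def F_def using l by (intro sum.cong refl d_pc_cycle[OF xc e_E _ _ _ d_e]) auto
  finally show "connes_sum (Suc l) (d l a x) = d (l - 1) (a + 1) (connes_sum l x)" using 2 by simp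
qed

text \<open>
  While the new output is an input of \<open>x\<close>, the tree \<open>\<mu>(x, y)\<close> looks like a rotation of \<open>x\<close> with \<open>\<mu> \<circ>\<^sub>1 y\<close>
  plugged into its old output. Afterwards, as the next lemma states, the roles of \<open>x\<close> and \<open>y\<close> are exchanged.
\<close>

lemma \<sigma>_pow_cup:
  assumes x: "x \<in> E l a" and y: "y \<in> E m b" and k: "1 \<le> k" "k \<le> l"
  shows "(\<sigma> ^^ k) (cup l x y) = ksign (a + 1) (pc (Suc l - k) ((\<sigma> ^^ k) x) (pc 1 \<mu> y))"
proof -
  obtain k' where k': "k = Suc k'" "k' < l" using k by (cases k) auto
  have my: "pc 1 \<mu> y \<in> E (Suc m) (b - 1)" using pc_mu_E[OF y] by auto
  have E1: "pc l (\<sigma> x) (pc 1 \<mu> y) \<in> E (l + m) (a + b - 1)"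
    using k by (intro pcI[OF \<sigma>_E[OF x] my]) auto
  have "\<sigma> (cup l x y) = pc l (\<sigma> (pc 1 \<mu> x)) y"
    unfolding cup_def using k \<sigma>_pc[OF pc_mu_E[OF x] y, of 1 "Suc l"] by simp
  also have "\<dots> = ksign (a + 1) (pc l (pc l (\<sigma> x) \<mu>) y)"
    using k \<sigma>_mu_right[OF x] pc_ksign_left[OF mu_pc_E[OF \<sigma>_E[OF x], of l] y, of l] by simp
  also have "pc l (pc l (\<sigma> x) \<mu>) y = pc l (\<sigma> x) (pc 1 \<mu> y)"
    using k by (intro seq[OF \<sigma>_E[OF x] mu_E y]) auto
  finally have "(\<sigma> ^^ k) (cup l x y) = (\<sigma> ^^ k') (ksign (a + 1) (pc l (\<sigma> x) (pc 1 \<mu> y)))"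
    unfolding k' by (simp add: funpow_swap1)
  also have "\<dots> = ksign (a + 1) ((\<sigma> ^^ k') (pc l (\<sigma> x) (pc 1 \<mu> y)))"
    by (rule \<sigma>_pow_ksign[OF E1])
  also have "(\<sigma> ^^ k') (pc l (\<sigma> x) (pc 1 \<mu> y)) = pc (l - k') ((\<sigma> ^^ k') (\<sigma> x)) (pc 1 \<mu> y)"
    using k' by (intro \<sigma>_pow_pc[OF \<sigma>_E[OF x] my]) auto
  finally show ?thesis unfolding k' by (simp add: funpow_swap1)
qed

lemma \<sigma>_pow_cup_wrap:
  assumes x: "x \<in> E l a" and y: "y \<in> E m b" and k: "1 \<le> k" "k \<le> m"
  shows "(\<sigma> ^^ (k + l)) (cup l x y) = ksign (a * b + b + 1) (pc (Suc m - k) ((\<sigma> ^^ k) y) (pc 2 \<mu> x))"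
proof -
  obtain k' where k': "k = Suc k'" "k' < m" using k by (cases k) auto
  have m: "1 \<le> m" using k by auto
  have mx1: "pc 1 \<mu> x \<in> E (Suc l) (a - 1)" and mx2: "pc 2 \<mu> x \<in> E (Suc l) (a - 1)"
    and my: "pc 1 \<mu> y \<in> E (Suc m) (b - 1)"
    using pc_mu_E[OF x] pc_mu_E[OF y] by auto
  have 1: "\<sigma> ((\<sigma> ^^ l) (cup l x y)) = ksign (a * b + b + 1) (pc m (\<sigma> y) (pc 2 \<mu> x))"
  proof (cases "l = 0")
    case True
    have "\<sigma> (cup l x y) = - ksign ((a - 1) * b) (pc m (\<sigma> y) (\<sigma> (pc 1 \<mu> x)))"
      unfolding cup_def using \<sigma>_pc_first[OF mx1 y] True m by (simp flip: One_nat_def)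
    then show ?thesis
      using x True by (cases "even a"; cases "even b"; simp add: \<sigma>_mu_right_0 ksign_def)
  next
    case False
    have E2: "pc 1 ((\<sigma> ^^ l) x) (pc 1 \<mu> y) \<in> E (l + m) (a + b - 1)"
      using False by (intro pcI[OF \<sigma>_pow_E[OF x] my]) auto
    have xl: "\<sigma> ((\<sigma> ^^ l) x) = x" using \<sigma>_cyclic[OF x] by simp
    have "(\<sigma> ^^ l) (cup l x y) = ksign (a + 1) (pc 1 ((\<sigma> ^^ l) x) (pc 1 \<mu> y))"
      using False \<sigma>_pow_cup[OF x y, of l] by (simp add: One_nat_def)
    then have "\<sigma> ((\<sigma> ^^ l) (cup l x y)) = ksign (a + 1) (\<sigma> (pc 1 ((\<sigma> ^^ l) x) (pc 1 \<mu> y)))"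
      by (simp only: \<sigma>_ksign[OF E2])
    also have "\<sigma> (pc 1 ((\<sigma> ^^ l) x) (pc 1 \<mu> y)) = - ksign (a * (b - 1)) (pc (Suc m) (\<sigma> (pc 1 \<mu> y)) x)"
      using False \<sigma>_pc_first[OF \<sigma>_pow_E[OF x, of l] my] by (simp add: xl)
    also have "\<sigma> (pc 1 \<mu> y) = ksign (b + 1) (pc m (\<sigma> y) \<mu>)"
      by (rule \<sigma>_mu_right[OF y m])
    also have "pc (Suc m) (ksign (b + 1) (pc m (\<sigma> y) \<mu>)) x = ksign (b + 1) (pc (Suc m) (pc m (\<sigma> y) \<mu>) x)"
      using m by (intro pc_ksign_left[OF mu_pc_E[OF \<sigma>_E[OF y]] x]) auto
    also have "pc (Suc m) (pc m (\<sigma> y) \<mu>) x = pc m (\<sigma> y) (pc 2 \<mu> x)"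
      using m by (intro seq[OF \<sigma>_E[OF y] mu_E x]) auto
    finally show ?thesis by (cases "even a"; cases "even b"; simp add: ksign_def)
  qed
  have E1: "pc m (\<sigma> y) (pc 2 \<mu> x) \<in> E (l + m) (a + b - 1)"
    using m by (intro pcI[OF \<sigma>_E[OF y] mx2]) auto
  have "(\<sigma> ^^ (k + l)) (cup l x y) = (\<sigma> ^^ k') (\<sigma> ((\<sigma> ^^ l) (cup l x y)))"
    unfolding k' by (simp add: funpow_add funpow_swap1)
  also have "\<dots> = ksign (a * b + b + 1) ((\<sigma> ^^ k') (pc m (\<sigma> y) (pc 2 \<mu> x)))"
    unfolding 1 by (rule \<sigma>_pow_ksign[OF E1])
  also have "(\<sigma> ^^ k') (pc m (\<sigma> y) (pc 2 \<mu> x)) = pc (m - k') ((\<sigma> ^^ k') (\<sigma> y)) (pc 2 \<mu> x)"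
    using k' by (intro \<sigma>_pow_pc[OF \<sigma>_E[OF y] mx2]) auto
  finally show ?thesis unfolding k' by (simp add: funpow_swap1)
qed

lemma sum_rot: "(\<Sum>k=1..<Suc n. h (Suc n - k) ((\<sigma> ^^ k) x)) = (\<Sum>c=1..<Suc n. h c (rot n c x))"
  for h :: "nat \<Rightarrow> 'b \<Rightarrow> 'c::comm_monoid_add"
  by (rule sum.reindex_bij_witness[of _ "\<lambda>i. Suc n - i" "\<lambda>i. Suc n - i"]) (auto simp: rot_def)

text \<open>
  The old output of \<open>\<mu>(x, y)\<close> is a leg of \<open>\<mu>\<close>. Plugging \<open>e\<close> into it cancels \<open>\<mu>\<close>, and \<open>x\<close> and \<open>y\<close> become joined at
  their outputs.
\<close>

lemma connes_sum_cup:
  assumes x: "x \<in> E l a" and y: "y \<in> E m b"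
  shows "connes_sum (l + m) (cup l x y) = ksign (a + b + 1) (rot_prelie l x y) + ksign (a * b + a + b) (rot_prelie m y x)"
proof -
  define f where "f k = pc (Suc (l + m) - k) ((\<sigma> ^^ k) (cup l x y)) e" for k
  have mx2: "pc 2 \<mu> x \<in> E (Suc l) (a - 1)" and my: "pc 1 \<mu> y \<in> E (Suc m) (b - 1)"
    using pc_mu_E[OF x] pc_mu_E[OF y] by auto
  have "connes_sum (l + m) (cup l x y) = (\<Sum>k=1..<Suc (l + m). f k)"
    unfolding connes_sum_def f_def by (rule sum_rot[symmetric])
  also have "\<dots> = (\<Sum>k=1..<Suc l. f k) + (\<Sum>k=Suc l..<Suc (l + m). f k)"
    by (rule sum.atLeastLessThan_concat[symmetric]) auto
  also have "(\<Sum>k=Suc l..<Suc (l + m). f k) = (\<Sum>k=1..<Suc m. f (k + l - 0))"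
    by (rule sum_shift_ivl) auto
  also have "(\<Sum>k=1..<Suc l. f k) = (\<Sum>k=1..<Suc l. ksign (a + b + 1) (pc (Suc l - k) ((\<sigma> ^^ k) x) y))"
  proof (intro sum.cong refl)
    fix k assume k: "k \<in> {1..<Suc l}"
    have E2: "pc (Suc l - k) ((\<sigma> ^^ k) x) (pc 1 \<mu> y) \<in> E (l + m) (a + b - 1)"
      using k by (intro pcI[OF \<sigma>_pow_E[OF x] my]) auto
    have "f k = ksign (a + 1) (pc (Suc (l + m) - k) (pc (Suc l - k) ((\<sigma> ^^ k) x) (pc 1 \<mu> y)) e)"
      unfolding f_def using k by (subst \<sigma>_pow_cup[OF x y]) (auto intro: pc_ksign_left[OF E2 e_E])
    also have "pc (Suc (l + m) - k) (pc (Suc l - k) ((\<sigma> ^^ k) x) (pc 1 \<mu> y)) e =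
        pc (Suc l - k) ((\<sigma> ^^ k) x) (pc (Suc m) (pc 1 \<mu> y) e)"
      using k by (intro seq[OF \<sigma>_pow_E[OF x] my e_E]) auto
    also have "pc (Suc m) (pc 1 \<mu> y) e = ksign b y" by (rule mu1_e[OF y])
    also have "pc (Suc l - k) ((\<sigma> ^^ k) x) (ksign b y) = ksign b (pc (Suc l - k) ((\<sigma> ^^ k) x) y)"
      using k by (intro pc_ksign_right[OF \<sigma>_pow_E[OF x] y]) auto
    finally show "f k = ksign (a + b + 1) (pc (Suc l - k) ((\<sigma> ^^ k) x) y)"
      by (simp add: ksign_ksign add_ac)
  qed
  also have "\<dots> = ksign (a + b + 1) (rot_prelie l x y)"
    unfolding ksign_sum[symmetric] rot_prelie_def by (intro arg_cong[of _ _ "ksign _"] sum_rot)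
  also have "(\<Sum>k=1..<Suc m. f (k + l - 0)) =
      (\<Sum>k=1..<Suc m. ksign (a * b + a + b) (pc (Suc m - k) ((\<sigma> ^^ k) y) x))"
  proof (intro sum.cong refl)
    fix k assume k: "k \<in> {1..<Suc m}"
    have E2: "pc (Suc m - k) ((\<sigma> ^^ k) y) (pc 2 \<mu> x) \<in> E (l + m) (a + b - 1)"
      using k by (intro pcI[OF \<sigma>_pow_E[OF y] mx2]) auto
    have "f (k + l - 0) = ksign (a * b + b + 1) (pc (Suc m - k) (pc (Suc m - k) ((\<sigma> ^^ k) y) (pc 2 \<mu> x)) e)"
      unfolding f_def using k \<sigma>_pow_cup_wrap[OF x y, of k] by (auto intro: pc_ksign_left[OF E2 e_E])
    also have "pc (Suc m - k) (pc (Suc m - k) ((\<sigma> ^^ k) y) (pc 2 \<mu> x)) e =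
        pc (Suc m - k) ((\<sigma> ^^ k) y) (pc 1 (pc 2 \<mu> x) e)"
      using k by (intro seq[OF \<sigma>_pow_E[OF y] mx2 e_E]) auto
    also have "pc 1 (pc 2 \<mu> x) e = ksign (a + 1) x" by (rule mu2_e[OF x])
    also have "pc (Suc m - k) ((\<sigma> ^^ k) y) (ksign (a + 1) x) = ksign (a + 1) (pc (Suc m - k) ((\<sigma> ^^ k) y) x)"
      using k by (intro pc_ksign_right[OF \<sigma>_pow_E[OF y] x]) auto
    finally show "f (k + l - 0) = ksign (a * b + a + b) (pc (Suc m - k) ((\<sigma> ^^ k) y) x)"
      by (cases "even a"; cases "even b"; simp add: ksign_def)
  qed
  also have "\<dots> = ksign (a * b + a + b) (rot_prelie m y x)"
    unfolding ksign_sum[symmetric] rot_prelie_def by (intro arg_cong[of _ _ "ksign _"] sum_rot)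
  finally show ?thesis .
qed

text \<open>
  Half of the BV identity. The homotopy is the sum over \<open>c < j\<close> of the rotations of \<open>x\<close> with \<open>e\<close> in the old
  output \<open>c\<close> and \<open>y\<close> in input \<open>j\<close>. Its boundary is compared with the rotations of \<open>d x = 0\<close> with \<open>e\<close> and \<open>y\<close>
  plugged in. The terms that remain are those in which \<open>y\<close> and the new output meet, giving \<open>(B x) y\<close>, those in
  which \<open>e\<close> and \<open>y\<close> meet, giving \<open>rot_prelie\<close>, and those in which \<open>e\<close> and the new output meet, giving
  \<open>x \<circ> y\<close>.
\<close>

lemma rot_prelie_homotopy:
  assumes x: "x \<in> E l a" and y: "y \<in> E m b" and dx: "d l a x = 0" and dy: "d m b y = 0"
  shows "rot_prelie l x y - prelie l x y - ksign (a + 1) (cup (l - 1) (connes_sum l x) y) \<in> bnd (l + m - 1) (a + b)"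
proof -
  define u where "u c = rot l c x" for c
  have u: "u c \<in> E l a" for c unfolding u_def by (rule rot_E[OF x])
  define A where "A j c = pc (j - 1) (pc c (R l a j (u c)) e) y" for j c
  define M where "M j c = pc j (pc c (R l a c (u c) - R l a (Suc j) (u c)) e) y" for j c
  define F where "F j c = pc j (pc (Suc c) (L a (Suc c) (u c)) e) y" for j c
  define N where "N = l + m - 2"
  define T where "T j c = d N (a + b + 1) (pc (j - 1) (pc c (u c) e) y)" for j c
  have Rx: "R l a k (u c) \<in> E (Suc l) (a - 1)" if "1 \<le> k" for k c using R_E[OF u that] .
  have Lx: "L a k (u c) \<in> E (Suc l) (a - 1)" if "k \<le> Suc l" for k c using L_E[OF u that] .
  have T: "T j c = A j c + F j c + M j c" if "c \<in> {1..<j}" "j \<in> {1..<Suc l}" for c j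
  proof -
    have cj: "1 \<le> c" "c < j" "j \<le> l" using that by auto
    define v where "v = pc c (u c) e"
    have l: "Suc (l - 1) = l" using cj by simp
    have v: "v \<in> E (l - 1) (a + 1)" unfolding v_def using cj by (intro pcI[OF u e_E]) auto
    have j: "Suc (j - 1) = j" using cj by simp
    have "d N (a + 1 + b) (pc (j - 1) v y) = pc (j - 1) (R (l - 1) (a + 1) (j - 1) v) y + pc (Suc (j - 1)) (L (a + 1) (Suc (j - 1)) v) y"
      using cj by (intro d_pc_cycle[OF v y _ _ _ dy]) (auto simp: N_def)
    also have "R (l - 1) (a + 1) (j - 1) v = pc c (R l a j (u c)) e"
      unfolding v_def using cj by (intro R_pc[OF u e_E]) auto
    also have "Suc (j - 1) = j" by (rule j)
    also have "L (a + 1) j v = d (l - 1) (a + 1) v - R (l - 1) (a + 1) j v"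
      using d_split[of j "l - 1" "a + 1" v] cj by simp
    also have "R (l - 1) (a + 1) j v = pc c (R l a (Suc j) (u c)) e"
      unfolding v_def using cj by (intro R_pc[OF u e_E]) auto
    also have "d (l - 1) (a + 1) v = pc c (R l a c (u c)) e + pc (Suc c) (L a (Suc c) (u c)) e"
      unfolding v_def using cj by (intro d_pc_cycle[OF u e_E _ _ _ d_e]) auto
    also have "pc j (pc c (R l a c (u c)) e + pc (Suc c) (L a (Suc c) (u c)) e - pc c (R l a (Suc j) (u c)) e) y
        = F j c + M j c"
    proof -
      have E: "pc c (R l a k (u c)) e \<in> E l a" if "1 \<le> k" for k
        using cj by (intro pcI[OF Rx[OF that] e_E]) auto
      have E': "pc (Suc c) (L a (Suc c) (u c)) e \<in> E l a"
        using cj by (intro pcI[OF Lx e_E]) auto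
      have "pc c (R l a c (u c)) e + pc (Suc c) (L a (Suc c) (u c)) e - pc c (R l a (Suc j) (u c)) e
          = pc (Suc c) (L a (Suc c) (u c)) e + pc c (R l a c (u c) - R l a (Suc j) (u c)) e"
        using cj by (simp add: pc_diff_left[OF Rx Rx e_E])
      moreover have "pc c (R l a c (u c) - R l a (Suc j) (u c)) e \<in> E l a"
        using cj by (intro pcI[OF E_diff[OF Rx Rx] e_E]) auto
      ultimately show ?thesis
        using cj by (simp only: F_def M_def) (intro pc_add_left[OF E' _ y], auto)
    qed
    finally show ?thesis by (simp add: T_def v_def A_def add_ac)
  qed
  \<comment> \<open>the terms of the rotations of \<open>d x\<close>; the last one belongs to the rotation \<open>c - 1\<close> of \<open>x\<close> by \<open>rot_d\<close>\<close>
  have zero: "(\<Sum>j=1..<Suc l. \<Sum>c=1..<Suc j. A (Suc j) c + M j c + F j (c - 1)) = 0"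
  proof (intro sum.neutral ballI)
    fix j c assume "j \<in> {1..<Suc l}" "c \<in> {1..<Suc j}"
    then have jc: "1 \<le> c" "c \<le> j" "j \<le> l" by auto
    have "pc j (pc c (rot (Suc l) c (d l a x)) e) y = A (Suc j) c + M j c + F j (c - 1)"
    proof -
      have "rot (Suc l) c (d l a x) = R l a (Suc j) (u c) + (R l a c (u c) - R l a (Suc j) (u c)) + L a c (u (c - 1))"
        unfolding u_def using jc by (subst rot_d[OF x]) auto
      moreover have E: "pc c (R l a (Suc j) (u c)) e \<in> E l a" "pc c (R l a c (u c) - R l a (Suc j) (u c)) e \<in> E l a"
          "pc c (L a c (u (c - 1))) e \<in> E l a"
        using jc by (auto intro!: pcI[OF Rx e_E] pcI[OF E_diff[OF Rx Rx] e_E] pcI[OF Lx e_E])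
      moreover have "pc c (R l a (Suc j) (u c) + (R l a c (u c) - R l a (Suc j) (u c)) + L a c (u (c - 1))) e =
          pc c (R l a (Suc j) (u c)) e + pc c (R l a c (u c) - R l a (Suc j) (u c)) e + pc c (L a c (u (c - 1))) e"
      proof -
        have r: "R l a (Suc j) (u c) \<in> E (Suc l) (a - 1)" "R l a c (u c) - R l a (Suc j) (u c) \<in> E (Suc l) (a - 1)"
            "L a c (u (c - 1)) \<in> E (Suc l) (a - 1)"
          using jc by (auto intro!: Rx Lx E_diff)
        show ?thesis
          using jc by (simp only: pc_add_left[OF E_add[OF r(1,2)] r(3) e_E] pc_add_left[OF r(1,2) e_E])
      qed
      ultimately show ?thesis
        using jc by (simp only: pc_add_left[OF E_add[OF E(1,2)] E(3) y] pc_add_left[OF E(1,2) y])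
          (simp add: A_def M_def F_def)
    qed
    moreover have "rot (Suc l) c (d l a x) = 0" by (simp add: dx rot_def)
    ultimately show "A (Suc j) c + M j c + F j (c - 1) = 0"
      using jc y e_E by simp
  qed
  have 1: "(\<Sum>j=1..<Suc l. \<Sum>c=1..<j. T j c) = (\<Sum>j=1..<Suc l. \<Sum>c=1..<j. A j c)
      + (\<Sum>j=1..<Suc l. \<Sum>c=1..<j. F j c) + (\<Sum>j=1..<Suc l. \<Sum>c=1..<j. M j c)"
    unfolding sum.distrib[symmetric] by (intro sum.cong refl T)
  have 2: "(\<Sum>j=1..<Suc l. \<Sum>c=1..<j. A j c) + (\<Sum>c=1..<Suc l. A (Suc l) c)
     + ((\<Sum>j=1..<Suc l. \<Sum>c=1..<j. M j c) + (\<Sum>j=1..<Suc l. M j j))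
     + ((\<Sum>j=1..<Suc l. \<Sum>c=1..<j. F j c) + (\<Sum>j=1..<Suc l. F j 0)) = 0"
  proof -
    have "(\<Sum>j=1..<Suc l. \<Sum>c=1..<Suc j. A (Suc j) c) = (\<Sum>j=Suc 1..<Suc (Suc l). \<Sum>c=1..<j. A j c)"
      by (rule sum.shift_bounds_Suc_ivl[symmetric])
    also have "\<dots> = (\<Sum>j=1..<Suc (Suc l). \<Sum>c=1..<j. A j c)"
      by (simp add: sum.atLeast_Suc_lessThan[of 1] del: Suc_1)
    also have "\<dots> = (\<Sum>j=1..<Suc l. \<Sum>c=1..<j. A j c) + (\<Sum>c=1..<Suc l. A (Suc l) c)"
      by (simp add: sum.op_ivl_Suc[of _ 1 "Suc l"])
    finally have a: "(\<Sum>j=1..<Suc l. \<Sum>c=1..<Suc j. A (Suc j) c) =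
      (\<Sum>j=1..<Suc l. \<Sum>c=1..<j. A j c) + (\<Sum>c=1..<Suc l. A (Suc l) c)" .
    have mm: "(\<Sum>j=1..<Suc l. \<Sum>c=1..<Suc j. M j c) =
      (\<Sum>j=1..<Suc l. \<Sum>c=1..<j. M j c) + (\<Sum>j=1..<Suc l. M j j)"
      unfolding sum.distrib[symmetric] by (intro sum.cong refl) (simp add: sum.op_ivl_Suc)
    have ff: "(\<Sum>j=1..<Suc l. \<Sum>c=1..<Suc j. F j (c - 1)) =
      (\<Sum>j=1..<Suc l. \<Sum>c=1..<j. F j c) + (\<Sum>j=1..<Suc l. F j 0)"
      unfolding sum.distrib[symmetric]
    proof (intro sum.cong refl)
      fix j assume j: "j \<in> {1..<Suc l}"
      have "(\<Sum>c=1..<Suc j. F j (c - 1)) = (\<Sum>c=0..<j. F j c)"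
        using sum.shift_bounds_Suc_ivl[of "\<lambda>c. F j (c - 1)" 0 j] by (simp add: One_nat_def)
      then show "(\<Sum>c=1..<Suc j. F j (c - 1)) = (\<Sum>c=1..<j. F j c) + F j 0"
        using j by (simp add: sum.atLeast_Suc_lessThan[of 0] One_nat_def add.commute)
    qed
    show ?thesis using zero unfolding sum.distrib a mm ff .
  qed
  \<comment> \<open>\<open>y\<close> meets the new output\<close>
  have A: "(\<Sum>c=1..<Suc l. A (Suc l) c) = cup (l - 1) (connes_sum l x) y"
  proof -
    have "A (Suc l) c = cup (l - 1) (pc c (u c) e) y" if c: "c \<in> {1..<Suc l}" for c
    proof -
      have "pc c (pc 1 \<mu> (u c)) e = pc 1 \<mu> (pc c (u c) e)"
        using c by (intro seq[OF mu_E u e_E]) auto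
      moreover have "Suc (l - 1) = l" using c by simp
      ultimately show ?thesis by (simp add: cup_def A_def R_def)
    qed
    then have "(\<Sum>c=1..<Suc l. A (Suc l) c) = (\<Sum>c=1..<Suc l. cup (l - 1) (pc c (u c) e) y)"
      by simp
    also have "\<dots> = cup (l - 1) (connes_sum l x) y"
      unfolding connes_sum_def u_def[symmetric]
      by (intro cup_sum_left[OF _ y, of _ _ "l - 1" "a + 1", symmetric] pcI[OF u e_E]) auto
    finally show ?thesis .
  qed
  \<comment> \<open>\<open>e\<close> meets \<open>y\<close>\<close>
  have Mj: "M j j = ksign a (pc j (u j) y)" if j: "j \<in> {1..<Suc l}" for j
  proof -
    have xm: "pc j (u j) \<mu> \<in> E (Suc l) (a - 1)" using j by (intro mu_pc_E[OF u]) auto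
    have "R l a j (u j) - R l a (Suc j) (u j) = ksign (a + 1) (pc j (u j) \<mu>)"
      using j by (simp add: R_def ksign_add sum.atLeast_Suc_lessThan[of j])
    moreover have "pc j (ksign (a + 1) (pc j (u j) \<mu>)) e = ksign (a + 1) (pc j (pc j (u j) \<mu>) e)"
      using j by (intro pc_ksign_left[OF xm e_E]) auto
    moreover have "pc j (pc j (u j) \<mu>) e = - u j"
      using j by (intro pc_mu_e_left[OF u]) auto
    ultimately have "pc j (R l a j (u j) - R l a (Suc j) (u j)) e = ksign a (u j)"
      by (simp add: ksign_def split: if_splits)
    then show ?thesis
      unfolding M_def using j by (simp add: pc_ksign_left[OF u y])
  qed
  \<comment> \<open>\<open>e\<close> meets the new output\<close>
  have Fj: "F j 0 = ksign (a + 1) (pc j x y)" if j: "j \<in> {1..<Suc l}" for j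
  proof -
    have "F j 0 = pc j (pc 1 (pc 2 \<mu> x) e) y"
      by (simp add: F_def L_def u_def rot_0[OF x] flip: One_nat_def)
    then show ?thesis using j by (simp add: mu2_e[OF x] pc_ksign_left[OF x y])
  qed
  have Ms: "(\<Sum>j=1..<Suc l. M j j) = ksign a (rot_prelie l x y)"
    unfolding rot_prelie_def ksign_sum u_def[symmetric] by (intro sum.cong refl Mj)
  have Fs: "(\<Sum>j=1..<Suc l. F j 0) = ksign (a + 1) (prelie l x y)"
    unfolding prelie_def ksign_sum by (intro sum.cong refl Fj)
  have "(\<Sum>j=1..<Suc l. \<Sum>c=1..<j. T j c) = - (\<Sum>c=1..<Suc l. A (Suc l) c)
      - (\<Sum>j=1..<Suc l. M j j) - (\<Sum>j=1..<Suc l. F j 0)"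
    using 1 2 by (rule cancel_zero_sum2)
  then have "ksign (a + 1) (\<Sum>j=1..<Suc l. \<Sum>c=1..<j. T j c) =
      rot_prelie l x y - prelie l x y - ksign (a + 1) (cup (l - 1) (connes_sum l x) y)"
    unfolding A Ms Fs by (cases "even a"; simp add: ksign_def)
  moreover have "T j c \<in> bnd (l + m - 1) (a + b)" if "j \<in> {1..<Suc l}" "c \<in> {1..<j}" for j c
    unfolding T_def
  proof (rule bnd_d)
    have xe: "pc c (u c) e \<in> E (l - 1) (a + 1)" using that by (intro pcI[OF u e_E]) auto
    show "pc (j - 1) (pc c (u c) e) y \<in> E N (a + b + 1)"
      using that by (intro pcI[OF xe y]) (auto simp: N_def)
  qed (use that in \<open>auto simp: N_def\<close>)
  ultimately show ?thesis by (metis (no_types, lifting) bnd_ksign bnd_sum)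
qed

text \<open>
  In the rotation the inputs of \<open>x\<close> are at all places but \<open>c\<close>.
\<close>

lemma normalized_rot_e:
  assumes x: "x \<in> E l a" and nrm: "\<And>i. 1 \<le> i \<Longrightarrow> i \<le> l \<Longrightarrow> pc i x e = 0"
    and c: "c \<le> Suc l" and j: "1 \<le> j" "j \<le> l" "j \<noteq> c"
  shows "pc j (rot l c x) e = 0"
proof (cases "j < c")
  case True
  define k where "k = Suc l - c"
  have k: "k < j + k" "j + k \<le> l" using True j c by (auto simp: k_def)
  have "(\<sigma> ^^ k) (pc (j + k) x e) = pc (j + k - k) ((\<sigma> ^^ k) x) e"
    by (rule \<sigma>_pow_pc[OF x e_E k])
  then show ?thesis using nrm[of "j + k"] k j by (simp add: rot_def k_def)
next
  case False
  then have j': "c < j" using j by simp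
  have xc: "rot l c x \<in> E l a" by (rule rot_E[OF x])
  have pe: "pc j (rot l c x) e \<in> E (l - 1) (a + 1)" using j by (intro pcI[OF xc e_E]) auto
  have "(\<sigma> ^^ c) (rot l c x) = x"
    using \<sigma>_cyclic[OF x] c by (simp add: rot_def funpow_add[symmetric, THEN fun_cong, unfolded o_def] flip: funpow_Suc_right del: funpow.simps)
  then have "(\<sigma> ^^ c) (pc j (rot l c x) e) = 0"
    using \<sigma>_pow_pc[OF xc e_E j' j(2)] nrm[of "j - c"] j j' by simp
  then have "(\<sigma> ^^ (l - c)) ((\<sigma> ^^ c) (pc j (rot l c x) e)) = 0" by simp
  moreover have "(\<sigma> ^^ (l - c)) ((\<sigma> ^^ c) (pc j (rot l c x) e)) = (\<sigma> ^^ Suc (l - 1)) (pc j (rot l c x) e)"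
  proof -
    have "Suc (l - 1) = (l - c) + c" using j j' by simp
    then show ?thesis by (simp only: funpow_add o_apply)
  qed
  ultimately show ?thesis using \<sigma>_cyclic[OF pe] by simp
qed

text \<open>
  The sum is invariant under rotation, so its value is unchanged by the rotations of the second application.
  The second \<open>e\<close> is then plugged into an input of \<open>x\<close>.
\<close>

lemma connes_sum_connes_sum:
  assumes x: "x \<in> E l a" and nrm: "\<And>i. 1 \<le> i \<Longrightarrow> i \<le> l \<Longrightarrow> pc i x e = 0"
  shows "connes_sum (l - 1) (connes_sum l x) = 0"
proof (cases "l = 0")
  case False
  define u where "u c = rot l c x" for c
  have u: "u c \<in> E l a" for c unfolding u_def by (rule rot_E[OF x])
  have Xe: "pc c (u c) e \<in> E (l - 1) (a + 1)" if "c \<in> {1..<Suc l}" for c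
    using that by (intro pcI[OF u e_E]) auto
  have \<sigma>u: "\<sigma> (pc c (u c) e) = (if c = 1 then pc l (u l) e else pc (c - 1) (u (c - 1)) e)" if c: "c \<in> {1..<Suc l}" for c
  proof (cases "c = 1")
    case True
    have "pc 1 (u 1) e = (\<sigma> ^^ (l - 1)) (pc l (u l) e)"
    proof -
      have "(\<sigma> ^^ (l - 1)) (pc l (u l) e) = pc (l - (l - 1)) ((\<sigma> ^^ (l - 1)) (u l)) e"
        using c by (intro \<sigma>_pow_pc[OF u e_E]) auto
      moreover have "(\<sigma> ^^ (l - 1)) (u l) = u 1"
      proof -
        have "Suc l - 1 = (l - 1) + (Suc l - l)" using c by simp
        then show ?thesis unfolding u_def rot_def by (simp only: funpow_add o_apply)
      qed
      ultimately show ?thesis using c by simp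
    qed
    then have "\<sigma> (pc 1 (u 1) e) = (\<sigma> ^^ Suc (l - 1)) (pc l (u l) e)" by simp
    also have "\<dots> = pc l (u l) e" using c by (intro \<sigma>_cyclic[OF Xe]) auto
    finally show ?thesis using True by simp
  next
    case F: False
    have "\<sigma> (u c) = u (c - 1)"
    proof -
      have "Suc l - (c - 1) = Suc (Suc l - c)" using c F by auto
      then show ?thesis by (simp add: u_def rot_def)
    qed
    then show ?thesis using \<sigma>_pc[OF u e_E, of c c] c F by auto
  qed
  have inv: "\<sigma> (connes_sum l x) = connes_sum l x"
  proof -
    have "\<sigma> (connes_sum l x) = (\<Sum>c=1..<Suc l. \<sigma> (pc c (u c) e))"
      unfolding connes_sum_def u_def[symmetric] by (rule \<sigma>_sum[OF Xe])
    also have "\<dots> = (\<Sum>c=1..<Suc l. if c = 1 then pc l (u l) e else pc (c - 1) (u (c - 1)) e)"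
      by (intro sum.cong refl \<sigma>u)
    also have "\<dots> = pc l (u l) e + (\<Sum>c=Suc 1..<Suc l. if c = 1 then pc l (u l) e else pc (c - 1) (u (c - 1)) e)"
      using False by (simp add: sum.atLeast_Suc_lessThan[of 1])
    also have "(\<Sum>c=Suc 1..<Suc l. if c = 1 then pc l (u l) e else pc (c - 1) (u (c - 1)) e) = (\<Sum>c=1..<l. pc c (u c) e)"
      unfolding sum.shift_bounds_Suc_ivl by (intro sum.cong refl) (auto simp: One_nat_def)
    also have "pc l (u l) e + (\<Sum>c=1..<l. pc c (u c) e) = connes_sum l x"
      using False by (simp add: connes_sum_def u_def sum.op_ivl_Suc add.commute)
    finally show ?thesis .
  qed
  have inv': "(\<sigma> ^^ k) (connes_sum l x) = connes_sum l x" for k by (induction k) (auto simp: inv)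
  have "pc c' (connes_sum l x) e = 0" if c': "c' \<in> {1..<l}" for c'
  proof -
    have "pc c' (connes_sum l x) e = (\<Sum>c=1..<Suc l. pc c' (pc c (u c) e) e)"
      unfolding connes_sum_def u_def[symmetric] using c' by (intro pc_sum_left[OF Xe e_E]) auto
    also have "\<dots> = 0"
    proof (intro sum.neutral ballI)
      fix c assume c: "c \<in> {1..<Suc l}"
      show "pc c' (pc c (u c) e) e = 0"
      proof (cases "c' < c")
        case True
        have "pc (c - 1) (pc c' (u c) e) e = ksign (1 * 1) (pc c' (pc c (u c) e) e)"
          using True c c' by (intro par[OF u e_E e_E]) auto
        moreover have "pc c' (u c) e = 0"
          unfolding u_def using True c c' by (intro normalized_rot_e[OF x nrm]) auto
        moreover have "1 \<le> c - 1" using True c' by auto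
        ultimately show ?thesis using pc_zero_left[OF e_E, of "c - 1"] by simp
      next
        case F: False
        have "pc c' (pc c (u c) e) e = ksign (1 * 1) (pc c (pc (Suc c') (u c) e) e)"
          using F c c' by (intro par[OF u e_E e_E]) auto
        moreover have "pc (Suc c') (u c) e = 0"
          unfolding u_def using F c c' by (intro normalized_rot_e[OF x nrm]) auto
        ultimately show ?thesis using pc_zero_left[OF e_E, of c] c by simp
      qed
    qed
    finally show ?thesis .
  qed
  then show ?thesis
    using False by (auto simp: connes_sum_def[of "l - 1"] rot_def inv' intro!: sum.neutral)
qed simp

definition B :: "nat \<Rightarrow> int \<Rightarrow> 'b \<Rightarrow> 'b" where
  "B l a x = ksign (a + 1) (connes_sum l x)"

lemma B_E: "x \<in> E l a \<Longrightarrow> B l a x \<in> E (l - 1) (a + 1)"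
  unfolding B_def by (intro E_ksign connes_sum_E)

lemma d_connes_sum_cycle:
  assumes x: "x \<in> cyc l a"
  shows "d (l - 1) (a + 1) (connes_sum l x) = 0"
  using connes_sum_d(1)[OF cyc_E[OF x]] by (cases "l = 0") (auto simp: cyc_d[OF x])

lemma B_cyc: "x \<in> cyc l a \<Longrightarrow> B l a x \<in> cyc (l - 1) (a + 1)"
  by (rule cycI) (auto simp: B_E cyc_E B_def[of l] d_ksign[OF connes_sum_E[OF cyc_E]] d_connes_sum_cycle intro!: E_ksign connes_sum_E)

lemma B_bnd:
  assumes x: "x \<in> bnd l a"
  shows "B l a x \<in> bnd (l - 1) (a + 1)"
  using x
proof (cases rule: bnd_cases)
  case 1
  then show ?thesis by (simp add: B_def)
next
  case (2 j w)
  show ?thesis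
  proof (cases "j = 0")
    case True
    then show ?thesis using connes_sum_d(2)[OF 2(2)] 2 by (simp add: B_def)
  next
    case False
    have "d (j - 1) (a + 1 + 1) (connes_sum j w) \<in> bnd (l - 1) (a + 1)"
      using False by (intro bnd_d connes_sum_E[OF 2(2)]) (auto simp: 2)
    then show ?thesis
      using connes_sum_d(1)[OF 2(2)] False 2 by (simp add: B_def bnd_ksign)
  qed
qed

lemma B_B:
  assumes x: "x \<in> E l a" and nrm: "\<And>i. 1 \<le> i \<Longrightarrow> i \<le> l \<Longrightarrow> pc i x e = 0"
  shows "B (l - 1) (a + 1) (B l a x) = 0"
proof -
  have "connes_sum (l - 1) (ksign (a + 1) (connes_sum l x)) = ksign (a + 1) (connes_sum (l - 1) (connes_sum l x))"
    using connes_sum_add[OF connes_sum_E[OF x] E_uminus[OF connes_sum_E[OF x]]]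
    by (simp add: ksign_def eq_neg_iff_add_eq_0 add.commute)
  then show ?thesis by (simp add: B_def connes_sum_connes_sum[OF x nrm])
qed

lemma B_prod:
  assumes x: "x \<in> cyc l a" and y: "y \<in> cyc m b"
  shows "B (l + m) (a + b - 1) (prod l a x y) -
    (prod (l - 1) (a + 1) (B l a x) y + ksign (a + 1) (prod l a x (B m b y)) +
     ksign (a + 1) (br l a m b x y)) \<in> bnd (l + m - 1) (a + b)"
proof -
  note xE = cyc_E[OF x] and yE = cyc_E[OF y]
  have 1: "rot_prelie l x y - prelie l x y - ksign (a + 1) (cup (l - 1) (connes_sum l x) y) \<in> bnd (l + m - 1) (a + b)"
    using x y by (intro rot_prelie_homotopy) (auto simp: cyc_def)
  have 2: "rot_prelie m y x - prelie m y x - ksign (b + 1) (cup (m - 1) (connes_sum m y) x) \<in> bnd (l + m - 1) (a + b)"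
    using x y rot_prelie_homotopy[of y m b x l a] by (auto simp: cyc_def add.commute)
  have 3: "cup (m - 1) (connes_sum m y) x + ksign ((b + 1) * a) (cup l x (connes_sum m y)) \<in> bnd (l + m - 1) (a + b)"
  proof (cases "m = 0")
    case True
    then show ?thesis using xE by simp
  next
    case False
    have "cup (m - 1) (connes_sum m y) x + ksign ((b + 1) * a) (cup l x (connes_sum m y)) \<in> bnd (m - 1 + l) (b + 1 + a - 1)"
      using x by (intro cup_comm connes_sum_E[OF yE] d_connes_sum_cycle[OF y]) (auto simp: cyc_def)
    moreover have "m - 1 + l = l + m - 1" "b + 1 + a - 1 = a + b" using False by auto
    ultimately show ?thesis by simp
  qed
  have P1: "prod (l - 1) (a + 1) (B l a x) y = cup (l - 1) (connes_sum l x) y"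
    unfolding prod_def B_def cup_ksign_left[OF connes_sum_E[OF xE] yE] by (simp only: ksign_ksign) (simp add: ksign_def)
  have P2: "prod l a x (B m b y) = ksign (a + b + 1) (cup l x (connes_sum m y))"
    unfolding prod_def B_def cup_ksign_right[OF xE connes_sum_E[OF yE]] by (simp add: ksign_ksign add_ac)
  have P3: "B (l + m) (a + b - 1) (prod l a x y) =
      ksign (a + 1) (rot_prelie l x y) + ksign (a * b + a) (rot_prelie m y x)"
  proof -
    have "connes_sum (l + m) (ksign a (cup l x y)) = ksign a (connes_sum (l + m) (cup l x y))"
      using connes_sum_add[OF cup_E[OF xE yE] E_uminus[OF cup_E[OF xE yE]]]
      by (simp add: ksign_def eq_neg_iff_add_eq_0 add.commute)
    then show ?thesis
      unfolding B_def prod_def connes_sum_cup[OF xE yE]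
      by (cases "even a"; cases "even b"; simp add: ksign_def connes_sum_cup[OF xE yE])
  qed
  have "ksign (a + 1) (rot_prelie l x y - prelie l x y - ksign (a + 1) (cup (l - 1) (connes_sum l x) y)) +
     ksign (a * b + a) (rot_prelie m y x - prelie m y x - ksign (b + 1) (cup (m - 1) (connes_sum m y) x)) +
     ksign (a * b + a + b + 1) (cup (m - 1) (connes_sum m y) x + ksign ((b + 1) * a) (cup l x (connes_sum m y)))
    \<in> bnd (l + m - 1) (a + b)"
    by (intro bnd_add bnd_ksign 1 2 3)
  also have "ksign (a + 1) (rot_prelie l x y - prelie l x y - ksign (a + 1) (cup (l - 1) (connes_sum l x) y)) +
     ksign (a * b + a) (rot_prelie m y x - prelie m y x - ksign (b + 1) (cup (m - 1) (connes_sum m y) x)) +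
     ksign (a * b + a + b + 1) (cup (m - 1) (connes_sum m y) x + ksign ((b + 1) * a) (cup l x (connes_sum m y))) =
    B (l + m) (a + b - 1) (prod l a x y) -
    (prod (l - 1) (a + 1) (B l a x) y + ksign (a + 1) (prod l a x (B m b y)) +
     ksign (a + 1) (br l a m b x y))"
    unfolding P1 P2 P3 br_def by (cases "even a"; cases "even b"; simp add: ksign_def)
  finally show ?thesis .
qed

end

section \<open>Suspension of a cyclic multiplicative operad\<close>

lemma single_ksign: "ksign n (single k x) = single k (ksign n (x :: 'a::ab_group_add))"
  by (simp add: ksign_def single_uminus)

lemma single_sum: "single k (\<Sum>i\<in>A. f i) = (\<Sum>i\<in>A. single k (f i :: 'a::ab_group_add))"
  by (induction A rule: infinite_finite_induct) (auto simp: single_add)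

context cyclic_multiplicative_operad
begin

abbreviation hom :: "nat \<Rightarrow> int \<Rightarrow> 'a set" where
  "hom l p \<equiv> comps \<O> l (int l + p)"

lemma comps_zero [simp]: "0 \<in> comps \<O> l p"
  by (rule subspace_0[OF subspace_comps])

lemma comps_add: "\<lbrakk>x \<in> comps \<O> l p; y \<in> comps \<O> l p\<rbrakk> \<Longrightarrow> x + y \<in> comps \<O> l p"
  by (rule subspace_add[OF subspace_comps])

lemma comps_uminus: "x \<in> comps \<O> l p \<Longrightarrow> - x \<in> comps \<O> l p"
  by (rule subspace_neg[OF subspace_comps])

lemma comps_scl: "x \<in> comps \<O> l p \<Longrightarrow> scl \<O> a x \<in> comps \<O> l p"
  by (rule subspace_scale[OF subspace_comps])

lemma comps_ksign: "x \<in> comps \<O> l p \<Longrightarrow> ksign n x \<in> comps \<O> l p"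
  by (simp add: ksign_def comps_uminus)

lemma comps_sum: "(\<And>i. i \<in> A \<Longrightarrow> f i \<in> comps \<O> l p) \<Longrightarrow> (\<Sum>i\<in>A. f i) \<in> comps \<O> l p"
  by (induction A rule: infinite_finite_induct) (auto intro: comps_add)

lemma pcomp_zero_left [simp]: "\<lbrakk>y \<in> comps \<O> m q; 1 \<le> i; i \<le> l\<rbrakk> \<Longrightarrow> pcomp \<O> l m i 0 y = 0"
  using pcomp_add_left[of i l 0 0 0 y m q] by simp

lemma pcomp_zero_right [simp]: "\<lbrakk>x \<in> comps \<O> l p; 1 \<le> i; i \<le> l\<rbrakk> \<Longrightarrow> pcomp \<O> l m i x 0 = 0"
  using pcomp_add_right[of i l x p 0 m 0 0] by simp

lemma pcomp_ksign_left: "\<lbrakk>x \<in> comps \<O> l p; y \<in> comps \<O> m q; 1 \<le> i; i \<le> l\<rbrakk> \<Longrightarrow>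
    pcomp \<O> l m i (ksign n x) y = ksign n (pcomp \<O> l m i x y)"
  using pcomp_add_left[of i l x p "- x" y m q] comps_uminus[of x l p]
  by (auto simp: ksign_def eq_neg_iff_add_eq_0 add.commute)

lemma pcomp_ksign_right: "\<lbrakk>x \<in> comps \<O> l p; y \<in> comps \<O> m q; 1 \<le> i; i \<le> l\<rbrakk> \<Longrightarrow>
    pcomp \<O> l m i x (ksign n y) = ksign n (pcomp \<O> l m i x y)"
  using pcomp_add_right[of i l x p y m q "- y"] comps_uminus[of y m q]
  by (auto simp: ksign_def eq_neg_iff_add_eq_0 add.commute)

text \<open>
  An element of \<open>\<O>(l)\<close> of degree \<open>p = l + a - 1\<close> is represented by the family that has it in place
  \<open>(l, a)\<close>. In this way the modules \<open>\<O>(l)\<^sub>p\<close> become independent.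
\<close>

definition E :: "nat \<Rightarrow> int \<Rightarrow> (nat \<times> int \<Rightarrow>\<^sub>0 'a) set" where
  "E l a = single (l, a) ` comps \<O> l (int l + a - 1)"

text \<open>
  \<open>x \<circ>\<^sub>i y\<close> with the sign of its summand in \<open>circ_bar\<close>; the degree of \<open>y\<close> is \<open>m + b - 1\<close>.
\<close>

definition susp :: "nat \<Rightarrow> nat \<Rightarrow> int \<Rightarrow> nat \<Rightarrow> 'a \<Rightarrow> 'a \<Rightarrow> 'a" where
  "susp l m b i x y =
    ksign ((int m - 1) * (int l - int i) + (int l - 1) * (int m + b - 1)) (pcomp \<O> l m i x y)"

definition spc :: "nat \<Rightarrow> (nat \<times> int \<Rightarrow>\<^sub>0 'a) \<Rightarrow> (nat \<times> int \<Rightarrow>\<^sub>0 'a) \<Rightarrow> (nat \<times> int \<Rightarrow>\<^sub>0 'a)" where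
  "spc i U Y = (\<Sum>u \<in> keys U. \<Sum>v \<in> keys Y.
     single (fst u + fst v - 1, snd u + snd v)
       (susp (fst u) (fst v) (snd v) i (lookup U u) (lookup Y v)))"

definition stau :: "(nat \<times> int \<Rightarrow>\<^sub>0 'a) \<Rightarrow> (nat \<times> int \<Rightarrow>\<^sub>0 'a)" where
  "stau U = (\<Sum>u \<in> keys U.
     single u (ksign (int (fst u)) (tau \<O> (fst u) (lookup U u))))"

abbreviation sgl :: "nat \<Rightarrow> int \<Rightarrow> 'a \<Rightarrow> (nat \<times> int \<Rightarrow>\<^sub>0 'a)" where
  "sgl l a x \<equiv> single (l, a) x"

lemma spc_sgl:
  assumes "x \<in> comps \<O> l p" "y \<in> comps \<O> m q" "1 \<le> i" "i \<le> l"
  shows "spc i (sgl l a x) (sgl m b y) = sgl (l + m - 1) (a + b) (susp l m b i x y)"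
  using assms by (cases "x = 0"; cases "y = 0") (auto simp: spc_def susp_def)

lemma tau_zero [simp]: "tau \<O> k 0 = 0"
  using tau_add[of 0 k 0 0] by simp

lemma tau_ksign: "x \<in> comps \<O> k p \<Longrightarrow> tau \<O> k (ksign n x) = ksign n (tau \<O> k x)"
  using tau_add[of x k p "- x"] comps_uminus[of x k p]
  by (auto simp: ksign_def eq_neg_iff_add_eq_0 add.commute)

lemma stau_sgl: "stau (sgl l a x) = sgl l a (ksign (int l) (tau \<O> l x))"
  by (cases "x = 0") (auto simp: stau_def)

lemma tau_pow_closed: "x \<in> comps \<O> k p \<Longrightarrow> (tau \<O> k ^^ n) x \<in> comps \<O> k p"
  by (induction n) (auto intro: tau_closed)

lemma stau_pow_sgl:
  assumes "x \<in> comps \<O> l p"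
  shows "(stau ^^ n) (sgl l a x) = sgl l a (ksign (int n * int l) ((tau \<O> l ^^ n) x))"
proof (induction n)
  case (Suc n)
  then show ?case
    by (simp add: stau_sgl tau_ksign[OF tau_pow_closed[OF assms]] ksign_ksign algebra_simps)
qed (simp add: ksign_def)

lemma E_sgl: "x \<in> comps \<O> l p \<Longrightarrow> p = int l + a - 1 \<Longrightarrow> sgl l a x \<in> E l a"
  by (auto simp: E_def)

lemma E_cases:
  assumes "U \<in> E l a"
  obtains x where "U = sgl l a x" "x \<in> comps \<O> l (int l + a - 1)"
  using assms by (auto simp: E_def)

lemma susp_closed: "\<lbrakk>x \<in> comps \<O> l p; y \<in> comps \<O> m q; 1 \<le> i; i \<le> l\<rbrakk> \<Longrightarrow>
    susp l m b i x y \<in> comps \<O> (l + m - 1) (p + q)"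
  unfolding susp_def by (intro comps_ksign pcomp_closed)

lemma susp_sequential:
  assumes x: "x \<in> comps \<O> l (int l + a - 1)" and y: "y \<in> comps \<O> m (int m + b - 1)"
    and z: "z \<in> comps \<O> n (int n + c - 1)" and ij: "1 \<le> i" "i \<le> l" "1 \<le> j" "j \<le> m"
  shows "susp (l + m - 1) n c (i + j - 1) (susp l m b i x y) z =
    susp l (m + n - 1) (b + c) i x (susp m n c j y z)"
proof -
  have lm: "int (l + m - 1) = int l + int m - 1" "int (m + n - 1) = int m + int n - 1"
    "int (i + j - 1) = int i + int j - 1" using ij by auto
  have "susp (l + m - 1) n c (i + j - 1) (susp l m b i x y) z =
    ksign ((int n - 1) * (int l + int m - 1 - (int i + int j - 1)) + (int l + int m - 1 - 1) * (int n + c - 1)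
      + ((int m - 1) * (int l - int i) + (int l - 1) * (int m + b - 1)))
      (pcomp \<O> (l + m - 1) n (i + j - 1) (pcomp \<O> l m i x y) z)"
    unfolding susp_def lm using ij
    by (simp add: pcomp_ksign_left[OF pcomp_closed[OF ij(1,2) x y] z] ksign_ksign)
  also have "pcomp \<O> (l + m - 1) n (i + j - 1) (pcomp \<O> l m i x y) z =
      pcomp \<O> l (m + n - 1) i x (pcomp \<O> m n j y z)"
    by (rule pcomp_sequential[OF ij x y z])
  also have "ksign ((int n - 1) * (int l + int m - 1 - (int i + int j - 1)) + (int l + int m - 1 - 1) * (int n + c - 1)
      + ((int m - 1) * (int l - int i) + (int l - 1) * (int m + b - 1)))
        (pcomp \<O> l (m + n - 1) i x (pcomp \<O> m n j y z)) =
      ksign ((int m + int n - 1 - 1) * (int l - int i) + (int l - 1) * (int m + int n - 1 + (b + c) - 1)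
      + ((int n - 1) * (int m - int j) + (int m - 1) * (int n + c - 1)))
        (pcomp \<O> l (m + n - 1) i x (pcomp \<O> m n j y z))"
    by (rule ksign_cong) (simp add: algebra_simps)
  also have "\<dots> = susp l (m + n - 1) (b + c) i x (susp m n c j y z)"
    unfolding susp_def lm using ij
    by (simp add: pcomp_ksign_right[OF x pcomp_closed[OF ij(3,4) y z]] ksign_ksign)
  finally show ?thesis .
qed

lemma susp_parallel:
  assumes x: "x \<in> comps \<O> l (int l + a - 1)" and y: "y \<in> comps \<O> m (int m + b - 1)"
    and z: "z \<in> comps \<O> n (int n + c - 1)" and ij: "1 \<le> i" "i < j" "j \<le> l"
  shows "susp (l + m - 1) n c (j + m - 1) (susp l m b i x y) z =
    ksign (b * c) (susp (l + n - 1) m b i (susp l n c j x z) y)"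
proof -
  have lm: "int (l + m - 1) = int l + int m - 1" "int (l + n - 1) = int l + int n - 1"
    "int (j + m - 1) = int j + int m - 1" using ij by auto
  have i: "1 \<le> i" "i \<le> l" and j: "1 \<le> j" "j \<le> l" using ij by auto
  have "susp (l + m - 1) n c (j + m - 1) (susp l m b i x y) z =
    ksign ((int n - 1) * (int l + int m - 1 - (int j + int m - 1)) + (int l + int m - 1 - 1) * (int n + c - 1)
      + ((int m - 1) * (int l - int i) + (int l - 1) * (int m + b - 1)))
      (pcomp \<O> (l + m - 1) n (j + m - 1) (pcomp \<O> l m i x y) z)"
    unfolding susp_def lm using ij
    by (simp add: pcomp_ksign_left[OF pcomp_closed[OF i x y] z] ksign_ksign)
  also have "pcomp \<O> (l + m - 1) n (j + m - 1) (pcomp \<O> l m i x y) z =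
      ksign ((int m + b - 1) * (int n + c - 1)) (pcomp \<O> (l + n - 1) m i (pcomp \<O> l n j x z) y)"
    by (rule pcomp_parallel[OF ij x y z])
  also have "ksign ((int n - 1) * (int l + int m - 1 - (int j + int m - 1)) + (int l + int m - 1 - 1) * (int n + c - 1)
      + ((int m - 1) * (int l - int i) + (int l - 1) * (int m + b - 1)))
        (ksign ((int m + b - 1) * (int n + c - 1)) (pcomp \<O> (l + n - 1) m i (pcomp \<O> l n j x z) y)) =
      ksign (b * c + ((int m - 1) * (int l + int n - 1 - int i) + (int l + int n - 1 - 1) * (int m + b - 1)
      + ((int n - 1) * (int l - int j) + (int l - 1) * (int n + c - 1))))
        (pcomp \<O> (l + n - 1) m i (pcomp \<O> l n j x z) y)"
    unfolding ksign_ksign by (rule ksign_cong) (simp add: algebra_simps)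
  also have "\<dots> = ksign (b * c) (susp (l + n - 1) m b i (susp l n c j x z) y)"
    unfolding susp_def lm using ij
    by (simp add: pcomp_ksign_left[OF pcomp_closed[OF j x z] y] ksign_ksign)
  finally show ?thesis .
qed

text \<open>
  Each law reduces to the corresponding one for \<open>\<O>\<close> by comparing the exponents of the signs modulo two.
\<close>

sublocale S: cyclic_suspended_operad E spc "sgl 1 0 (ident \<O>)" "sgl 2 (-1) (mu \<O>)" "sgl 0 1 (unt \<O>)" stau
proof
  fix l m n i j :: nat and a b c :: int and U U' Y Y' Z' :: "nat \<times> int \<Rightarrow>\<^sub>0 'a"
  show "0 \<in> E l a" using E_sgl[OF comps_zero] by simp
  show "U + Y \<in> E l a" if U: "U \<in> E l a" and Y: "Y \<in> E l a"
    using E_cases[OF U] E_cases[OF Y] by (metis E_sgl comps_add single_add)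
  show "- U \<in> E l a" if U: "U \<in> E l a"
    using E_cases[OF U] by (metis E_sgl comps_uminus single_uminus)
  show "spc i U Y \<in> E (l + m - 1) (a + b)" if U: "U \<in> E l a" and Y: "Y \<in> E m b" and i: "1 \<le> i" "i \<le> l"
  proof -
    obtain x where x: "U = sgl l a x" "x \<in> comps \<O> l (int l + a - 1)" using U by (rule E_cases)
    obtain y where y: "Y = sgl m b y" "y \<in> comps \<O> m (int m + b - 1)" using Y by (rule E_cases)
    show ?thesis
      unfolding x(1) y(1) spc_sgl[OF x(2) y(2) i] using i
      by (intro E_sgl[OF susp_closed[OF x(2) y(2) i]]) auto
  qed
  show "spc i (U + U') Y = spc i U Y + spc i U' Y"
    if U: "U \<in> E l a" and U': "U' \<in> E l a" and Y: "Y \<in> E m b" and i: "1 \<le> i" "i \<le> l"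
  proof -
    obtain x where x: "U = sgl l a x" "x \<in> comps \<O> l (int l + a - 1)" using U by (rule E_cases)
    obtain x' where x': "U' = sgl l a x'" "x' \<in> comps \<O> l (int l + a - 1)" using U' by (rule E_cases)
    obtain y where y: "Y = sgl m b y" "y \<in> comps \<O> m (int m + b - 1)" using Y by (rule E_cases)
    show ?thesis
      unfolding x(1) x'(1) y(1) single_add[symmetric] spc_sgl[OF x(2) y(2) i] spc_sgl[OF x'(2) y(2) i]
        spc_sgl[OF comps_add[OF x(2) x'(2)] y(2) i]
      by (simp add: susp_def pcomp_add_left[OF i x(2) x'(2) y(2)] ksign_add)
  qed
  show "spc i U (Y + Y') = spc i U Y + spc i U Y'"
    if U: "U \<in> E l a" and Y: "Y \<in> E m b" and Y': "Y' \<in> E m b" and i: "1 \<le> i" "i \<le> l"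
  proof -
    obtain x where x: "U = sgl l a x" "x \<in> comps \<O> l (int l + a - 1)" using U by (rule E_cases)
    obtain y where y: "Y = sgl m b y" "y \<in> comps \<O> m (int m + b - 1)" using Y by (rule E_cases)
    obtain y' where y': "Y' = sgl m b y'" "y' \<in> comps \<O> m (int m + b - 1)" using Y' by (rule E_cases)
    show ?thesis
      unfolding x(1) y(1) y'(1) single_add[symmetric] spc_sgl[OF x(2) y(2) i] spc_sgl[OF x(2) y'(2) i]
        spc_sgl[OF x(2) comps_add[OF y(2) y'(2)] i]
      by (simp add: susp_def pcomp_add_right[OF i x(2) y(2) y'(2)] ksign_add)
  qed
  show "spc (i + j - 1) (spc i U Y) Z' = spc i U (spc j Y Z')"
    if U: "U \<in> E l a" and Y: "Y \<in> E m b" and Z': "Z' \<in> E n c"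
      and ij: "1 \<le> i" "i \<le> l" "1 \<le> j" "j \<le> m"
  proof -
    obtain x where x: "U = sgl l a x" "x \<in> comps \<O> l (int l + a - 1)" using U by (rule E_cases)
    obtain y where y: "Y = sgl m b y" "y \<in> comps \<O> m (int m + b - 1)" using Y by (rule E_cases)
    obtain z where z: "Z' = sgl n c z" "z \<in> comps \<O> n (int n + c - 1)" using Z' by (rule E_cases)
    have k: "1 \<le> i + j - 1" "i + j - 1 \<le> l + m - 1" "l + m - 1 + n - 1 = l + (m + n - 1) - 1" using ij by auto
    show ?thesis
      unfolding x(1) y(1) z(1) spc_sgl[OF x(2) y(2) ij(1,2)] spc_sgl[OF y(2) z(2) ij(3,4)]
        spc_sgl[OF susp_closed[OF x(2) y(2) ij(1,2)] z(2) k(1,2)]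
        spc_sgl[OF x(2) susp_closed[OF y(2) z(2) ij(3,4)] ij(1,2)]
        susp_sequential[OF x(2) y(2) z(2) ij] k(3) by (simp add: add.assoc)
  qed
  show "spc (j + m - 1) (spc i U Y) Z' = ksign (b * c) (spc i (spc j U Z') Y)"
    if U: "U \<in> E l a" and Y: "Y \<in> E m b" and Z': "Z' \<in> E n c" and ij: "1 \<le> i" "i < j" "j \<le> l"
  proof -
    obtain x where x: "U = sgl l a x" "x \<in> comps \<O> l (int l + a - 1)" using U by (rule E_cases)
    obtain y where y: "Y = sgl m b y" "y \<in> comps \<O> m (int m + b - 1)" using Y by (rule E_cases)
    obtain z where z: "Z' = sgl n c z" "z \<in> comps \<O> n (int n + c - 1)" using Z' by (rule E_cases)
    have k: "1 \<le> j + m - 1" "j + m - 1 \<le> l + m - 1" "l + m - 1 + n - 1 = l + n - 1 + m - 1"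
      "i \<le> l" "1 \<le> j" "i \<le> l + n - 1" using ij by auto
    show ?thesis
      unfolding x(1) y(1) z(1) spc_sgl[OF x(2) y(2) ij(1) k(4)] spc_sgl[OF x(2) z(2) k(5) ij(3)]
        spc_sgl[OF susp_closed[OF x(2) y(2) ij(1) k(4)] z(2) k(1,2)]
        spc_sgl[OF susp_closed[OF x(2) z(2) k(5) ij(3)] y(2) ij(1) k(6)]
        susp_parallel[OF x(2) y(2) z(2) ij] k(3) single_ksign by (simp add: add_ac)
  qed
  show "spc 1 (sgl 1 0 (ident \<O>)) Y = Y" if Y: "Y \<in> E m b"
  proof -
    obtain y where y: "Y = sgl m b y" "y \<in> comps \<O> m (int m + b - 1)" using Y by (rule E_cases)
    show ?thesis
      unfolding y(1) using spc_sgl[OF ident_closed y(2), of 1]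
      by (simp add: susp_def ident_left[OF y(2)] ksign_def)
  qed
  show "spc i U (sgl 1 0 (ident \<O>)) = U" if U: "U \<in> E l a" and i: "1 \<le> i" "i \<le> l"
  proof -
    obtain x where x: "U = sgl l a x" "x \<in> comps \<O> l (int l + a - 1)" using U by (rule E_cases)
    show ?thesis
      unfolding x(1) using spc_sgl[OF x(2) ident_closed i]
      by (simp add: susp_def ident_right[OF i x(2)] ksign_def)
  qed
  show "sgl 2 (- 1) (mu \<O>) \<in> E 2 (- 1)" by (rule E_sgl[OF mu_closed]) simp
  show "sgl 0 1 (unt \<O>) \<in> E 0 1" by (rule E_sgl[OF unt_closed]) simp
  show "spc 1 (sgl 2 (- 1) (mu \<O>)) (sgl 2 (- 1) (mu \<O>)) = - spc 2 (sgl 2 (- 1) (mu \<O>)) (sgl 2 (- 1) (mu \<O>))"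
    by (simp add: spc_sgl[OF mu_closed mu_closed] susp_def mu_assoc) (simp add: ksign_def single_uminus)
  show "spc 1 (sgl 2 (- 1) (mu \<O>)) (sgl 0 1 (unt \<O>)) = - sgl 1 0 (ident \<O>)"
    by (simp add: spc_sgl[OF mu_closed unt_closed] susp_def mu_unt_left) (simp add: ksign_def single_uminus One_nat_def)
  show "spc 2 (sgl 2 (- 1) (mu \<O>)) (sgl 0 1 (unt \<O>)) = sgl 1 0 (ident \<O>)"
    by (simp add: spc_sgl[OF mu_closed unt_closed] susp_def mu_unt_right) (simp add: ksign_def single_uminus One_nat_def)
  show "stau U \<in> E l a" if U: "U \<in> E l a"
  proof -
    obtain x where x: "U = sgl l a x" "x \<in> comps \<O> l (int l + a - 1)" using U by (rule E_cases)
    show ?thesis unfolding x(1) stau_sgl by (rule E_sgl[OF comps_ksign[OF tau_closed[OF x(2)]] refl])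
  qed
  show "stau (U + Y) = stau U + stau Y" if U: "U \<in> E l a" and Y: "Y \<in> E l a"
  proof -
    obtain x where x: "U = sgl l a x" "x \<in> comps \<O> l (int l + a - 1)" using U by (rule E_cases)
    obtain y where y: "Y = sgl l a y" "y \<in> comps \<O> l (int l + a - 1)" using Y by (rule E_cases)
    show ?thesis unfolding x(1) y(1) single_add[symmetric] stau_sgl tau_add[OF x(2) y(2)] ksign_add ..
  qed
  show "(stau ^^ Suc l) U = U" if U: "U \<in> E l a"
  proof -
    obtain x where x: "U = sgl l a x" "x \<in> comps \<O> l (int l + a - 1)" using U by (rule E_cases)
    have "even (int (Suc l) * int l)" by simp
    then show ?thesis
      unfolding x(1) stau_pow_sgl[OF x(2)] using tau_cyclic[OF x(2)] by (simp add: ksign_def flip: Suc_eq_plus1)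
  qed
  show "stau (sgl 2 (- 1) (mu \<O>)) = sgl 2 (- 1) (mu \<O>)"
    by (simp add: stau_sgl tau_mu ksign_def)
  show "stau (spc i U Y) = spc (i - 1) (stau U) Y" if U: "U \<in> E l a" and Y: "Y \<in> E m b" and i: "2 \<le> i" "i \<le> l"
  proof -
    obtain x where x: "U = sgl l a x" "x \<in> comps \<O> l (int l + a - 1)" using U by (rule E_cases)
    obtain y where y: "Y = sgl m b y" "y \<in> comps \<O> m (int m + b - 1)" using Y by (rule E_cases)
    have k: "1 \<le> i" "1 \<le> i - 1" "i - 1 \<le> l" "int (i - 1) = int i - 1" "int (l + m - 1) = int l + int m - 1" using i by auto
    have t: "pcomp \<O> l m (i - 1) (ksign (int l) (tau \<O> l x)) y = ksign (int l) (pcomp \<O> l m (i - 1) (tau \<O> l x) y)"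
      by (rule pcomp_ksign_left[OF tau_closed[OF x(2)] y(2) k(2,3)])
    show ?thesis
      unfolding x(1) y(1) spc_sgl[OF x(2) y(2) k(1) i(2)] stau_sgl
        spc_sgl[OF comps_ksign[OF tau_closed[OF x(2)]] y(2) k(2,3)]
      unfolding susp_def tau_ksign[OF pcomp_closed[OF k(1) i(2) x(2) y(2)]] tau_pcomp[OF i x(2) y(2)] t ksign_ksign k(4,5)
      by (intro arg_cong[of _ _ "sgl _ _"] ksign_cong) (simp add: algebra_simps)
  qed
  show "stau (spc 1 U Y) = - ksign (a * b) (spc m (stau Y) (stau U))"
    if U: "U \<in> E l a" and Y: "Y \<in> E m b" and lm: "1 \<le> l" "1 \<le> m"
  proof -
    obtain x where x: "U = sgl l a x" "x \<in> comps \<O> l (int l + a - 1)" using U by (rule E_cases)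
    obtain y where y: "Y = sgl m b y" "y \<in> comps \<O> m (int m + b - 1)" using Y by (rule E_cases)
    have k: "int (l + m - 1) = int l + int m - 1" "m + l - 1 = l + m - 1" using lm by auto
    have t: "pcomp \<O> m l m (ksign (int m) (tau \<O> m y)) (ksign (int l) (tau \<O> l x)) =
        ksign (int m + int l) (pcomp \<O> m l m (tau \<O> m y) (tau \<O> l x))"
      using lm by (simp add: pcomp_ksign_left[OF tau_closed[OF y(2)] comps_ksign[OF tau_closed[OF x(2)]]]
          pcomp_ksign_right[OF tau_closed[OF y(2)] tau_closed[OF x(2)]] ksign_ksign)
    have neg: "- sgl n c w = sgl n c (ksign 1 w)" for n c w by (simp add: ksign_def single_uminus)
    show ?thesis
      unfolding x(1) y(1) spc_sgl[OF x(2) y(2) order.refl lm(1)] stau_sgl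
        spc_sgl[OF comps_ksign[OF tau_closed[OF y(2)]] comps_ksign[OF tau_closed[OF x(2)]] lm(2) order.refl]
      unfolding susp_def tau_ksign[OF pcomp_closed[OF order.refl lm(1) x(2) y(2)]] tau_pcomp_first[OF lm x(2) y(2)]
        t single_ksign neg ksign_ksign k add.commute[of b a]
      by (intro arg_cong[of _ _ "sgl _ _"] ksign_cong) (simp add: algebra_simps)
  qed
qed

section \<open>Comparison of the operations\<close>

text \<open>
  For a component of total degree \<open>p\<close> the suspended degree is \<open>p + 1\<close>.
\<close>

abbreviation emb :: "nat \<Rightarrow> int \<Rightarrow> 'a \<Rightarrow> (nat \<times> int \<Rightarrow>\<^sub>0 'a)" where
  "emb l p x \<equiv> sgl l (p + 1) x"

lemma emb_E: "x \<in> hom l p \<Longrightarrow> emb l p x \<in> E l (p + 1)"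
  by (rule E_sgl) auto

lemma E_emb: 
  assumes "U \<in> E l (p + 1)"
  obtains x where "U = emb l p x" "x \<in> hom l p"
  using assms by (auto simp: E_def)

lemma prelie_emb:
  assumes x: "x \<in> hom l p" and y: "y \<in> hom m q"
  shows "S.prelie l (emb l p x) (emb m q y) = emb (l + m - 1) (p + q + 1) (circ_bar \<O> l m (int m + q) x y)"
proof -
  have "S.prelie l (emb l p x) (emb m q y) =
      (\<Sum>i=1..<Suc l. sgl (l + m - 1) (p + 1 + (q + 1)) (susp l m (q + 1) i x y))"
    unfolding S.prelie_def by (intro sum.cong refl spc_sgl[OF x y]) auto
  also have "\<dots> = emb (l + m - 1) (p + q + 1) (circ_bar \<O> l m (int m + q) x y)"
    unfolding single_sum[symmetric] circ_bar_def atLeastLessThanSuc_atLeastAtMost susp_def by simp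
  finally show ?thesis .
qed

lemma br_emb:
  assumes x: "x \<in> hom l p" and y: "y \<in> hom m q"
  shows "S.br l (p + 1) m (q + 1) (emb l p x) (emb m q y) =
    emb (l + m - 1) (p + q + 1) (bracket \<O> l m (int l + p) (int m + q) x y)"
  unfolding S.br_def prelie_emb[OF x y] prelie_emb[OF y x] bracket_def single_ksign
  by (simp add: single_diff add.commute)

lemma mu_emb:
  assumes x: "x \<in> hom l p"
  shows "spc 1 (sgl 2 (- 1) (mu \<O>)) (emb l p x) = sgl (Suc l) p (ksign (p + 1) (pcomp \<O> 2 l 1 (mu \<O>) x))"
    and "spc 2 (sgl 2 (- 1) (mu \<O>)) (emb l p x) = sgl (Suc l) p (ksign (int l + p) (pcomp \<O> 2 l 2 (mu \<O>) x))"
proof -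
  have "ksign (int l - 1 + (int l + p)) z = ksign (p + 1) z" for z :: 'a
    by (rule ksign_cong) simp
  then show "spc 1 (sgl 2 (- 1) (mu \<O>)) (emb l p x) = sgl (Suc l) p (ksign (p + 1) (pcomp \<O> 2 l 1 (mu \<O>) x))"
    using spc_sgl[OF mu_closed x, of 1 "-1" "p + 1"] by (simp add: susp_def)
  show "spc 2 (sgl 2 (- 1) (mu \<O>)) (emb l p x) = sgl (Suc l) p (ksign (int l + p) (pcomp \<O> 2 l 2 (mu \<O>) x))"
    using spc_sgl[OF mu_closed x, of 2 "-1" "p + 1"] by (simp add: susp_def)
qed

lemma mu2_Suc: "mu2 \<O> l m x y = pcomp \<O> (Suc l) m (Suc l) (pcomp \<O> 2 l 1 (mu \<O>) x) y"
  by (simp add: mu2_def Suc_eq_plus1)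

lemma ksign_inject: "ksign n x = ksign n y \<longleftrightarrow> x = (y :: 'x::ab_group_add)"
  by (simp add: ksign_def)

lemma tau_pow_ksign: "x \<in> comps \<O> k p \<Longrightarrow> (tau \<O> k ^^ n) (ksign c x) = ksign c ((tau \<O> k ^^ n) x)"
  by (induction n) (auto simp: tau_ksign[OF tau_pow_closed])

lemma emb_inject: "emb l p x = emb l p y \<longleftrightarrow> x = y"
  by (metis lookup_single_eq)

lemma mu_pcomp_closed: "\<lbrakk>x \<in> comps \<O> l p; i = 1 \<or> i = 2\<rbrakk> \<Longrightarrow> pcomp \<O> 2 l i (mu \<O>) x \<in> comps \<O> (Suc l) p"
  using pcomp_closed[of i 2 "mu \<O>" 0 x l p] mu_closed by auto

lemma prod_emb:
  assumes x: "x \<in> hom l p" and y: "y \<in> hom m q"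
  shows "S.prod l (p + 1) (emb l p x) (emb m q y) = emb (l + m) (p + q) (bullet \<O> l m (int m + q) x y)"
proof -
  have mx: "pcomp \<O> 2 l 1 (mu \<O>) x \<in> comps \<O> (Suc l) (int l + p)"
    by (rule mu_pcomp_closed[OF x]) simp
  have "spc (Suc l) (sgl (Suc l) p (ksign (p + 1) (pcomp \<O> 2 l 1 (mu \<O>) x))) (emb m q y) =
     sgl (Suc l + m - 1) (p + (q + 1)) (susp (Suc l) m (q + 1) (Suc l) (ksign (p + 1) (pcomp \<O> 2 l 1 (mu \<O>) x)) y)"
    by (rule spc_sgl[OF comps_ksign[OF mx] y]) auto
  also have "susp (Suc l) m (q + 1) (Suc l) (ksign (p + 1) (pcomp \<O> 2 l 1 (mu \<O>) x)) y
      = ksign (int l * (int m + q) + (p + 1)) (mu2 \<O> l m x y)"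
    using pcomp_ksign_left[OF mx y, of "Suc l"] by (simp add: susp_def mu2_Suc ksign_ksign)
  finally show ?thesis
    unfolding S.prod_def S.cup_def mu_emb(1)[OF x]
    by (simp add: bullet_def single_ksign ksign_ksign add.assoc) (simp add: ksign_def)
qed

lemma bdry_closed: "x \<in> comps \<O> k p \<Longrightarrow> bdry \<O> k x \<in> comps \<O> (Suc k) p"
proof -
  assume x: "x \<in> comps \<O> k p"
  have "coface \<O> k i x \<in> comps \<O> (Suc k) p" if i: "i \<le> k + 1" for i
  proof -
    have 1: "mu2 \<O> 1 k (ident \<O>) x \<in> comps \<O> (Suc k) p"
      using pcomp_closed[of 2 2 _ 0 x k p] pcomp_closed[OF _ _ mu_closed ident_closed, of 1] x
      by (simp add: mu2_def)
    have 2: "mu2 \<O> k 1 x (ident \<O>) \<in> comps \<O> (Suc k) p"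
      using pcomp_closed[of "Suc k" "Suc k" _ p "ident \<O>" 1 0] mu_pcomp_closed[OF x, of 1] ident_closed
      by (simp add: mu2_Suc flip: Suc_eq_plus1)
    have 3: "pcomp \<O> k 2 i x (mu \<O>) \<in> comps \<O> (Suc k) p" if "1 \<le> i" "i \<le> k"
      using pcomp_closed[OF that x mu_closed] by simp
    show ?thesis using 1 2 3 i by (auto simp: coface_def)
  qed
  then show ?thesis unfolding bdry_def by (intro comps_sum comps_ksign) auto
qed

text \<open>
  The sign depends only on the degree in the operad, which the differential preserves; so it changes neither
  cycles nor boundaries.
\<close>

lemma d_emb:
  assumes x: "x \<in> hom l p"
  shows "S.d l (p + 1) (emb l p x) = sgl (Suc l) p (ksign (int l + p) (bdry \<O> l x))"
proof -
  have 0: "coface \<O> l 0 x = pcomp \<O> 2 l 2 (mu \<O>) x"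
    using ident_right[OF _ _ mu_closed, of 1] by (simp add: coface_def mu2_def)
  have last: "coface \<O> l (Suc l) x = pcomp \<O> 2 l 1 (mu \<O>) x"
    using ident_right[OF _ _ mu_pcomp_closed[OF x, of 1], of "Suc l"] by (simp add: coface_def mu2_Suc)
  have mid: "spc i (emb l p x) (sgl 2 (- 1) (mu \<O>)) = sgl (Suc l) p (ksign (int l - int i) (coface \<O> l i x))"
    if i: "i \<in> {1..<Suc l}" for i
    using spc_sgl[OF x mu_closed, of i "p + 1" "-1"] i by (simp add: susp_def coface_def)
  have "bdry \<O> l x = coface \<O> l 0 x + (\<Sum>i=1..<Suc l. ksign (int i) (coface \<O> l i x))
      + ksign (int (Suc l)) (coface \<O> l (Suc l) x)"
  proof -
    have "{..l + 1} = {0..<Suc (Suc l)}" by auto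
    then show ?thesis
      by (simp add: bdry_def sum.op_ivl_Suc[of _ 0 "Suc l"] sum.atLeast_Suc_lessThan[of 0 "Suc l"])
        (simp add: ksign_def One_nat_def)
  qed
  then have "sgl (Suc l) p (ksign (int l + p) (bdry \<O> l x)) =
      sgl (Suc l) p (ksign (int l + p) (coface \<O> l 0 x)) +
      (\<Sum>i=1..<Suc l. sgl (Suc l) p (ksign (int l + p + int i) (coface \<O> l i x))) +
      sgl (Suc l) p (ksign (int l + p + int (Suc l)) (coface \<O> l (Suc l) x))"
    by (simp only: ksign_add ksign_sum single_add single_sum ksign_ksign)
  moreover have "S.d l (p + 1) (emb l p x) = sgl (Suc l) p (ksign (p + 1) (coface \<O> l (Suc l) x)) +
      sgl (Suc l) p (ksign (int l + p) (coface \<O> l 0 x)) +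
      (\<Sum>i=1..<Suc l. sgl (Suc l) p (ksign (p + 1 + 1) (ksign (int l - int i) (coface \<O> l i x))))"
    unfolding S.d_def mu_emb[OF x] 0 last ksign_sum using mid
    by (simp add: single_ksign)
  moreover have "ksign (int l + p + int (Suc l)) z = ksign (p + 1) z" for z :: 'a
    by (rule ksign_cong) simp
  moreover have "ksign (p + 1 + 1) (ksign (int l - int i) z) = ksign (int l + p + int i) z" for z :: 'a and i
    unfolding ksign_ksign by (rule ksign_cong) simp
  ultimately show ?thesis by (simp only: ac_simps)
qed

lemma B_emb:
  assumes x: "x \<in> hom l p"
  shows "S.B l (p + 1) (emb l p x) = emb (l - 1) (p + 1) (connes \<O> l (int l + p) x)"
proof -
  define y where "y = codegeneracy \<O> (l - 1) (l - 1) (tau \<O> l x)"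
  have tx: "tau \<O> l x \<in> hom l p" by (rule tau_closed[OF x])
  have y: "y \<in> comps \<O> (l - 1) (int l + p)" if "1 \<le> l"
    using pcomp_closed[OF that order.refl tx unt_closed] that by (simp add: y_def codegeneracy_def)
  have t: "spc i (S.rot l i (emb l p x)) (sgl 0 1 (unt \<O>)) =
      sgl (l - 1) (p + 1 + 1) (ksign (int l + (int l - int i) * (int l - 1)) ((tau \<O> (l - 1) ^^ (l - i)) y))"
    if i: "i \<in> {1..<Suc l}" for i
  proof -
    have l: "1 \<le> l" using i by auto
    have "Suc l - i = Suc (l - i)" "l - (l - i) = i" using i by auto
    moreover have E: "stau (emb l p x) \<in> E l (p + 1)" by (rule S.\<sigma>_E[OF emb_E[OF x]])
    ultimately have "spc i (S.rot l i (emb l p x)) (sgl 0 1 (unt \<O>)) =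
        (stau ^^ (l - i)) (spc l (stau (emb l p x)) (sgl 0 1 (unt \<O>)))"
      using S.\<sigma>_pow_pc[OF E S.e_E, of "l - i" l] i by (simp add: S.rot_def funpow_swap1)
    also have "spc l (stau (emb l p x)) (sgl 0 1 (unt \<O>)) = sgl (l - 1) (p + 1 + 1) (ksign (int l) y)"
      unfolding stau_sgl spc_sgl[OF comps_ksign[OF tx] unt_closed l order.refl] susp_def
      using l by (simp add: pcomp_ksign_left[OF tx unt_closed] y_def codegeneracy_def ksign_ksign)
    also have "(stau ^^ (l - i)) \<dots> =
        sgl (l - 1) (p + 1 + 1) (ksign (int (l - i) * int (l - 1)) ((tau \<O> (l - 1) ^^ (l - i)) (ksign (int l) y)))"
      by (rule stau_pow_sgl[OF comps_ksign[OF y[OF l]]])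
    also have "(tau \<O> (l - 1) ^^ (l - i)) (ksign (int l) y) = ksign (int l) ((tau \<O> (l - 1) ^^ (l - i)) y)"
      by (rule tau_pow_ksign[OF y[OF l]])
    finally show ?thesis using i l by (simp add: ksign_ksign add.commute of_nat_diff)
  qed
  have "S.B l (p + 1) (emb l p x) = (\<Sum>i=1..<Suc l. sgl (l - 1) (p + 1 + 1)
      (ksign (p + 1 + 1 + (int l + (int l - int i) * (int l - 1))) ((tau \<O> (l - 1) ^^ (l - i)) y)))"
    unfolding S.B_def S.connes_sum_def ksign_sum
    by (intro sum.cong refl) (simp add: t single_ksign ksign_ksign)
  also have "\<dots> = (\<Sum>i=1..<Suc l. sgl (l - 1) (p + 1 + 1)
      (ksign (int l + p) (ksign (int i * (int l - 1)) ((tau \<O> (l - 1) ^^ (l - i)) y))))"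
  proof (intro sum.cong refl arg_cong[of _ _ "sgl _ _"])
    fix i
    have "even (p + 1 + 1 + (int l + (int l - int i) * (int l - 1)) - (int l + p + int i * (int l - 1)))"
      by (simp add: algebra_simps)
    then show "ksign (p + 1 + 1 + (int l + (int l - int i) * (int l - 1))) ((tau \<O> (l - 1) ^^ (l - i)) y) =
      ksign (int l + p) (ksign (int i * (int l - 1)) ((tau \<O> (l - 1) ^^ (l - i)) y))"
      unfolding ksign_ksign by (rule ksign_cong)
  qed
  also have "\<dots> = emb (l - 1) (p + 1) (connes \<O> l (int l + p) x)"
    unfolding connes_def single_sum[symmetric] ksign_sum[symmetric] y_def atLeastLessThanSuc_atLeastAtMost ..
  finally show ?thesis .
qed

text \<open>
  The cycles of arity \<open>l\<close> and total degree \<open>p\<close>, and below the boundaries.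
\<close>

definition hcyc :: "nat \<Rightarrow> int \<Rightarrow> 'a set" where
  "hcyc l p = {x \<in> hom l p. bdry \<O> l x = 0}"

definition hbnd :: "nat \<Rightarrow> int \<Rightarrow> 'a set" where
  "hbnd l p = {z. z = 0 \<or> (\<exists>j w. l = Suc j \<and> w \<in> comps \<O> j (int l + p) \<and> z = bdry \<O> j w)}"

lemma hcyc_comps: "x \<in> hcyc l p \<Longrightarrow> x \<in> hom l p"
  by (simp add: hcyc_def)

lemma emb_cyc: "emb l p x \<in> S.cyc l (p + 1) \<longleftrightarrow> x \<in> hcyc l p"
proof
  assume "x \<in> hcyc l p"
  then show "emb l p x \<in> S.cyc l (p + 1)"
    by (auto simp: hcyc_def S.cyc_def d_emb emb_E)
next
  assume a: "emb l p x \<in> S.cyc l (p + 1)"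
  then have "emb l p x \<in> E l (p + 1)" by (simp add: S.cyc_def)
  then have x: "x \<in> hom l p" by (rule E_emb) (simp add: emb_inject)
  have "lookup (sgl (Suc l) p (ksign (int l + p) (bdry \<O> l x))) (Suc l, p) = 0"
    using a by (simp add: S.cyc_def d_emb[OF x])
  then show "x \<in> hcyc l p" using x by (simp add: hcyc_def)
qed

lemma bdry_add:
  assumes "x \<in> comps \<O> k p" "y \<in> comps \<O> k p"
  shows "bdry \<O> k (x + y) = bdry \<O> k x + bdry \<O> k y"
proof -
  define q where "q = p - int k"
  have x: "x \<in> hom k q" and y: "y \<in> hom k q" using assms by (simp_all add: q_def)
  have "S.d k (q + 1) (emb k q (x + y)) = S.d k (q + 1) (emb k q x) + S.d k (q + 1) (emb k q y)"
    unfolding single_add by (rule S.d_add[OF emb_E[OF x] emb_E[OF y]])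
  then have "ksign (int k + q) (bdry \<O> k (x + y)) = ksign (int k + q) (bdry \<O> k x + bdry \<O> k y)"
    unfolding d_emb[OF x] d_emb[OF y] d_emb[OF comps_add[OF x y]] single_add[symmetric] ksign_add[symmetric]
    by (metis lookup_single_eq)
  then show ?thesis by (simp only: ksign_inject)
qed

lemma bdry_zero [simp]: "bdry \<O> k 0 = 0"
  using bdry_add[of 0 k 0 0] by simp

lemma bdry_ksign: "x \<in> comps \<O> k p \<Longrightarrow> bdry \<O> k (ksign n x) = ksign n (bdry \<O> k x)"
  using bdry_add[of x k p "- x"] comps_uminus[of x k p]
  by (auto simp: ksign_def eq_neg_iff_add_eq_0 add.commute)

lemma emb_bnd: "emb l p z \<in> S.bnd l (p + 1) \<longleftrightarrow> z \<in> hbnd l p"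
proof
  assume "z \<in> hbnd l p"
  then consider "z = 0" | j w where "l = Suc j" "w \<in> comps \<O> j (int l + p)" "z = bdry \<O> j w"
    by (auto simp: hbnd_def)
  then show "emb l p z \<in> S.bnd l (p + 1)"
  proof cases
    case 2
    have w: "w \<in> comps \<O> j (int j + (p + 1))" using 2 by (simp add: add_ac)
    have "ksign (int j + (p + 1)) (S.d j (p + 1 + 1) (emb j (p + 1) w)) \<in> S.bnd l (p + 1)"
      using 2 by (intro S.bnd_ksign S.bnd_d[OF emb_E[OF w]]) auto
    then show ?thesis using 2
      unfolding d_emb[OF w] single_ksign ksign_ksign by (simp add: ksign_def)
  qed simp
next
  assume "emb l p z \<in> S.bnd l (p + 1)"
  then show "z \<in> hbnd l p"
  proof (cases rule: S.bnd_cases)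
    case 1
    then have "z = 0" by (metis lookup_single_eq lookup_zero)
    then show ?thesis by (simp add: hbnd_def)
  next
    case (2 j w)
    obtain v where v: "w = emb j (p + 1) v" "v \<in> comps \<O> j (int j + (p + 1))" using 2(2) by (rule E_emb)
    have "z = ksign (int j + (p + 1)) (bdry \<O> j v)"
      using 2(3) unfolding v(1) d_emb[OF v(2)] 2(1) by (metis lookup_single_eq)
    then have "z = bdry \<O> j (ksign (int j + (p + 1)) v)" by (simp add: bdry_ksign[OF v(2)])
    then show ?thesis using 2(1) comps_ksign[OF v(2)] by (auto simp: hbnd_def add_ac)
  qed
qed

lemma bdry_bdry:
  assumes x: "x \<in> comps \<O> k p"
  shows "bdry \<O> (Suc k) (bdry \<O> k x) = 0"
proof -
  define q where "q = p - int k"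
  have x: "x \<in> hom k q" using x by (simp add: q_def)
  have y: "ksign (int k + q) (bdry \<O> k x) \<in> comps \<O> (Suc k) (int (Suc k) + (q - 1))"
    using comps_ksign[OF bdry_closed[OF x], of "int k + q"] by (simp add: add_ac)
  have "S.d (Suc k) (q - 1 + 1) (emb (Suc k) (q - 1) (ksign (int k + q) (bdry \<O> k x))) = 0"
    using S.d_d[OF emb_E[OF x]] unfolding d_emb[OF x] by simp
  then have "ksign (int (Suc k) + (q - 1)) (bdry \<O> (Suc k) (ksign (int k + q) (bdry \<O> k x))) = 0"
    unfolding d_emb[OF y] by (metis lookup_single_eq lookup_zero)
  then show ?thesis by (simp add: bdry_ksign[OF bdry_closed[OF x]])
qed

lemma hbnd_hcyc: "hbnd l p \<subseteq> hcyc l p"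
proof
  fix z assume "z \<in> hbnd l p"
  then consider "z = 0" | j w where "l = Suc j" "w \<in> comps \<O> j (int l + p)" "z = bdry \<O> j w"
    by (auto simp: hbnd_def)
  then show "z \<in> hcyc l p"
    by cases (auto simp: hcyc_def bdry_bdry bdry_closed)
qed

lemma hcyc_zero [simp]: "0 \<in> hcyc l p" and hbnd_zero [simp]: "0 \<in> hbnd l p"
  by (simp_all add: hcyc_def hbnd_def)

lemma hbnd_comps: "x \<in> hbnd l p \<Longrightarrow> x \<in> hom l p"
  using hbnd_hcyc hcyc_comps by blast

lemma deg_prod: "p + 1 + (q + 1) - 1 = p + q + (1 :: int)"
  by simp

lemma deg_br: "p + 1 + (q + 1) = p + q + 1 + (1 :: int)"
  by simp

lemma bullet_hcyc: "\<lbrakk>x \<in> hcyc l p; y \<in> hcyc m q\<rbrakk> \<Longrightarrow> bullet \<O> l m (int m + q) x y \<in> hcyc (l + m) (p + q)"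
  using S.prod_cyc[of "emb l p x" l "p + 1" "emb m q y" m "q + 1"]
  unfolding deg_prod emb_cyc by (simp only: prod_emb hcyc_comps emb_cyc)

lemma bullet_hbnd_right:
  "\<lbrakk>x \<in> hcyc l p; y \<in> hbnd m q\<rbrakk> \<Longrightarrow> bullet \<O> l m (int m + q) x y \<in> hbnd (l + m) (p + q)"
  using S.prod_bnd_right[of "emb l p x" l "p + 1" "emb m q y" m "q + 1"]
  unfolding deg_prod emb_cyc emb_bnd by (simp only: prod_emb hcyc_comps hbnd_comps emb_bnd)

lemma bullet_hbnd_left:
  "\<lbrakk>x \<in> hbnd l p; y \<in> hcyc m q\<rbrakk> \<Longrightarrow> bullet \<O> l m (int m + q) x y \<in> hbnd (l + m) (p + q)"
  using S.prod_bnd_left[of "emb l p x" l "p + 1" "emb m q y" m "q + 1"]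
  unfolding deg_prod emb_cyc emb_bnd by (simp only: prod_emb hcyc_comps hbnd_comps emb_bnd)

lemma bullet_closed:
  assumes x: "x \<in> hom l p" and y: "y \<in> hom m q"
  shows "bullet \<O> l m (int m + q) x y \<in> comps \<O> (l + m) (int (l + m) + (p + q))"
proof -
  have "S.prod l (p + 1) (emb l p x) (emb m q y) \<in> E (l + m) (p + q + 1)"
    unfolding S.prod_def deg_prod[symmetric] by (rule S.E_ksign[OF S.cup_E[OF emb_E[OF x] emb_E[OF y]]])
  then show ?thesis unfolding prod_emb[OF x y] by (rule E_emb) (simp only: emb_inject)
qed

lemma bracket_closed:
  assumes x: "x \<in> hom l p" and y: "y \<in> hom m q"
  shows "bracket \<O> l m (int l + p) (int m + q) x y \<in> comps \<O> (l + m - 1) (int (l + m - 1) + (p + q + 1))"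
proof -
  have "S.br l (p + 1) m (q + 1) (emb l p x) (emb m q y) \<in> E (l + m - 1) (p + q + 1 + 1)"
    unfolding deg_br[symmetric] by (rule S.br_E[OF emb_E[OF x] emb_E[OF y]])
  then show ?thesis unfolding br_emb[OF x y] by (rule E_emb) (simp only: emb_inject)
qed

lemma connes_closed:
  assumes x: "x \<in> hom l p"
  shows "connes \<O> l (int l + p) x \<in> comps \<O> (l - 1) (int (l - 1) + (p + 1))"
proof -
  have "S.B l (p + 1) (emb l p x) \<in> E (l - 1) (p + 1 + 1)"
    by (rule S.B_E[OF emb_E[OF x]])
  then show ?thesis unfolding B_emb[OF x] by (rule E_emb) (simp only: emb_inject)
qed

lemma bracket_hcyc:
  "\<lbrakk>x \<in> hcyc l p; y \<in> hcyc m q\<rbrakk> \<Longrightarrow> bracket \<O> l m (int l + p) (int m + q) x y \<in> hcyc (l + m - 1) (p + q + 1)"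
  using S.br_cyc[of "emb l p x" l "p + 1" "emb m q y" m "q + 1"]
  unfolding deg_br emb_cyc by (simp only: br_emb hcyc_comps emb_cyc)

lemma bracket_hbnd_right:
  "\<lbrakk>x \<in> hcyc l p; y \<in> hbnd m q\<rbrakk> \<Longrightarrow> bracket \<O> l m (int l + p) (int m + q) x y \<in> hbnd (l + m - 1) (p + q + 1)"
  using S.br_bnd_right[of "emb l p x" l "p + 1" "emb m q y" m "q + 1"]
  unfolding deg_br emb_cyc emb_bnd by (simp only: br_emb hcyc_comps hbnd_comps emb_bnd)

lemma bracket_hbnd_left:
  "\<lbrakk>x \<in> hbnd l p; y \<in> hcyc m q\<rbrakk> \<Longrightarrow> bracket \<O> l m (int l + p) (int m + q) x y \<in> hbnd (l + m - 1) (p + q + 1)"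
  using S.br_bnd_left[of "emb l p x" l "p + 1" "emb m q y" m "q + 1"]
  unfolding deg_br emb_cyc emb_bnd by (simp only: br_emb hcyc_comps hbnd_comps emb_bnd)

lemma connes_hcyc: "x \<in> hcyc l p \<Longrightarrow> connes \<O> l (int l + p) x \<in> hcyc (l - 1) (p + 1)"
  using S.B_cyc[of "emb l p x" l "p + 1"]
  unfolding emb_cyc by (simp only: B_emb hcyc_comps emb_cyc)

lemma connes_hbnd: "x \<in> hbnd l p \<Longrightarrow> connes \<O> l (int l + p) x \<in> hbnd (l - 1) (p + 1)"
  using S.B_bnd[of "emb l p x" l "p + 1"]
  unfolding emb_bnd by (simp only: B_emb hbnd_comps emb_bnd)

lemma bullet_add_left:
  assumes x: "x \<in> hom l p" and x': "x' \<in> hom l p" and y: "y \<in> hom m q"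
  shows "bullet \<O> l m (int m + q) (x + x') y = bullet \<O> l m (int m + q) x y + bullet \<O> l m (int m + q) x' y"
proof -
  have "S.prod l (p + 1) (emb l p (x + x')) (emb m q y) =
      S.prod l (p + 1) (emb l p x) (emb m q y) + S.prod l (p + 1) (emb l p x') (emb m q y)"
    unfolding S.prod_def single_add S.cup_add_left[OF emb_E[OF x] emb_E[OF x'] emb_E[OF y]] ksign_add ..
  then show ?thesis
    unfolding prod_emb[OF comps_add[OF x x'] y] prod_emb[OF x y] prod_emb[OF x' y] single_add[symmetric] emb_inject .
qed

lemma bullet_add_right:
  assumes x: "x \<in> hom l p" and y: "y \<in> hom m q" and y': "y' \<in> hom m q"
  shows "bullet \<O> l m (int m + q) x (y + y') = bullet \<O> l m (int m + q) x y + bullet \<O> l m (int m + q) x y'"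
proof -
  have "S.prod l (p + 1) (emb l p x) (emb m q (y + y')) =
      S.prod l (p + 1) (emb l p x) (emb m q y) + S.prod l (p + 1) (emb l p x) (emb m q y')"
    unfolding S.prod_def single_add S.cup_add_right[OF emb_E[OF x] emb_E[OF y] emb_E[OF y']] ksign_add ..
  then show ?thesis
    unfolding prod_emb[OF x comps_add[OF y y']] prod_emb[OF x y] prod_emb[OF x y'] single_add[symmetric] emb_inject .
qed

lemma circ_bar_add_left:
  assumes x: "x \<in> hom l p" and x': "x' \<in> hom l p" and y: "y \<in> hom m q"
  shows "circ_bar \<O> l m (int m + q) (x + x') y = circ_bar \<O> l m (int m + q) x y + circ_bar \<O> l m (int m + q) x' y"
  unfolding circ_bar_def sum.distrib[symmetric]
  by (intro sum.cong refl) (simp add: pcomp_add_left[OF _ _ x x' y] ksign_add)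

lemma circ_bar_add_right:
  assumes x: "x \<in> hom l p" and y: "y \<in> hom m q" and y': "y' \<in> hom m q"
  shows "circ_bar \<O> l m (int m + q) x (y + y') = circ_bar \<O> l m (int m + q) x y + circ_bar \<O> l m (int m + q) x y'"
  unfolding circ_bar_def sum.distrib[symmetric]
  by (intro sum.cong refl) (simp add: pcomp_add_right[OF _ _ x y y'] ksign_add)

lemma bracket_add_left:
  assumes x: "x \<in> hom l p" and x': "x' \<in> hom l p" and y: "y \<in> hom m q"
  shows "bracket \<O> l m (int l + p) (int m + q) (x + x') y =
    bracket \<O> l m (int l + p) (int m + q) x y + bracket \<O> l m (int l + p) (int m + q) x' y"
  unfolding bracket_def circ_bar_add_left[OF x x' y] circ_bar_add_right[OF y x x'] ksign_add by simp

lemma bracket_add_right: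
  assumes x: "x \<in> hom l p" and y: "y \<in> hom m q" and y': "y' \<in> hom m q"
  shows "bracket \<O> l m (int l + p) (int m + q) x (y + y') =
    bracket \<O> l m (int l + p) (int m + q) x y + bracket \<O> l m (int l + p) (int m + q) x y'"
  unfolding bracket_def circ_bar_add_left[OF y y' x] circ_bar_add_right[OF x y y'] ksign_add by simp

lemma connes_add:
  assumes x: "x \<in> hom l p" and y: "y \<in> hom l p"
  shows "connes \<O> l (int l + p) (x + y) = connes \<O> l (int l + p) x + connes \<O> l (int l + p) y"
proof -
  have "S.B l (p + 1) (emb l p (x + y)) = S.B l (p + 1) (emb l p x) + S.B l (p + 1) (emb l p y)"
    unfolding S.B_def single_add S.connes_sum_add[OF emb_E[OF x] emb_E[OF y]] ksign_add ..
  then show ?thesis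
    unfolding B_emb[OF comps_add[OF x y]] B_emb[OF x] B_emb[OF y] single_add[symmetric] emb_inject .
qed

lemma scl_ksign: "scl \<O> a (ksign n x) = ksign n (scl \<O> a x)"
  by (simp add: ksign_def scale_minus_right)

lemma mu2_scl_left:
  assumes x: "x \<in> comps \<O> l p" and y: "y \<in> comps \<O> m q"
  shows "mu2 \<O> l m (scl \<O> a x) y = scl \<O> a (mu2 \<O> l m x y)"
  unfolding mu2_Suc using pcomp_scl_right[OF _ _ mu_closed x, of 1] pcomp_scl_left[OF _ _ mu_pcomp_closed[OF x, of 1] y, of "Suc l"]
  by simp

lemma mu2_scl_right:
  assumes x: "x \<in> comps \<O> l p" and y: "y \<in> comps \<O> m q"
  shows "mu2 \<O> l m x (scl \<O> a y) = scl \<O> a (mu2 \<O> l m x y)"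
  unfolding mu2_Suc using pcomp_scl_right[OF _ _ mu_pcomp_closed[OF x, of 1] y, of "Suc l"] by simp

lemma bullet_scl:
  assumes x: "x \<in> comps \<O> l p" and y: "y \<in> comps \<O> m q"
  shows "bullet \<O> l m q (scl \<O> a x) y = scl \<O> a (bullet \<O> l m q x y)"
    and "bullet \<O> l m q x (scl \<O> a y) = scl \<O> a (bullet \<O> l m q x y)"
  unfolding bullet_def mu2_scl_left[OF x y] mu2_scl_right[OF x y] scl_ksign by (rule refl)+

lemma circ_bar_scl:
  assumes x: "x \<in> comps \<O> l p" and y: "y \<in> comps \<O> m q"
  shows "circ_bar \<O> l m q (scl \<O> a x) y = scl \<O> a (circ_bar \<O> l m q x y)"
    and "circ_bar \<O> l m q x (scl \<O> a y) = scl \<O> a (circ_bar \<O> l m q x y)"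
  unfolding circ_bar_def scale_sum_right
  by (intro sum.cong refl; simp add: pcomp_scl_left[OF _ _ x y] pcomp_scl_right[OF _ _ x y] scl_ksign)+

lemma bracket_scl:
  assumes x: "x \<in> comps \<O> l p" and y: "y \<in> comps \<O> m q"
  shows "bracket \<O> l m p q (scl \<O> a x) y = scl \<O> a (bracket \<O> l m p q x y)"
    and "bracket \<O> l m p q x (scl \<O> a y) = scl \<O> a (bracket \<O> l m p q x y)"
  unfolding bracket_def circ_bar_scl[OF x y] circ_bar_scl[OF y x] scl_ksign[symmetric] scale_right_diff_distrib
  by (rule refl)+

lemma bdry_scl:
  assumes x: "x \<in> comps \<O> k p"
  shows "bdry \<O> k (scl \<O> a x) = scl \<O> a (bdry \<O> k x)"
  unfolding bdry_def scale_sum_right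
proof (intro sum.cong refl)
  fix i
  assume "i \<in> {..k + 1}"
  then show "ksign (int i) (coface \<O> k i (scl \<O> a x)) = scl \<O> a (ksign (int i) (coface \<O> k i x))"
    using pcomp_scl_left[OF _ _ x mu_closed, of i]
    by (simp add: coface_def mu2_scl_left[OF x ident_closed] mu2_scl_right[OF ident_closed x] scl_ksign)
qed

lemma connes_scl:
  assumes x: "x \<in> comps \<O> k p"
  shows "connes \<O> k q (scl \<O> a x) = scl \<O> a (connes \<O> k q x)"
proof -
  have tx: "tau \<O> k x \<in> comps \<O> k p" by (rule tau_closed[OF x])
  have pow: "(tau \<O> j ^^ n) (scl \<O> a y) = scl \<O> a ((tau \<O> j ^^ n) y)" if "y \<in> comps \<O> j p" for j n y
    using that by (induction n) (auto simp: tau_scl[OF tau_pow_closed])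
  have "codegeneracy \<O> (k - 1) (k - 1) (tau \<O> k (scl \<O> a x)) = scl \<O> a (codegeneracy \<O> (k - 1) (k - 1) (tau \<O> k x))"
    and "codegeneracy \<O> (k - 1) (k - 1) (tau \<O> k x) \<in> comps \<O> (k - 1) p" if "1 \<le> k"
    using that pcomp_scl_left[OF that order.refl tx unt_closed] pcomp_closed[OF that order.refl tx unt_closed]
    by (simp_all add: codegeneracy_def tau_scl[OF x])
  then show ?thesis
    unfolding connes_def scl_ksign scale_sum_right
    by (intro arg_cong[of _ _ "ksign q"] sum.cong refl) (simp add: pow scl_ksign)
qed

lemma normalize_hcyc:
  assumes x: "x \<in> hcyc l p"
  obtains x' where "x' \<in> hcyc l p" "x' - x \<in> hbnd l p" "\<And>i. i < l \<Longrightarrow> codegeneracy \<O> (l - 1) i x' = 0"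
proof -
  have "emb l p x \<in> S.cyc l (p + 1)" by (simp add: emb_cyc x)
  then have "emb l p x \<in> E l (p + 1)" "S.d l (p + 1) (emb l p x) = 0" by (auto simp: S.cyc_def)
  then obtain U where U: "U \<in> E l (p + 1)" "S.d l (p + 1) U = 0" "U - emb l p x \<in> S.bnd l (p + 1)"
    "\<And>i. 1 \<le> i \<Longrightarrow> i \<le> l \<Longrightarrow> spc i U (sgl 0 1 (unt \<O>)) = 0"
    by (rule S.normalize_cycle) blast
  obtain x' where x': "U = emb l p x'" "x' \<in> hom l p" using U(1) by (rule E_emb)
  show ?thesis
  proof
    show "x' \<in> hcyc l p" using U(1,2) unfolding x'(1) emb_cyc[symmetric] by (rule S.cycI)
    show "x' - x \<in> hbnd l p" using U(3) unfolding x'(1) single_diff[symmetric] emb_bnd .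
    fix i assume i: "i < l"
    then have "sgl (l + 0 - 1) (p + 1 + 1) (susp l 0 1 (Suc i) x' (unt \<O>)) = 0"
      using U(4)[of "Suc i"] spc_sgl[OF x'(2) unt_closed, of "Suc i" "p + 1" 1] unfolding x'(1) by simp
    then have "susp l 0 1 (Suc i) x' (unt \<O>) = 0" by (metis lookup_single_eq lookup_zero)
    then show "codegeneracy \<O> (l - 1) i x' = 0" using i by (simp add: susp_def codegeneracy_def flip: Suc_eq_plus1)
  qed
qed

lemma connes_connes:
  assumes x: "x \<in> hom l p" and nrm: "\<And>i. i < l \<Longrightarrow> codegeneracy \<O> (l - 1) i x = 0"
  shows "connes \<O> (l - 1) (int (l - 1) + (p + 1)) (connes \<O> l (int l + p) x) = 0"
proof -
  have "spc i (emb l p x) (sgl 0 1 (unt \<O>)) = 0" if "1 \<le> i" "i \<le> l" for i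
  proof -
    have "Suc (i - 1) = i" "Suc (l - 1) = l" using that by auto
    then have "pcomp \<O> l 0 i x (unt \<O>) = 0"
      using nrm[of "i - 1"] that by (simp add: codegeneracy_def Suc_eq_plus1)
    then show ?thesis using spc_sgl[OF x unt_closed that] by (simp add: susp_def)
  qed
  then have "S.B (l - 1) (p + 1 + 1) (S.B l (p + 1) (emb l p x)) = 0"
    by (rule S.B_B[OF emb_E[OF x]])
  then show ?thesis
    unfolding B_emb[OF x] B_emb[OF connes_closed[OF x]] by (metis lookup_single_eq lookup_zero)
qed

end

section \<open>The total complex\<close>

text \<open>
  This forgets the degrees. Being additive on all families, it carries an identity of suspended operations to
  one of chains also when truncated subtraction puts its terms into different arities; such terms are zero.
\<close>

definition forget :: "(nat \<times> int \<Rightarrow>\<^sub>0 'a::ab_group_add) \<Rightarrow> (nat \<Rightarrow>\<^sub>0 'a)" where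
  "forget U = (\<Sum>u \<in> keys U. single (fst u) (lookup U u))"

lemma forget_add: "forget (U + V) = forget U + forget V"
  unfolding forget_def by (rule setsum_keys_plus_distrib) (simp_all add: single_add)

lemma forget_single [simp]: "forget (single (l, a) x) = single l x"
  by (cases "x = 0") (auto simp: forget_def)

lemma forget_zero [simp]: "forget 0 = 0"
  by (simp add: forget_def)

lemma forget_uminus: "forget (- U) = - forget U"
  using forget_add[of U "- U"] by (simp add: eq_neg_iff_add_eq_0 add.commute)

lemma forget_diff: "forget (U - V) = forget U - forget V"
  using forget_add[of U "- V"] by (simp add: forget_uminus)

lemma forget_ksign: "forget (ksign n U) = ksign n (forget U)"
  by (simp add: ksign_def forget_uminus)

text \<open>
  The linear and, below, the bilinear extension of operations on components to chains.
\<close>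

definition ext1 :: "(nat \<Rightarrow> nat) \<Rightarrow> (nat \<Rightarrow> 'a \<Rightarrow> 'a) \<Rightarrow> (nat \<Rightarrow>\<^sub>0 'a::ab_group_add) \<Rightarrow> (nat \<Rightarrow>\<^sub>0 'a)" where
  "ext1 g f x = (\<Sum>l \<in> keys x. single (g l) (f l (lookup x l)))"

definition ext2 :: "(nat \<Rightarrow> nat \<Rightarrow> nat) \<Rightarrow> (nat \<Rightarrow> nat \<Rightarrow> 'a \<Rightarrow> 'a \<Rightarrow> 'a) \<Rightarrow>
    (nat \<Rightarrow>\<^sub>0 'a::ab_group_add) \<Rightarrow> (nat \<Rightarrow>\<^sub>0 'a) \<Rightarrow> (nat \<Rightarrow>\<^sub>0 'a)" where
  "ext2 g f x y = (\<Sum>l \<in> keys x. \<Sum>m \<in> keys y.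
     single (g l m) (f l m (lookup x l) (lookup y m)))"

lemma ext1_superset:
  assumes "finite K" "keys x \<subseteq> K" "\<And>l. f l 0 = 0"
  shows "ext1 g f x = (\<Sum>l\<in>K. single (g l) (f l (lookup x l)))"
  unfolding ext1_def using assms
  by (intro sum.mono_neutral_left) (auto simp: in_keys_iff)

lemma ext1_add:
  assumes add: "\<And>l u v. \<lbrakk>u \<in> C l; v \<in> C l\<rbrakk> \<Longrightarrow> f l (u + v) = f l u + f l v" and 0: "\<And>l. 0 \<in> C l"
    and x: "\<And>l. lookup x l \<in> C l" and y: "\<And>l. lookup y l \<in> C l"
  shows "ext1 g f (x + y) = ext1 g f x + ext1 g f y"
proof -
  have f0: "f l 0 = 0" for l using add[OF 0 0, of l] by simp
  define K where "K = keys x \<union> keys y"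
  have K: "finite K" "keys x \<subseteq> K" "keys y \<subseteq> K" "keys (x + y) \<subseteq> K"
    using keys_add[of x y] by (auto simp: K_def)
  show ?thesis
    unfolding ext1_superset[OF K(1,2), of f, OF f0] ext1_superset[OF K(1,3), of f, OF f0]
      ext1_superset[OF K(1,4), of f, OF f0] sum.distrib[symmetric]
    by (intro sum.cong refl) (simp add: lookup_add add x y single_add)
qed

lemma ext1_single: "f l 0 = 0 \<Longrightarrow> ext1 g f (single l x) = single (g l) (f l x)"
  by (cases "x = 0") (auto simp: ext1_def)

lemma ext1_zero [simp]: "ext1 g f 0 = 0"
  by (simp add: ext1_def)

lemma ext2_zero_left [simp]: "ext2 g f 0 y = 0" and ext2_zero_right [simp]: "ext2 g f x 0 = 0"
  by (simp_all add: ext2_def)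

lemma ext2_swap: "ext2 g f x y = ext2 (\<lambda>m l. g l m) (\<lambda>m l v u. f l m u v) y x"
  unfolding ext2_def by (rule sum.swap)

lemma ext2_superset:
  assumes "finite K" "keys x \<subseteq> K" "\<And>l m. f l m 0 (lookup y m) = 0"
  shows "ext2 g f x y = (\<Sum>l\<in>K. \<Sum>m \<in> keys y.
     single (g l m) (f l m (lookup x l) (lookup y m)))"
  unfolding ext2_def using assms
  by (intro sum.mono_neutral_left) (auto simp: in_keys_iff)

lemma ext2_add_left:
  assumes add: "\<And>l m u u' v. \<lbrakk>u \<in> C l; u' \<in> C l; v \<in> D m\<rbrakk> \<Longrightarrow> f l m (u + u') v = f l m u v + f l m u' v"
    and 0: "\<And>l. 0 \<in> C l"
    and x: "\<And>l. lookup x l \<in> C l" and x': "\<And>l. lookup x' l \<in> C l"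
    and y: "\<And>m. lookup y m \<in> D m"
  shows "ext2 g f (x + x') y = ext2 g f x y + ext2 g f x' y"
proof -
  have f0: "f l m 0 (lookup y m) = 0" for l m using add[OF 0 0 y, of l m] by simp
  define K where "K = keys x \<union> keys x'"
  have K: "finite K" "keys x \<subseteq> K" "keys x' \<subseteq> K" "keys (x + x') \<subseteq> K"
    using keys_add[of x x'] by (auto simp: K_def)
  show ?thesis
    unfolding ext2_superset[OF K(1,2), of f, OF f0] ext2_superset[OF K(1,3), of f, OF f0]
      ext2_superset[OF K(1,4), of f, OF f0] sum.distrib[symmetric]
    by (intro sum.cong refl) (simp add: lookup_add add[OF x x' y] single_add)
qed

lemma ext2_add_right:
  assumes add: "\<And>l m u v v'. \<lbrakk>u \<in> C l; v \<in> D m; v' \<in> D m\<rbrakk> \<Longrightarrow> f l m u (v + v') = f l m u v + f l m u v'"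
    and 0: "\<And>m. 0 \<in> D m"
    and x: "\<And>l. lookup x l \<in> C l"
    and y: "\<And>m. lookup y m \<in> D m" and y': "\<And>m. lookup y' m \<in> D m"
  shows "ext2 g f x (y + y') = ext2 g f x y + ext2 g f x y'"
  unfolding ext2_swap[of g f x]
  by (rule ext2_add_left[where C = D and D = C]) (simp_all add: add 0 x y y')

lemma ext2_single:
  "\<lbrakk>f l m 0 y = 0; f l m x 0 = 0\<rbrakk> \<Longrightarrow>
    ext2 g f (single l x) (single m y) = single (g l m) (f l m x y)"
  by (cases "x = 0"; cases "y = 0") (auto simp: ext2_def)

lemma sum_single_keys: "(\<Sum>l \<in> keys x. single l (lookup x l)) = (x :: 'k \<Rightarrow>\<^sub>0 'a::comm_monoid_add)"
proof (rule poly_mapping_eqI)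
  fix k
  show "lookup (\<Sum>l \<in> keys x. single l (lookup x l)) k = lookup x k"
    by (simp add: lookup_sum lookup_single when_def sum.delta in_keys_iff)
qed

lemma tot_bullet_ext2: "tot_bullet \<O> p q = ext2 (+) (\<lambda>l m. bullet \<O> l m (int m + q))"
  by (intro ext) (simp add: tot_bullet_def ext2_def)

lemma tot_bracket_ext2: "tot_bracket \<O> p q = ext2 (\<lambda>l m. l + m - 1) (\<lambda>l m. bracket \<O> l m (int l + p) (int m + q))"
  by (intro ext) (simp add: tot_bracket_def ext2_def)

lemma tot_connes_ext1: "tot_connes \<O> n = ext1 (\<lambda>k. k - 1) (\<lambda>k. connes \<O> k (int k + n))"
  by (intro ext) (simp add: tot_connes_def ext1_def)

lemma diff_ext1: "diff \<O> = ext1 Suc (bdry \<O>)"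
  by (intro ext) (simp add: diff_def ext1_def Suc_eq_plus1)

context cyclic_multiplicative_operad
begin

lemma chains_lookup: "x \<in> chains \<O> n \<Longrightarrow> lookup x l \<in> hom l n"
  by (simp add: chains_def)

lemma chains_zero [simp]: "0 \<in> chains \<O> n"
  by (simp add: chains_def)

lemma chains_add: "\<lbrakk>x \<in> chains \<O> n; y \<in> chains \<O> n\<rbrakk> \<Longrightarrow> x + y \<in> chains \<O> n"
  by (simp add: chains_def lookup_add comps_add)

lemma chains_uminus: "x \<in> chains \<O> n \<Longrightarrow> - x \<in> chains \<O> n"
  by (simp add: chains_def comps_uminus)

lemma chains_single: "x \<in> hom l n \<Longrightarrow> single l x \<in> chains \<O> n"
  by (auto simp: chains_def lookup_single when_def)

lemma chains_sum: "(\<And>i. i \<in> A \<Longrightarrow> f i \<in> chains \<O> n) \<Longrightarrow> (\<Sum>i\<in>A. f i) \<in> chains \<O> n"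
  by (induction A rule: infinite_finite_induct) (auto intro: chains_add)

lemma diff_add: "\<lbrakk>x \<in> chains \<O> n; y \<in> chains \<O> n\<rbrakk> \<Longrightarrow> diff \<O> (x + y) = diff \<O> x + diff \<O> y"
  unfolding diff_ext1
  by (rule ext1_add[where C = "\<lambda>l. hom l n"]) (auto simp: bdry_add chains_lookup)

lemma diff_single: "diff \<O> (single l x) = single (Suc l) (bdry \<O> l x)"
  unfolding diff_ext1 by (rule ext1_single) simp

lemma diff_zero [simp]: "diff \<O> 0 = 0"
  by (simp add: diff_ext1)

lemma diff_uminus: "x \<in> chains \<O> n \<Longrightarrow> diff \<O> (- x) = - diff \<O> x"
  using diff_add[of x n "- x"] chains_uminus[of x n] by (simp add: eq_neg_iff_add_eq_0 add.commute)

lemma lookup_diff: "lookup (diff \<O> x) (Suc l) = bdry \<O> l (lookup x l)"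
proof -
  have "lookup (diff \<O> x) (Suc l) =
      (\<Sum>k\<in>keys x. if k = l then bdry \<O> k (lookup x k) else 0)"
    by (simp add: diff_ext1 ext1_def lookup_sum lookup_single when_def)
  also have "\<dots> = bdry \<O> l (lookup x l)"
    by (simp add: sum.delta' in_keys_iff)
  finally show ?thesis .
qed

lemma cycles_lookup: "x \<in> cycles \<O> n \<Longrightarrow> lookup x l \<in> hcyc l n"
  using lookup_diff[of x l] by (simp add: cycles_def hcyc_def chains_lookup)

lemma cycles_zero [simp]: "0 \<in> cycles \<O> n"
  by (simp add: cycles_def)

lemma cycles_chains: "x \<in> cycles \<O> n \<Longrightarrow> x \<in> chains \<O> n"
  by (simp add: cycles_def)

lemma cycles_add: "\<lbrakk>x \<in> cycles \<O> n; y \<in> cycles \<O> n\<rbrakk> \<Longrightarrow> x + y \<in> cycles \<O> n"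
  by (auto simp: cycles_def chains_add diff_add)

lemma cycles_uminus: "x \<in> cycles \<O> n \<Longrightarrow> - x \<in> cycles \<O> n"
  by (auto simp: cycles_def chains_uminus diff_uminus)

lemma cycles_ksign: "x \<in> cycles \<O> n \<Longrightarrow> ksign k x \<in> cycles \<O> n"
  by (simp add: ksign_def cycles_uminus)

lemma cycles_single: "x \<in> hcyc l n \<Longrightarrow> single l x \<in> cycles \<O> n"
  by (simp add: cycles_def hcyc_def chains_single diff_single)

text \<open>
  A chain is the sum of its components, and the components of a cycle are cycles because the differential maps
  components of different arities to components of different arities.
\<close>

lemma cycles_induct [consumes 1, case_names zero add single]:
  assumes x: "x \<in> cycles \<O> n"
    and z: "P 0"
    and a: "\<And>x y. \<lbrakk>x \<in> cycles \<O> n; y \<in> cycles \<O> n; P x; P y\<rbrakk> \<Longrightarrow> P (x + y)"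
    and s: "\<And>l w. w \<in> hcyc l n \<Longrightarrow> P (single l w)"
  shows "P x"
proof -
  have "P (\<Sum>l\<in>K. single l (lookup x l)) \<and>
      (\<Sum>l\<in>K. single l (lookup x l)) \<in> cycles \<O> n" if "finite K" for K
    using that by (induction K) (auto intro!: z a s cycles_lookup[OF x] cycles_add cycles_single)
  from this[OF finite_keys[of x]] show ?thesis by (simp add: sum_single_keys)
qed

lemma boundaries_zero [simp]: "0 \<in> boundaries \<O> n"
  unfolding boundaries_def by (rule image_eqI[of _ _ 0]) simp_all

lemma boundaries_add: "\<lbrakk>x \<in> boundaries \<O> n; y \<in> boundaries \<O> n\<rbrakk> \<Longrightarrow> x + y \<in> boundaries \<O> n"
proof -
  assume "x \<in> boundaries \<O> n" "y \<in> boundaries \<O> n"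
  then obtain u v where "u \<in> chains \<O> (n + 1)" "x = diff \<O> u" "v \<in> chains \<O> (n + 1)" "y = diff \<O> v"
    unfolding boundaries_def by blast
  then have "x + y = diff \<O> (u + v)" "u + v \<in> chains \<O> (n + 1)"
    by (simp_all add: diff_add chains_add)
  then show ?thesis unfolding boundaries_def by (rule image_eqI)
qed

lemma boundaries_uminus: "x \<in> boundaries \<O> n \<Longrightarrow> - x \<in> boundaries \<O> n"
proof -
  assume "x \<in> boundaries \<O> n"
  then obtain u where "u \<in> chains \<O> (n + 1)" "x = diff \<O> u"
    unfolding boundaries_def by blast
  then have "- x = diff \<O> (- u)" "- u \<in> chains \<O> (n + 1)"
    by (simp_all add: diff_uminus chains_uminus)
  then show ?thesis unfolding boundaries_def by (rule image_eqI)
qed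

lemma boundaries_diff: "\<lbrakk>x \<in> boundaries \<O> n; y \<in> boundaries \<O> n\<rbrakk> \<Longrightarrow> x - y \<in> boundaries \<O> n"
  using boundaries_add[OF _ boundaries_uminus] by (metis diff_conv_add_uminus)

lemma boundaries_single: "z \<in> hbnd l n \<Longrightarrow> single l z \<in> boundaries \<O> n"
proof -
  assume "z \<in> hbnd l n"
  then consider "z = 0" | j w where "l = Suc j" "w \<in> comps \<O> j (int l + n)" "z = bdry \<O> j w"
    by (auto simp: hbnd_def)
  then show ?thesis
  proof cases
    case 2
    then show ?thesis
      unfolding boundaries_def
      by (intro image_eqI[of _ _ "single j w"] chains_single) (simp_all add: diff_single add_ac)
  qed simp
qed

lemma boundaries_induct [consumes 1, case_names zero add single]:
  assumes x: "x \<in> boundaries \<O> n"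
    and z: "P 0"
    and a: "\<And>x y. \<lbrakk>x \<in> boundaries \<O> n; y \<in> boundaries \<O> n; P x; P y\<rbrakk> \<Longrightarrow> P (x + y)"
    and s: "\<And>l w. w \<in> hbnd l n \<Longrightarrow> P (single l w)"
  shows "P x"
proof -
  obtain y where y: "y \<in> chains \<O> (n + 1)" "x = diff \<O> y" using x by (auto simp: boundaries_def)
  have b: "bdry \<O> l (lookup y l) \<in> hbnd (Suc l) n" for l
    using chains_lookup[OF y(1), of l] by (auto simp: hbnd_def add_ac)
  have "P (\<Sum>l\<in>K. single (Suc l) (bdry \<O> l (lookup y l))) \<and>
      (\<Sum>l\<in>K. single (Suc l) (bdry \<O> l (lookup y l))) \<in> boundaries \<O> n" if "finite K" for K
    using that by (induction K) (auto intro!: z a s b boundaries_add boundaries_single)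
  from this[OF finite_keys[of y]] show ?thesis by (simp add: y(2) diff_ext1 ext1_def)
qed

lemma boundaries_cycles: "x \<in> boundaries \<O> n \<Longrightarrow> x \<in> cycles \<O> n"
proof (induction rule: boundaries_induct)
  case (single l w)
  then show ?case using hbnd_hcyc cycles_single by blast
qed (auto intro: cycles_add)

lemma forget_bnd:
  assumes "U \<in> S.bnd l (n + 1)"
  shows "forget U \<in> boundaries \<O> n"
proof -
  have "U \<in> E l (n + 1)"
    using assms
  proof (cases rule: S.bnd_cases)
    case (2 j w)
    then show ?thesis using S.d_E[OF 2(2)] by (simp add: add.commute)
  qed simp
  then obtain z where "U = emb l n z" by (rule E_emb)
  then show ?thesis using assms by (simp add: emb_bnd boundaries_single)
qed

lemma tot_bullet_add_left:
  "\<lbrakk>x \<in> chains \<O> p; x' \<in> chains \<O> p; y \<in> chains \<O> q\<rbrakk> \<Longrightarrow>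
    tot_bullet \<O> p q (x + x') y = tot_bullet \<O> p q x y + tot_bullet \<O> p q x' y"
  unfolding tot_bullet_ext2
  by (rule ext2_add_left[where C = "\<lambda>l. hom l p" and D = "\<lambda>m. hom m q"])
    (auto intro: bullet_add_left chains_lookup)

lemma tot_bullet_add_right:
  "\<lbrakk>x \<in> chains \<O> p; y \<in> chains \<O> q; y' \<in> chains \<O> q\<rbrakk> \<Longrightarrow>
    tot_bullet \<O> p q x (y + y') = tot_bullet \<O> p q x y + tot_bullet \<O> p q x y'"
  unfolding tot_bullet_ext2
  by (rule ext2_add_right[where C = "\<lambda>l. hom l p" and D = "\<lambda>m. hom m q"])
    (auto intro: bullet_add_right chains_lookup)

lemma tot_bracket_add_left:
  "\<lbrakk>x \<in> chains \<O> p; x' \<in> chains \<O> p; y \<in> chains \<O> q\<rbrakk> \<Longrightarrow>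
    tot_bracket \<O> p q (x + x') y = tot_bracket \<O> p q x y + tot_bracket \<O> p q x' y"
  unfolding tot_bracket_ext2
  by (rule ext2_add_left[where C = "\<lambda>l. hom l p" and D = "\<lambda>m. hom m q"])
    (auto intro: bracket_add_left chains_lookup)

lemma tot_bracket_add_right:
  "\<lbrakk>x \<in> chains \<O> p; y \<in> chains \<O> q; y' \<in> chains \<O> q\<rbrakk> \<Longrightarrow>
    tot_bracket \<O> p q x (y + y') = tot_bracket \<O> p q x y + tot_bracket \<O> p q x y'"
  unfolding tot_bracket_ext2
  by (rule ext2_add_right[where C = "\<lambda>l. hom l p" and D = "\<lambda>m. hom m q"])
    (auto intro: bracket_add_right chains_lookup)

lemma tot_connes_add:
  "\<lbrakk>x \<in> chains \<O> p; y \<in> chains \<O> p\<rbrakk> \<Longrightarrow> tot_connes \<O> p (x + y) = tot_connes \<O> p x + tot_connes \<O> p y"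
  unfolding tot_connes_ext1
  by (rule ext1_add[where C = "\<lambda>l. hom l p"]) (auto intro: connes_add chains_lookup)

lemmas tot_add = tot_bullet_add_left tot_bullet_add_right tot_bracket_add_left tot_bracket_add_right tot_connes_add

lemma tot_bullet_zero [simp]: "tot_bullet \<O> p q 0 y = 0" "tot_bullet \<O> p q x 0 = 0"
  by (simp_all add: tot_bullet_ext2)

lemma tot_bracket_zero [simp]: "tot_bracket \<O> p q 0 y = 0" "tot_bracket \<O> p q x 0 = 0"
  by (simp_all add: tot_bracket_ext2)

lemma tot_connes_zero [simp]: "tot_connes \<O> p 0 = 0"
  by (simp add: tot_connes_ext1)

lemma tot_bullet_single:
  assumes x: "x \<in> hom l p" and y: "y \<in> hom m q"
  shows "tot_bullet \<O> p q (single l x) (single m y) =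
    single (l + m) (bullet \<O> l m (int m + q) x y)"
  unfolding tot_bullet_ext2
  using bullet_add_left[OF comps_zero comps_zero y, of l] bullet_add_right[OF x comps_zero comps_zero, of m q]
  by (intro ext2_single) auto

lemma tot_bracket_single:
  assumes x: "x \<in> hom l p" and y: "y \<in> hom m q"
  shows "tot_bracket \<O> p q (single l x) (single m y) =
    single (l + m - 1) (bracket \<O> l m (int l + p) (int m + q) x y)"
  unfolding tot_bracket_ext2
  using bracket_add_left[OF comps_zero comps_zero y, of l p] bracket_add_right[OF x comps_zero comps_zero, of m q]
  by (intro ext2_single) auto

lemma tot_connes_single:
  shows "tot_connes \<O> p (single l x) = single (l - 1) (connes \<O> l (int l + p) x)"
  unfolding tot_connes_ext1
proof (rule ext1_single)
  have "connes \<O> l (int l + p) (0 + 0) = connes \<O> l (int l + p) 0 + connes \<O> l (int l + p) 0"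
    by (rule connes_add) simp_all
  then show "connes \<O> l (int l + p) 0 = 0" by simp
qed

lemma tot_bullet_chains: "\<lbrakk>x \<in> chains \<O> p; y \<in> chains \<O> q\<rbrakk> \<Longrightarrow> tot_bullet \<O> p q x y \<in> chains \<O> (p + q)"
  unfolding tot_bullet_def by (intro chains_sum chains_single bullet_closed chains_lookup)

lemma tot_bracket_chains: "\<lbrakk>x \<in> chains \<O> p; y \<in> chains \<O> q\<rbrakk> \<Longrightarrow> tot_bracket \<O> p q x y \<in> chains \<O> (p + q + 1)"
  unfolding tot_bracket_def by (intro chains_sum chains_single bracket_closed chains_lookup)

lemma tot_connes_chains: "x \<in> chains \<O> p \<Longrightarrow> tot_connes \<O> p x \<in> chains \<O> (p + 1)"
  unfolding tot_connes_def by (intro chains_sum chains_single connes_closed chains_lookup)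

lemmas tot_chains = tot_bullet_chains tot_bracket_chains tot_connes_chains cycles_chains chains_single

lemma cycles_sum: "(\<And>i. i \<in> A \<Longrightarrow> f i \<in> cycles \<O> n) \<Longrightarrow> (\<Sum>i\<in>A. f i) \<in> cycles \<O> n"
  by (induction A rule: infinite_finite_induct) (auto intro: cycles_add)

lemma tot_bullet_cycles: "\<lbrakk>x \<in> cycles \<O> p; y \<in> cycles \<O> q\<rbrakk> \<Longrightarrow> tot_bullet \<O> p q x y \<in> cycles \<O> (p + q)"
  unfolding tot_bullet_def by (intro cycles_sum cycles_single bullet_hcyc cycles_lookup)

lemma tot_bracket_cycles: "\<lbrakk>x \<in> cycles \<O> p; y \<in> cycles \<O> q\<rbrakk> \<Longrightarrow> tot_bracket \<O> p q x y \<in> cycles \<O> (p + q + 1)"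
  unfolding tot_bracket_def by (intro cycles_sum cycles_single bracket_hcyc cycles_lookup)

lemma tot_connes_cycles: "x \<in> cycles \<O> p \<Longrightarrow> tot_connes \<O> p x \<in> cycles \<O> (p + 1)"
  unfolding tot_connes_def by (intro cycles_sum cycles_single connes_hcyc cycles_lookup)

lemma boundaries_sum: "(\<And>i. i \<in> A \<Longrightarrow> f i \<in> boundaries \<O> n) \<Longrightarrow> (\<Sum>i\<in>A. f i) \<in> boundaries \<O> n"
  by (induction A rule: infinite_finite_induct) (auto intro: boundaries_add)

lemma boundaries_lookup: "x \<in> boundaries \<O> n \<Longrightarrow> lookup x l \<in> hbnd l n"
proof (induction rule: boundaries_induct)
  case (add x y)
  then have "emb l n (lookup x l) + emb l n (lookup y l) \<in> S.bnd l (n + 1)"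
    by (intro S.bnd_add) (simp_all add: emb_bnd)
  then show ?case unfolding single_add[symmetric] emb_bnd lookup_add .
qed (auto simp: lookup_single when_def)

lemma tot_bullet_boundaries_left:
  "\<lbrakk>x \<in> boundaries \<O> p; y \<in> cycles \<O> q\<rbrakk> \<Longrightarrow> tot_bullet \<O> p q x y \<in> boundaries \<O> (p + q)"
  unfolding tot_bullet_def
  by (intro boundaries_sum boundaries_single bullet_hbnd_left boundaries_lookup cycles_lookup)

lemma tot_bullet_boundaries_right:
  "\<lbrakk>x \<in> cycles \<O> p; y \<in> boundaries \<O> q\<rbrakk> \<Longrightarrow> tot_bullet \<O> p q x y \<in> boundaries \<O> (p + q)"
  unfolding tot_bullet_def
  by (intro boundaries_sum boundaries_single bullet_hbnd_right boundaries_lookup cycles_lookup)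

lemma tot_bracket_boundaries_left:
  "\<lbrakk>x \<in> boundaries \<O> p; y \<in> cycles \<O> q\<rbrakk> \<Longrightarrow> tot_bracket \<O> p q x y \<in> boundaries \<O> (p + q + 1)"
  unfolding tot_bracket_def
  by (intro boundaries_sum boundaries_single bracket_hbnd_left boundaries_lookup cycles_lookup)

lemma tot_bracket_boundaries_right:
  "\<lbrakk>x \<in> cycles \<O> p; y \<in> boundaries \<O> q\<rbrakk> \<Longrightarrow> tot_bracket \<O> p q x y \<in> boundaries \<O> (p + q + 1)"
  unfolding tot_bracket_def
  by (intro boundaries_sum boundaries_single bracket_hbnd_right boundaries_lookup cycles_lookup)

lemma tot_connes_boundaries: "x \<in> boundaries \<O> p \<Longrightarrow> tot_connes \<O> p x \<in> boundaries \<O> (p + 1)"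
  unfolding tot_connes_def by (intro boundaries_sum boundaries_single connes_hbnd boundaries_lookup)

lemma tot_bullet_assoc:
  assumes x: "x \<in> cycles \<O> p" and y: "y \<in> cycles \<O> q" and z: "z \<in> cycles \<O> r"
  shows "tot_bullet \<O> (p + q) r (tot_bullet \<O> p q x y) z = tot_bullet \<O> p (q + r) x (tot_bullet \<O> q r y z)"
  using x
proof (induction rule: cycles_induct)
  case (single l u)
  note u = hcyc_comps[OF single]
  show ?case using y
  proof (induction rule: cycles_induct)
    case (single m v)
    note v = hcyc_comps[OF single]
    show ?case using z
    proof (induction rule: cycles_induct)
      case (single n w)
      note w = hcyc_comps[OF single]
      have "S.prod (l + m) (p + 1 + (q + 1) - 1) (S.prod l (p + 1) (emb l p u) (emb m q v)) (emb n r w) =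
          S.prod l (p + 1) (emb l p u) (S.prod m (q + 1) (emb m q v) (emb n r w))"
        by (rule S.prod_assoc[OF emb_E[OF u] emb_E[OF v] emb_E[OF w]])
      then have "forget (emb (l + m + n) (p + q + r) (bullet \<O> (l + m) n (int n + r) (bullet \<O> l m (int m + q) u v) w)) =
          forget (emb (l + (m + n)) (p + (q + r)) (bullet \<O> l (m + n) (int (m + n) + (q + r)) u (bullet \<O> m n (int n + r) v w)))"
        unfolding prod_emb[OF u v] prod_emb[OF v w] deg_prod prod_emb[OF bullet_closed[OF u v] w]
          prod_emb[OF u bullet_closed[OF v w]] by simp
      then show ?case
        by (simp only: tot_bullet_single u v w bullet_closed forget_single)
    qed (simp_all add: tot_add tot_chains u v)
  qed (use z in \<open>simp_all add: tot_add tot_chains u\<close>)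
qed (use y z in \<open>simp_all add: tot_add tot_chains\<close>)

lemmas pm_ac = add.assoc[where ?'a = "nat \<Rightarrow>\<^sub>0 'a"] add.commute[where ?'a = "nat \<Rightarrow>\<^sub>0 'a"]
  add.left_commute[where ?'a = "nat \<Rightarrow>\<^sub>0 'a"]

lemma boundaries_rearrange2:
  "\<lbrakk>a - ksign k b \<in> boundaries \<O> n; a' - ksign k b' \<in> boundaries \<O> n\<rbrakk> \<Longrightarrow> a + a' - ksign k (b + b') \<in> boundaries \<O> n"
  using boundaries_add[of "a - ksign k b" n "a' - ksign k b'"] by (simp add: ksign_add algebra_simps)

lemma tot_bullet_comm:
  assumes x: "x \<in> cycles \<O> p" and y: "y \<in> cycles \<O> q"
  shows "tot_bullet \<O> p q x y - ksign (p * q) (tot_bullet \<O> q p y x) \<in> boundaries \<O> (p + q)"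
  using x
proof (induction rule: cycles_induct)
  case (single l u)
  note hu = single and u = hcyc_comps[OF single]
  show ?case using y
  proof (induction rule: cycles_induct)
    case (single m v)
    note v = hcyc_comps[OF single]
    have "S.prod l (p + 1) (emb l p u) (emb m q v) -
        ksign ((p + 1 - 1) * (q + 1 - 1)) (S.prod m (q + 1) (emb m q v) (emb l p u)) \<in> S.bnd (l + m) (p + 1 + (q + 1) - 1)"
      by (rule S.prod_comm) (simp_all add: emb_cyc hu single)
    from this[unfolded deg_prod, THEN forget_bnd]
    show ?case
      by (simp add: prod_emb u v forget_diff forget_ksign tot_bullet_single)
  qed (simp_all add: tot_add tot_chains u boundaries_rearrange2)
qed (use y in \<open>simp_all add: tot_add tot_chains boundaries_rearrange2\<close>)

lemma tot_bullet_unit: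
  assumes x: "x \<in> cycles \<O> p"
  shows "tot_bullet \<O> 0 p (single 0 (unt \<O>)) x = x"
    and "tot_bullet \<O> p 0 x (single 0 (unt \<O>)) = x"
proof -
  have e: "unt \<O> \<in> hom 0 0" using unt_closed by simp
  show "tot_bullet \<O> 0 p (single 0 (unt \<O>)) x = x"
    using x
  proof (induction rule: cycles_induct)
    case (single l u)
    note u = hcyc_comps[OF single]
    have "forget (S.prod 0 (0 + 1) (emb 0 0 (unt \<O>)) (emb l p u)) = forget (emb l p u)"
      using S.prod_e_left[OF emb_E[OF u]] by simp
    then show ?case unfolding prod_emb[OF e u] tot_bullet_single[OF e u] by simp
  qed (simp_all add: tot_bullet_add_right cycles_chains chains_single e[simplified])
  show "tot_bullet \<O> p 0 x (single 0 (unt \<O>)) = x"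
    using x
  proof (induction rule: cycles_induct)
    case (single l u)
    note u = hcyc_comps[OF single]
    have "forget (S.prod l (p + 1) (emb l p u) (emb 0 0 (unt \<O>))) = forget (emb l p u)"
      using S.prod_e_right[OF emb_E[OF u]] by simp
    then show ?case unfolding prod_emb[OF u e] tot_bullet_single[OF u e] by simp
  qed (simp_all add: tot_bullet_add_left cycles_chains chains_single e[simplified])
qed

lemma tot_bracket_antisym:
  assumes x: "x \<in> cycles \<O> p" and y: "y \<in> cycles \<O> q"
  shows "tot_bracket \<O> p q x y = - ksign ((p + 1) * (q + 1)) (tot_bracket \<O> q p y x)"
  using x
proof (induction rule: cycles_induct)
  case (single l u)
  note u = hcyc_comps[OF single]
  show ?case using y
  proof (induction rule: cycles_induct)
    case (single m v)
    note v = hcyc_comps[OF single]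
    have "forget (S.br l (p + 1) m (q + 1) (emb l p u) (emb m q v)) =
        forget (- ksign ((p + 1) * (q + 1)) (S.br m (q + 1) l (p + 1) (emb m q v) (emb l p u)))"
      by (simp only: S.br_swap[of l])
    then show ?case
      by (simp add: br_emb u v forget_uminus forget_ksign tot_bracket_single)
  qed (simp_all add: tot_add tot_chains u ksign_add)
qed (use y in \<open>simp_all add: tot_add tot_chains ksign_add\<close>)

lemma tot_bracket_jacobi:
  assumes x: "x \<in> cycles \<O> p" and y: "y \<in> cycles \<O> q" and z: "z \<in> cycles \<O> r"
  shows "tot_bracket \<O> p (q + r + 1) x (tot_bracket \<O> q r y z) =
    tot_bracket \<O> (p + q + 1) r (tot_bracket \<O> p q x y) z +
    ksign ((p + 1) * (q + 1)) (tot_bracket \<O> q (p + r + 1) y (tot_bracket \<O> p r x z))"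
  using x
proof (induction rule: cycles_induct)
  case (single l u)
  note u = hcyc_comps[OF single]
  show ?case using y
  proof (induction rule: cycles_induct)
    case (single m v)
    note v = hcyc_comps[OF single]
    show ?case using z
    proof (induction rule: cycles_induct)
      case (single n w)
      note w = hcyc_comps[OF single]
      have "S.br l (p + 1) (m + n - 1) (q + 1 + (r + 1)) (emb l p u) (S.br m (q + 1) n (r + 1) (emb m q v) (emb n r w)) =
        S.br (l + m - 1) (p + 1 + (q + 1)) n (r + 1) (S.br l (p + 1) m (q + 1) (emb l p u) (emb m q v)) (emb n r w) +
        ksign ((p + 1) * (q + 1)) (S.br m (q + 1) (l + n - 1) (p + 1 + (r + 1)) (emb m q v) (S.br l (p + 1) n (r + 1) (emb l p u) (emb n r w)))"
        by (rule S.br_jacobi[OF emb_E[OF u] emb_E[OF v] emb_E[OF w]])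
      from this[unfolded deg_br br_emb[OF u v] br_emb[OF v w] br_emb[OF u w] br_emb[OF bracket_closed[OF u v] w]
          br_emb[OF u bracket_closed[OF v w]] br_emb[OF v bracket_closed[OF u w]], THEN arg_cong[of _ _ forget]]
      show ?case
        by (simp only: tot_bracket_single u v w bracket_closed forget_single forget_add forget_ksign)
    qed (simp_all add: tot_add tot_chains u v ksign_add pm_ac)
  qed (use z in \<open>simp_all add: tot_add tot_chains u ksign_add pm_ac\<close>)
qed (use y z in \<open>simp_all add: tot_add tot_chains ksign_add pm_ac\<close>)

lemma boundaries_rearrange3:
  "\<lbrakk>a - (b + ksign k c) \<in> boundaries \<O> n; a' - (b' + ksign k c') \<in> boundaries \<O> n\<rbrakk> \<Longrightarrow>
    a + a' - (b + b' + ksign k (c + c')) \<in> boundaries \<O> n"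
  using boundaries_add[of "a - (b + ksign k c)" n "a' - (b' + ksign k c')"]
  by (simp add: ksign_add algebra_simps)

lemma boundaries_rearrange4:
  "\<lbrakk>a - (b + ksign k c + ksign k d) \<in> boundaries \<O> n; a' - (b' + ksign k c' + ksign k d') \<in> boundaries \<O> n\<rbrakk> \<Longrightarrow>
    a + a' - (b + b' + ksign k (c + c') + ksign k (d + d')) \<in> boundaries \<O> n"
  using boundaries_add[of "a - (b + ksign k c + ksign k d)" n "a' - (b' + ksign k c' + ksign k d')"]
  by (simp add: ksign_add algebra_simps)

text \<open>
  Both sides are additive in each argument, so three inductions over cycles leave the case of components.
\<close>

lemma tot_bracket_bullet:
  assumes x: "x \<in> cycles \<O> p" and y: "y \<in> cycles \<O> q" and z: "z \<in> cycles \<O> r"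
  shows "tot_bracket \<O> p (q + r) x (tot_bullet \<O> q r y z) -
    (tot_bullet \<O> (p + q + 1) r (tot_bracket \<O> p q x y) z +
     ksign ((p + 1) * q) (tot_bullet \<O> q (p + r + 1) y (tot_bracket \<O> p r x z))) \<in> boundaries \<O> (p + q + r + 1)"
  using x
proof (induction rule: cycles_induct)
  case (single l u)
  note hu = single and u = hcyc_comps[OF single]
  show ?case using y
  proof (induction rule: cycles_induct)
    case (single m v)
    note hv = single and v = hcyc_comps[OF single]
    show ?case using z
    proof (induction rule: cycles_induct)
      case (single n w)
      note hw = single and w = hcyc_comps[OF single]
      have deg: "p + 1 + (q + 1) + (r + 1) - 1 = p + q + r + 1 + 1" "q + 1 - 1 = q" by simp_all
      have "S.br l (p + 1) (m + n) (q + 1 + (r + 1) - 1) (emb l p u) (S.prod m (q + 1) (emb m q v) (emb n r w)) -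
        (S.prod (l + m - 1) (p + 1 + (q + 1)) (S.br l (p + 1) m (q + 1) (emb l p u) (emb m q v)) (emb n r w) +
         ksign ((p + 1) * (q + 1 - 1)) (S.prod m (q + 1) (emb m q v) (S.br l (p + 1) n (r + 1) (emb l p u) (emb n r w))))
        \<in> S.bnd (l + m + n - 1) (p + 1 + (q + 1) + (r + 1) - 1)"
        by (rule S.br_prod) (simp_all only: emb_cyc hu hv hw)
      from this[unfolded deg deg_prod, unfolded deg_br, unfolded prod_emb[OF v w] br_emb[OF u v] br_emb[OF u w]
          br_emb[OF u bullet_closed[OF v w]] prod_emb[OF bracket_closed[OF u v] w] prod_emb[OF v bracket_closed[OF u w]],
          THEN forget_bnd]
      show ?case
        by (simp only: tot_bracket_single tot_bullet_single u v w bracket_closed bullet_closed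
            forget_single forget_add forget_diff forget_ksign)
    qed (simp_all add: tot_add tot_chains u v boundaries_rearrange3)
  qed (use z in \<open>simp_all add: tot_add tot_chains u boundaries_rearrange3\<close>)
qed (use y z in \<open>simp_all add: tot_add tot_chains boundaries_rearrange3\<close>)

lemma tot_connes_bullet:
  assumes x: "x \<in> cycles \<O> p" and y: "y \<in> cycles \<O> q"
  shows "tot_connes \<O> (p + q) (tot_bullet \<O> p q x y) -
    (tot_bullet \<O> (p + 1) q (tot_connes \<O> p x) y + ksign p (tot_bullet \<O> p (q + 1) x (tot_connes \<O> q y)) +
     ksign p (tot_bracket \<O> p q x y)) \<in> boundaries \<O> (p + q + 1)"
  using x
proof (induction rule: cycles_induct)
  case (single l u)
  note hu = single and u = hcyc_comps[OF single]
  show ?case using y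
  proof (induction rule: cycles_induct)
    case (single m v)
    note hv = single and v = hcyc_comps[OF single]
    have k: "ksign (p + 1 + 1) t = ksign p t" for t :: "nat \<times> int \<Rightarrow>\<^sub>0 'a"
      by (rule ksign_cong) simp
    have "S.B (l + m) (p + 1 + (q + 1) - 1) (S.prod l (p + 1) (emb l p u) (emb m q v)) -
      (S.prod (l - 1) (p + 1 + 1) (S.B l (p + 1) (emb l p u)) (emb m q v) +
       ksign (p + 1 + 1) (S.prod l (p + 1) (emb l p u) (S.B m (q + 1) (emb m q v))) +
       ksign (p + 1 + 1) (S.br l (p + 1) m (q + 1) (emb l p u) (emb m q v))) \<in> S.bnd (l + m - 1) (p + 1 + (q + 1))"
      by (rule S.B_prod) (simp_all only: emb_cyc hu hv)
    from this[unfolded k deg_prod prod_emb[OF u v] B_emb[OF u] B_emb[OF v] br_emb[OF u v] B_emb[OF bullet_closed[OF u v]]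
        prod_emb[OF connes_closed[OF u] v] prod_emb[OF u connes_closed[OF v]], unfolded deg_br, THEN forget_bnd]
    have *: "forget (emb (l + m - 1) (p + q + 1) (connes \<O> (l + m) (int (l + m) + (p + q)) (bullet \<O> l m (int m + q) u v)) -
      (emb (l - 1 + m) (p + 1 + q) (bullet \<O> (l - 1) m (int m + q) (connes \<O> l (int l + p) u) v) +
       ksign p (emb (l + (m - 1)) (p + (q + 1)) (bullet \<O> l (m - 1) (int (m - 1) + (q + 1)) u (connes \<O> m (int m + q) v))) +
       ksign p (emb (l + m - 1) (p + q + 1) (bracket \<O> l m (int l + p) (int m + q) u v)))) \<in> boundaries \<O> (p + q + 1)" .
    then show ?case
      by (simp only: tot_bracket_single tot_bullet_single tot_connes_single u v connes_closed
          forget_single forget_add forget_diff forget_ksign)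
  qed (simp_all add: tot_add tot_chains u boundaries_rearrange4)
qed (use y in \<open>simp_all add: tot_add tot_chains boundaries_rearrange4\<close>)

lemma codegeneracy_zero: "i \<le> k \<Longrightarrow> codegeneracy \<O> k i 0 = 0"
  unfolding codegeneracy_def by (rule pcomp_zero_left[OF unt_closed]) auto

lemma codegeneracy_add:
  "\<lbrakk>x \<in> comps \<O> (Suc k) p; y \<in> comps \<O> (Suc k) p; i \<le> k\<rbrakk> \<Longrightarrow>
    codegeneracy \<O> k i (x + y) = codegeneracy \<O> k i x + codegeneracy \<O> k i y"
  unfolding codegeneracy_def by (rule pcomp_add_left[OF _ _ _ _ unt_closed]) (auto simp: Suc_eq_plus1)

lemma normalized_zero [simp]: "0 \<in> normalized \<O>"
  by (auto simp: normalized_def intro: codegeneracy_zero)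

lemma normalized_add:
  assumes x: "x \<in> normalized \<O>" "x \<in> chains \<O> n" and y: "y \<in> normalized \<O>" "y \<in> chains \<O> n"
  shows "x + y \<in> normalized \<O>"
  unfolding normalized_def
proof (intro CollectI allI impI)
  fix k i :: nat assume i: "i < k"
  then have k: "Suc (k - 1) = k" by simp
  show "codegeneracy \<O> (k - 1) i (lookup (x + y) k) = 0"
    using codegeneracy_add[of "lookup x k" "k - 1" "int k + n" "lookup y k" i]
      chains_lookup[OF x(2), of k] chains_lookup[OF y(2), of k] x(1) y(1) i k
    by (auto simp: lookup_add normalized_def)
qed

lemma normalized_representative:
  assumes "x \<in> cycles \<O> n"
  shows "\<exists>x'. x' \<in> cycles \<O> n \<and> x' \<in> normalized \<O> \<and> x' - x \<in> boundaries \<O> n"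
  using assms
proof (induction rule: cycles_induct)
  case zero
  show ?case by (rule exI[of _ 0]) simp
next
  case (add x y)
  then obtain x' y' where x': "x' \<in> cycles \<O> n" "x' \<in> normalized \<O>" "x' - x \<in> boundaries \<O> n"
    and y': "y' \<in> cycles \<O> n" "y' \<in> normalized \<O>" "y' - y \<in> boundaries \<O> n" by blast
  have "x' + y' - (x + y) \<in> boundaries \<O> n"
    using boundaries_add[OF x'(3) y'(3)] by (simp add: algebra_simps)
  then show ?case
    using x' y' by (intro exI[of _ "x' + y'"] conjI cycles_add normalized_add[of _ n] cycles_chains)
next
  case (single l w)
  obtain w' where w': "w' \<in> hcyc l n" "w' - w \<in> hbnd l n" "\<And>i. i < l \<Longrightarrow> codegeneracy \<O> (l - 1) i w' = 0"
    using normalize_hcyc[OF single] by blast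
  have "codegeneracy \<O> (k - 1) i (lookup (single l w') k) = 0" if "i < k" for k i
    using that w'(3) by (auto simp: lookup_single when_def intro: codegeneracy_zero)
  then have "single l w' \<in> normalized \<O>" by (simp add: normalized_def)
  then show ?case
    using cycles_single[OF w'(1)] boundaries_single[OF w'(2)]
    by (intro exI[of _ "single l w'"]) (simp add: single_diff)
qed

text \<open>
  The components of a normalized chain are normalized.
\<close>

lemma tot_connes_tot_connes:
  assumes x: "x \<in> chains \<O> n" and nrm: "x \<in> normalized \<O>"
  shows "tot_connes \<O> (n + 1) (tot_connes \<O> n x) = 0"
proof -
  define y where "y K = (\<Sum>l\<in>K. single l (lookup x l))" for K
  have y: "y K \<in> chains \<O> n" for K
    unfolding y_def by (intro chains_sum chains_single chains_lookup[OF x])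
  have "tot_connes \<O> (n + 1) (tot_connes \<O> n (y K)) = 0" if "finite K" for K
    using that
  proof (induction K)
    case (insert l K)
    have s: "single l (lookup x l) \<in> chains \<O> n"
      by (rule chains_single[OF chains_lookup[OF x]])
    have "y (insert l K) = single l (lookup x l) + y K"
      using insert by (simp add: y_def)
    moreover have "tot_connes \<O> (n + 1) (tot_connes \<O> n (single l (lookup x l))) = 0"
      unfolding tot_connes_single
      using connes_connes[OF chains_lookup[OF x]] nrm by (simp add: normalized_def)
    ultimately show ?case
      using insert.IH s y[of K] by (simp add: tot_connes_add[of _ n] tot_connes_add[of _ "n + 1"] tot_connes_chains)
  qed (simp add: y_def)
  from this[OF finite_keys[of x]] show ?thesis by (simp add: y_def sum_single_keys)
qed

abbreviation sclp :: "'r \<Rightarrow> (nat \<Rightarrow>\<^sub>0 'a) \<Rightarrow> (nat \<Rightarrow>\<^sub>0 'a)" where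
  "sclp a \<equiv> Poly_Mapping.map (scl \<O> a)"

lemma lookup_sclp: "lookup (sclp a x) k = scl \<O> a (lookup x k)"
  by (simp add: map.rep_eq when_def)

lemma sclp_add: "sclp a (x + y) = sclp a x + sclp a y"
  by (rule poly_mapping_eqI) (simp add: lookup_sclp lookup_add scale_right_distrib)

lemma sclp_zero [simp]: "sclp a 0 = 0"
  by (rule poly_mapping_eqI) (simp add: lookup_sclp)

lemma sclp_uminus: "sclp a (- x) = - sclp a x"
  by (rule poly_mapping_eqI) (simp add: lookup_sclp scale_minus_right)

lemma sclp_diff: "sclp a (x - y) = sclp a x - sclp a y"
  using sclp_add[of a x "- y"] by (simp add: sclp_uminus)

lemma sclp_single: "sclp a (single k x) = single k (scl \<O> a x)"
  by (rule poly_mapping_eqI) (simp add: lookup_sclp lookup_single when_def)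

lemma hcyc_scl: "x \<in> hcyc l p \<Longrightarrow> scl \<O> a x \<in> hcyc l p"
  by (auto simp: hcyc_def comps_scl bdry_scl)

lemma hbnd_scl: "x \<in> hbnd l p \<Longrightarrow> scl \<O> a x \<in> hbnd l p"
  by (auto simp: hbnd_def) (metis bdry_scl comps_scl)

lemma cycles_sclp: "x \<in> cycles \<O> n \<Longrightarrow> sclp a x \<in> cycles \<O> n"
  by (induction rule: cycles_induct) (simp_all add: sclp_add cycles_add sclp_single cycles_single hcyc_scl)

lemma boundaries_sclp: "x \<in> boundaries \<O> n \<Longrightarrow> sclp a x \<in> boundaries \<O> n"
  by (induction rule: boundaries_induct) (simp_all add: sclp_add boundaries_add sclp_single boundaries_single hbnd_scl)

lemma tot_bullet_sclp:
  assumes x: "x \<in> cycles \<O> p" and y: "y \<in> cycles \<O> q"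
  shows "tot_bullet \<O> p q (sclp a x) y = sclp a (tot_bullet \<O> p q x y) \<and>
    tot_bullet \<O> p q x (sclp a y) = sclp a (tot_bullet \<O> p q x y)"
  using x
proof (induction rule: cycles_induct)
  case (single l u)
  note u = hcyc_comps[OF single]
  show ?case using y
  proof (induction rule: cycles_induct)
    case (single m v)
    note v = hcyc_comps[OF single]
    show ?case
      by (simp add: sclp_single tot_bullet_single u v comps_scl bullet_scl[OF u v])
  qed (simp_all add: tot_add sclp_add tot_chains u comps_scl cycles_sclp sclp_single)
qed (use y in \<open>simp_all add: tot_add sclp_add tot_chains cycles_sclp\<close>)

lemma tot_bracket_sclp:
  assumes x: "x \<in> cycles \<O> p" and y: "y \<in> cycles \<O> q"
  shows "tot_bracket \<O> p q (sclp a x) y = sclp a (tot_bracket \<O> p q x y) \<and>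
    tot_bracket \<O> p q x (sclp a y) = sclp a (tot_bracket \<O> p q x y)"
  using x
proof (induction rule: cycles_induct)
  case (single l u)
  note u = hcyc_comps[OF single]
  show ?case using y
  proof (induction rule: cycles_induct)
    case (single m v)
    note v = hcyc_comps[OF single]
    show ?case
      by (simp add: sclp_single tot_bracket_single u v comps_scl bracket_scl[OF u v])
  qed (simp_all add: tot_add sclp_add tot_chains u comps_scl cycles_sclp sclp_single)
qed (use y in \<open>simp_all add: tot_add sclp_add tot_chains cycles_sclp\<close>)

lemma tot_connes_sclp: "x \<in> cycles \<O> p \<Longrightarrow> tot_connes \<O> p (sclp a x) = sclp a (tot_connes \<O> p x)"
proof (induction rule: cycles_induct)
  case (single l u)
  show ?case by (simp add: sclp_single tot_connes_single connes_scl[OF hcyc_comps[OF single]])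
qed (simp_all add: tot_connes_add[of _ p] sclp_add cycles_chains cycles_sclp)

section \<open>Hochschild homology\<close>

lemma mem_hclass: "z \<in> hclass \<O> n x \<longleftrightarrow> z - x \<in> boundaries \<O> n"
proof
  assume "z - x \<in> boundaries \<O> n"
  moreover have "z = x + (z - x)" by simp
  ultimately show "z \<in> hclass \<O> n x" unfolding hclass_def by blast
qed (auto simp: hclass_def)

lemma hclass_self: "x \<in> hclass \<O> n x"
  by (simp add: mem_hclass)

lemma hclass_eqI: "x - y \<in> boundaries \<O> n \<Longrightarrow> hclass \<O> n x = hclass \<O> n y"
proof -
  assume d: "x - y \<in> boundaries \<O> n"
  have "z - x \<in> boundaries \<O> n \<longleftrightarrow> z - y \<in> boundaries \<O> n" for z
    using boundaries_add[OF _ d, of "z - x"] boundaries_diff[OF _ d, of "z - y"] by auto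
  then show ?thesis by (auto simp: mem_hclass)
qed

lemma hclass_cycles: "\<lbrakk>z \<in> hclass \<O> n x; x \<in> cycles \<O> n\<rbrakk> \<Longrightarrow> z \<in> cycles \<O> n"
  using cycles_add[of x n "z - x"] boundaries_cycles[of "z - x" n] by (simp add: mem_hclass)

text \<open>
  This evaluates the unions over representatives by which the operations on classes are defined.
\<close>

lemma UN_const: "\<lbrakk>x \<in> U; \<And>z. z \<in> U \<Longrightarrow> F z = c\<rbrakk> \<Longrightarrow> (\<Union>z\<in>U. F z) = c"
  by auto

lemma HH_carrier: "carrier (HH \<O> n) = hclass \<O> n ` cycles \<O> n"
  by (simp add: HH_def)

lemma HH_zero: "\<zero>\<^bsub>HH \<O> n\<^esub> = hclass \<O> n 0"
  by (simp add: HH_def)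

lemma HH_add: "hclass \<O> n x \<oplus>\<^bsub>HH \<O> n\<^esub> hclass \<O> n y = hclass \<O> n (x + y)"
proof -
  have "(\<Union>z\<in>hclass \<O> n x. \<Union>w\<in>hclass \<O> n y. hclass \<O> n (z + w)) = hclass \<O> n (x + y)"
  proof (intro UN_const[OF hclass_self] hclass_eqI)
    fix z w assume "z \<in> hclass \<O> n x" "w \<in> hclass \<O> n y"
    then show "z + w - (x + y) \<in> boundaries \<O> n"
      using boundaries_add[of "z - x" n "w - y"] by (simp add: mem_hclass algebra_simps)
  qed
  then show ?thesis by (simp add: HH_def)
qed

lemma HH_smult: "a \<odot>\<^bsub>HH \<O> n\<^esub> hclass \<O> n x = hclass \<O> n (sclp a x)"
proof -
  have "(\<Union>z\<in>hclass \<O> n x. hclass \<O> n (sclp a z)) = hclass \<O> n (sclp a x)"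
  proof (intro UN_const[OF hclass_self] hclass_eqI)
    fix z assume "z \<in> hclass \<O> n x"
    then show "sclp a z - sclp a x \<in> boundaries \<O> n"
      using boundaries_sclp[of "z - x" n a] by (simp add: mem_hclass sclp_diff)
  qed
  then show ?thesis by (simp add: HH_def)
qed

lemma hclass_bilinear:
  assumes add_left: "\<And>u u' v. \<lbrakk>u \<in> chains \<O> p; u' \<in> chains \<O> p; v \<in> chains \<O> q\<rbrakk> \<Longrightarrow> F (u + u') v = F u v + F u' v"
    and add_right: "\<And>u v v'. \<lbrakk>u \<in> chains \<O> p; v \<in> chains \<O> q; v' \<in> chains \<O> q\<rbrakk> \<Longrightarrow> F u (v + v') = F u v + F u v'"
    and left: "\<And>u v. \<lbrakk>u \<in> boundaries \<O> p; v \<in> cycles \<O> q\<rbrakk> \<Longrightarrow> F u v \<in> boundaries \<O> n"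
    and right: "\<And>u v. \<lbrakk>u \<in> cycles \<O> p; v \<in> boundaries \<O> q\<rbrakk> \<Longrightarrow> F u v \<in> boundaries \<O> n"
    and x: "x \<in> cycles \<O> p" and y: "y \<in> cycles \<O> q"
  shows "(\<Union>z\<in>hclass \<O> p x. \<Union>w\<in>hclass \<O> q y. hclass \<O> n (F z w)) = hclass \<O> n (F x y)"
proof (intro UN_const[OF hclass_self] hclass_eqI)
  fix z w assume z: "z \<in> hclass \<O> p x" and w: "w \<in> hclass \<O> q y"
  have zc: "z \<in> cycles \<O> p" by (rule hclass_cycles[OF z x])
  have b: "z - x \<in> boundaries \<O> p" "w - y \<in> boundaries \<O> q" using z w by (simp_all add: mem_hclass)
  have "F (x + (z - x)) y = F x y + F (z - x) y" "F z (y + (w - y)) = F z y + F z (w - y)"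
    by (intro add_left add_right cycles_chains x y zc boundaries_cycles b)+
  then have "F z w - F x y = F (z - x) y + F z (w - y)" by simp
  then show "F z w - F x y \<in> boundaries \<O> n"
    using boundaries_add[OF left[OF b(1) y] right[OF zc b(2)]] by simp
qed

lemma HH_bullet:
  assumes "x \<in> cycles \<O> p" "y \<in> cycles \<O> q"
  shows "HH_bullet \<O> p q (hclass \<O> p x) (hclass \<O> q y) = hclass \<O> (p + q) (tot_bullet \<O> p q x y)"
  unfolding HH_bullet_def
  by (rule hclass_bilinear) (simp_all add: assms tot_add tot_bullet_boundaries_left tot_bullet_boundaries_right)

lemma HH_bracket:
  assumes "x \<in> cycles \<O> p" "y \<in> cycles \<O> q"
  shows "HH_bracket \<O> p q (hclass \<O> p x) (hclass \<O> q y) = hclass \<O> (p + q + 1) (tot_bracket \<O> p q x y)"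
  unfolding HH_bracket_def
  by (rule hclass_bilinear) (simp_all add: assms tot_add tot_bracket_boundaries_left tot_bracket_boundaries_right)

text \<open>
  Any representative computes \<open>B\<close>, normalized or not, because \<open>tot_connes\<close> preserves boundaries; that some
  representative is normalized makes the union non-empty.
\<close>

lemma HH_B:
  assumes x: "x \<in> cycles \<O> n"
  shows "HH_B \<O> n (hclass \<O> n x) = hclass \<O> (n + 1) (tot_connes \<O> n x)"
proof -
  obtain x' where x': "x' \<in> hclass \<O> n x \<inter> normalized \<O>"
    using normalized_representative[OF x] by (auto simp: mem_hclass)
  show ?thesis
    unfolding HH_B_def
  proof (intro UN_const[OF x'] hclass_eqI)
    fix z assume z: "z \<in> hclass \<O> n x \<inter> normalized \<O>"
    then have b: "z - x \<in> boundaries \<O> n" by (simp add: mem_hclass)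
    have "tot_connes \<O> n (x + (z - x)) = tot_connes \<O> n x + tot_connes \<O> n (z - x)"
      by (rule tot_connes_add) (simp_all add: tot_chains x boundaries_cycles b)
    then show "tot_connes \<O> n z - tot_connes \<O> n x \<in> boundaries \<O> (n + 1)"
      using tot_connes_boundaries[OF b] by simp
  qed
qed

lemma HH_carrierE:
  assumes "U \<in> carrier (HH \<O> n)"
  obtains x where "x \<in> cycles \<O> n" "U = hclass \<O> n x"
  using assms by (auto simp: HH_carrier)

lemma HH_closed: "x \<in> cycles \<O> n \<Longrightarrow> hclass \<O> n x \<in> carrier (HH \<O> n)"
  by (simp add: HH_carrier)

lemma HH_abelian_group: "abelian_group (HH \<O> n)"
proof (rule abelian_groupI)
  fix U V W assume U: "U \<in> carrier (HH \<O> n)"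
  then obtain x where x: "x \<in> cycles \<O> n" "U = hclass \<O> n x" by (rule HH_carrierE)
  show "\<exists>V\<in>carrier (HH \<O> n). V \<oplus>\<^bsub>HH \<O> n\<^esub> U = \<zero>\<^bsub>HH \<O> n\<^esub>"
    using x by (intro bexI[of _ "hclass \<O> n (- x)"]) (auto simp: HH_add HH_zero HH_closed cycles_uminus)
  show "\<zero>\<^bsub>HH \<O> n\<^esub> \<oplus>\<^bsub>HH \<O> n\<^esub> U = U" by (simp add: x HH_zero HH_add)
  assume V: "V \<in> carrier (HH \<O> n)"
  then obtain y where y: "y \<in> cycles \<O> n" "V = hclass \<O> n y" by (rule HH_carrierE)
  show "U \<oplus>\<^bsub>HH \<O> n\<^esub> V \<in> carrier (HH \<O> n)" by (simp add: x y HH_add HH_closed cycles_add)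
  show "U \<oplus>\<^bsub>HH \<O> n\<^esub> V = V \<oplus>\<^bsub>HH \<O> n\<^esub> U" by (simp add: x y HH_add add.commute)
  assume W: "W \<in> carrier (HH \<O> n)"
  then obtain z where z: "z \<in> cycles \<O> n" "W = hclass \<O> n z" by (rule HH_carrierE)
  show "U \<oplus>\<^bsub>HH \<O> n\<^esub> V \<oplus>\<^bsub>HH \<O> n\<^esub> W = U \<oplus>\<^bsub>HH \<O> n\<^esub> (V \<oplus>\<^bsub>HH \<O> n\<^esub> W)"
    by (simp add: x y z HH_add add.assoc)
qed (simp add: HH_zero HH_closed)

lemma HH_module: "Module.module (ring_of_type_algebra :: 'r ring) (HH \<O> n)"
proof (rule Module.moduleI[OF cring_from_type_algebra HH_abelian_group])
  have sclp_left: "sclp (a + b) x = sclp a x + sclp b x" "sclp (a * b) x = sclp a (sclp b x)" "sclp 1 x = x" for a b x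
    by (rule poly_mapping_eqI; simp add: lookup_sclp lookup_add scale_left_distrib)+
  fix a b :: 'r and U V assume U: "U \<in> carrier (HH \<O> n)"
  then obtain x where x: "x \<in> cycles \<O> n" "U = hclass \<O> n x" by (rule HH_carrierE)
  show "a \<odot>\<^bsub>HH \<O> n\<^esub> U \<in> carrier (HH \<O> n)" by (simp add: x HH_smult HH_closed cycles_sclp)
  show "(a \<oplus>\<^bsub>ring_of_type_algebra\<^esub> b) \<odot>\<^bsub>HH \<O> n\<^esub> U = a \<odot>\<^bsub>HH \<O> n\<^esub> U \<oplus>\<^bsub>HH \<O> n\<^esub> b \<odot>\<^bsub>HH \<O> n\<^esub> U"
    by (simp add: x HH_smult HH_add sclp_left ring_of_type_algebra_def)
  show "(a \<otimes>\<^bsub>ring_of_type_algebra\<^esub> b) \<odot>\<^bsub>HH \<O> n\<^esub> U = a \<odot>\<^bsub>HH \<O> n\<^esub> (b \<odot>\<^bsub>HH \<O> n\<^esub> U)"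
    by (simp add: x HH_smult sclp_left ring_of_type_algebra_def)
  show "\<one>\<^bsub>ring_of_type_algebra\<^esub> \<odot>\<^bsub>HH \<O> n\<^esub> U = U"
    by (simp add: x HH_smult sclp_left ring_of_type_algebra_def)
  assume V: "V \<in> carrier (HH \<O> n)"
  then obtain y where y: "y \<in> cycles \<O> n" "V = hclass \<O> n y" by (rule HH_carrierE)
  show "a \<odot>\<^bsub>HH \<O> n\<^esub> (U \<oplus>\<^bsub>HH \<O> n\<^esub> V) = a \<odot>\<^bsub>HH \<O> n\<^esub> U \<oplus>\<^bsub>HH \<O> n\<^esub> a \<odot>\<^bsub>HH \<O> n\<^esub> V"
    by (simp add: x y HH_smult HH_add sclp_add)
qed

lemma HH_uminus: "x \<in> cycles \<O> n \<Longrightarrow> \<ominus>\<^bsub>HH \<O> n\<^esub> hclass \<O> n x = hclass \<O> n (- x)"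
  by (rule abelian_group.minus_equality[OF HH_abelian_group])
    (simp_all add: HH_add HH_zero HH_closed cycles_uminus)

lemma HH_msign: "x \<in> cycles \<O> n \<Longrightarrow> msign (HH \<O> n) k (hclass \<O> n x) = hclass \<O> n (ksign k x)"
  by (simp add: msign_def ksign_def HH_uminus)

end

theorem theorem4p6:
  fixes \<O> :: "('r::comm_ring_1, 'a::ab_group_add) cyclic_operad"
  assumes "cyclic_multiplicative_operad \<O>"
  shows "BV_algebra (ring_of_type_algebra :: 'r ring) (HH \<O>) (HH_bullet \<O>) (HH_bracket \<O>) (HH_B \<O>)"
proof -
  interpret cyclic_multiplicative_operad \<O> by fact
  let ?R = "ring_of_type_algebra :: 'r ring"
  show ?thesis
  proof (intro BV_algebra.intro poisson_algebra.intro graded_comm_algebra.intro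
      BV_algebra_axioms.intro poisson_algebra_axioms.intro)
    fix p q r :: int
    show "Module.module ?R (HH \<O> p)" by (rule HH_module)
    show "graded_bilinear ?R (HH \<O>) 0 (HH_bullet \<O>)"
      unfolding graded_bilinear_def
      by (auto elim!: HH_carrierE simp: HH_bullet HH_add HH_smult HH_closed tot_bullet_cycles cycles_add
          tot_bullet_add_left tot_bullet_add_right cycles_chains tot_bullet_sclp cycles_sclp)
    show "graded_bilinear ?R (HH \<O>) 1 (HH_bracket \<O>)"
      unfolding graded_bilinear_def
      by (auto elim!: HH_carrierE simp: HH_bracket HH_add HH_smult HH_closed tot_bracket_cycles cycles_add
          tot_bracket_add_left tot_bracket_add_right cycles_chains tot_bracket_sclp cycles_sclp)
    show "graded_linear ?R (HH \<O>) 1 (HH_B \<O>)"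
      unfolding graded_linear_def
      by (auto elim!: HH_carrierE simp: HH_B HH_add HH_smult HH_closed tot_connes_cycles cycles_add
          tot_connes_add cycles_chains tot_connes_sclp cycles_sclp)
    show "\<exists>u\<in>carrier (HH \<O> 0). \<forall>p. \<forall>U\<in>carrier (HH \<O> p). HH_bullet \<O> 0 p u U = U \<and> HH_bullet \<O> p 0 U u = U"
    proof (intro bexI allI ballI)
      have e: "single 0 (unt \<O>) \<in> cycles \<O> 0"
      proof (rule cycles_single)
        have "emb 0 0 (unt \<O>) \<in> S.cyc 0 (0 + 1)"
          by (rule S.cycI) (simp_all add: S.e_E S.d_e)
        then show "unt \<O> \<in> hcyc 0 0" by (simp only: emb_cyc)
      qed
      show "hclass \<O> 0 (single 0 (unt \<O>)) \<in> carrier (HH \<O> 0)" by (rule HH_closed[OF e])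
      fix p U assume "U \<in> carrier (HH \<O> p)"
      then obtain x where x: "x \<in> cycles \<O> p" "U = hclass \<O> p x" by (rule HH_carrierE)
      show "HH_bullet \<O> 0 p (hclass \<O> 0 (single 0 (unt \<O>))) U = U \<and>
          HH_bullet \<O> p 0 U (hclass \<O> 0 (single 0 (unt \<O>))) = U"
        using HH_bullet[OF e x(1)] HH_bullet[OF x(1) e] by (simp add: x(2) tot_bullet_unit[OF x(1)])
    qed
    fix U V W assume U: "U \<in> carrier (HH \<O> p)"
    then obtain x where x: "x \<in> cycles \<O> p" and Ux: "U = hclass \<O> p x" by (rule HH_carrierE)
    show "HH_B \<O> (p + 1) (HH_B \<O> p U) = \<zero>\<^bsub>HH \<O> (p + 2)\<^esub>"
    proof -
      obtain x' where x': "x' \<in> cycles \<O> p" "x' \<in> normalized \<O>" "x' - x \<in> boundaries \<O> p"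
        using normalized_representative[OF x] by blast
      have Ux': "U = hclass \<O> p x'" using hclass_eqI[OF x'(3)] by (simp add: Ux)
      have deg: "p + 1 + 1 = p + 2" by simp
      show ?thesis
        unfolding Ux' HH_B[OF x'(1)] HH_B[OF tot_connes_cycles[OF x'(1)]]
          tot_connes_tot_connes[OF cycles_chains[OF x'(1)] x'(2)] HH_zero deg ..
    qed
    assume V: "V \<in> carrier (HH \<O> q)"
    then obtain y where y: "y \<in> cycles \<O> q" and Vy: "V = hclass \<O> q y" by (rule HH_carrierE)
    have a1: "p + q + 1 = p + (q + 1)" "p + q + 1 = p + 1 + q" "q + p = p + q" by simp_all
    show "HH_bullet \<O> p q U V = msign (HH \<O> (p + q)) (p * q) (HH_bullet \<O> q p V U)"
      using HH_msign[of "tot_bullet \<O> q p y x" "p + q"] tot_bullet_cycles[OF y x] hclass_eqI[OF tot_bullet_comm[OF x y]]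
      by (simp add: Ux Vy HH_bullet x y add.commute)
    show "HH_bracket \<O> p q U V = \<ominus>\<^bsub>HH \<O> (p + q + 1)\<^esub> msign (HH \<O> (p + q + 1)) ((p + 1) * (q + 1)) (HH_bracket \<O> q p V U)"
    proof -
      have yx: "tot_bracket \<O> q p y x \<in> cycles \<O> (p + q + 1)"
        using tot_bracket_cycles[OF y x] by (simp add: add.commute)
      have "HH_bracket \<O> q p V U = hclass \<O> (p + q + 1) (tot_bracket \<O> q p y x)"
        by (simp add: Ux Vy HH_bracket x y add.commute)
      then show ?thesis
        using tot_bracket_antisym[OF x y]
        by (simp add: Ux Vy HH_bracket x y HH_msign[OF yx] HH_uminus[OF cycles_ksign[OF yx]])
    qed
    show "HH_B \<O> (p + q) (HH_bullet \<O> p q U V) =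
        HH_bullet \<O> (p + 1) q (HH_B \<O> p U) V
        \<oplus>\<^bsub>HH \<O> (p + q + 1)\<^esub> msign (HH \<O> (p + q + 1)) p (HH_bullet \<O> p (q + 1) U (HH_B \<O> q V))
        \<oplus>\<^bsub>HH \<O> (p + q + 1)\<^esub> msign (HH \<O> (p + q + 1)) p (HH_bracket \<O> p q U V)"
    proof -
      have c: "tot_bullet \<O> p (q + 1) x (tot_connes \<O> q y) \<in> cycles \<O> (p + q + 1)"
        using tot_bullet_cycles[OF x tot_connes_cycles[OF y]] by (simp only: a1(1))
      have 1: "HH_bullet \<O> (p + 1) q (HH_B \<O> p U) V = hclass \<O> (p + q + 1) (tot_bullet \<O> (p + 1) q (tot_connes \<O> p x) y)"
        unfolding Ux Vy HH_B[OF x] HH_bullet[OF tot_connes_cycles[OF x] y] by (simp only: a1(2))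
      have 2: "HH_bullet \<O> p (q + 1) U (HH_B \<O> q V) = hclass \<O> (p + q + 1) (tot_bullet \<O> p (q + 1) x (tot_connes \<O> q y))"
        unfolding Ux Vy HH_B[OF y] HH_bullet[OF x tot_connes_cycles[OF y]] by (simp only: a1(1))
      have 3: "HH_bracket \<O> p q U V = hclass \<O> (p + q + 1) (tot_bracket \<O> p q x y)"
        unfolding Ux Vy by (rule HH_bracket[OF x y])
      have 4: "HH_B \<O> (p + q) (HH_bullet \<O> p q U V) = hclass \<O> (p + q + 1) (tot_connes \<O> (p + q) (tot_bullet \<O> p q x y))"
        unfolding Ux Vy HH_bullet[OF x y] by (rule HH_B[OF tot_bullet_cycles[OF x y]])
      show ?thesis
        unfolding 1 2 3 4 HH_msign[OF c] HH_msign[OF tot_bracket_cycles[OF x y]] HH_add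
        by (rule hclass_eqI[OF tot_connes_bullet[OF x y]])
    qed
    assume W: "W \<in> carrier (HH \<O> r)"
    then obtain z where z: "z \<in> cycles \<O> r" and Wz: "W = hclass \<O> r z" by (rule HH_carrierE)
    show "HH_bullet \<O> (p + q) r (HH_bullet \<O> p q U V) W = HH_bullet \<O> p (q + r) U (HH_bullet \<O> q r V W)"
      unfolding Ux Vy Wz HH_bullet[OF x y] HH_bullet[OF y z] HH_bullet[OF tot_bullet_cycles[OF x y] z]
        HH_bullet[OF x tot_bullet_cycles[OF y z]] tot_bullet_assoc[OF x y z] by (simp only: add.assoc)
    show "HH_bracket \<O> p (q + r + 1) U (HH_bracket \<O> q r V W) =
        HH_bracket \<O> (p + q + 1) r (HH_bracket \<O> p q U V) W \<oplus>\<^bsub>HH \<O> (p + q + r + 2 * 1)\<^esub>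
        msign (HH \<O> (p + q + r + 2 * 1)) ((p + 1) * (q + 1)) (HH_bracket \<O> q (p + r + 1) V (HH_bracket \<O> p r U W))"
    proof -
      have deg: "p + (q + r + 1) + 1 = p + q + r + 2 * 1" "p + q + 1 + r + 1 = p + q + r + 2 * 1"
        "q + (p + r + 1) + 1 = p + q + r + 2 * 1" by simp_all
      note c = tot_bracket_cycles[OF y tot_bracket_cycles[OF x z], unfolded deg]
      show ?thesis
        unfolding Ux Vy Wz HH_bracket[OF x y] HH_bracket[OF y z] HH_bracket[OF x z]
          HH_bracket[OF tot_bracket_cycles[OF x y] z] HH_bracket[OF x tot_bracket_cycles[OF y z]]
          HH_bracket[OF y tot_bracket_cycles[OF x z]] deg HH_msign[OF c] HH_add tot_bracket_jacobi[OF x y z] ..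
    qed
    show "HH_bracket \<O> p (q + r) U (HH_bullet \<O> q r V W) =
        HH_bullet \<O> (p + q + 1) r (HH_bracket \<O> p q U V) W \<oplus>\<^bsub>HH \<O> (p + q + r + 1)\<^esub>
        msign (HH \<O> (p + q + r + 1)) ((p + 1) * q) (HH_bullet \<O> q (p + r + 1) V (HH_bracket \<O> p r U W))"
    proof -
      have deg: "p + (q + r) + 1 = p + q + r + 1" "p + q + 1 + r = p + q + r + 1"
        "q + (p + r + 1) = p + q + r + 1" by simp_all
      have c: "tot_bullet \<O> q (p + r + 1) y (tot_bracket \<O> p r x z) \<in> cycles \<O> (p + q + r + 1)"
        using tot_bullet_cycles[OF y tot_bracket_cycles[OF x z]] by (simp only: deg)
      have 1: "HH_bracket \<O> p (q + r) U (HH_bullet \<O> q r V W) =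
          hclass \<O> (p + q + r + 1) (tot_bracket \<O> p (q + r) x (tot_bullet \<O> q r y z))"
        unfolding Ux Vy Wz HH_bullet[OF y z] HH_bracket[OF x tot_bullet_cycles[OF y z]] by (simp only: deg)
      have 2: "HH_bullet \<O> (p + q + 1) r (HH_bracket \<O> p q U V) W =
          hclass \<O> (p + q + r + 1) (tot_bullet \<O> (p + q + 1) r (tot_bracket \<O> p q x y) z)"
        unfolding Ux Vy Wz HH_bracket[OF x y] HH_bullet[OF tot_bracket_cycles[OF x y] z] by (simp only: deg)
      have 3: "HH_bullet \<O> q (p + r + 1) V (HH_bracket \<O> p r U W) =
          hclass \<O> (p + q + r + 1) (tot_bullet \<O> q (p + r + 1) y (tot_bracket \<O> p r x z))"
        unfolding Ux Vy Wz HH_bracket[OF x z] HH_bullet[OF y tot_bracket_cycles[OF x z]] by (simp only: deg)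
      show ?thesis
        unfolding 1 2 3 HH_msign[OF c] HH_add by (rule hclass_eqI[OF tot_bracket_bullet[OF x y z]])
    qed
  qed
qed

end
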